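(* Let $(W,S)$ be an arbitrary Coxeter system, $I\subseteq S$ arbitrary, and use the notation of the context. The sequence $1\to C_I\hookrightarrow N_I\overset{\mathsf A_{\mathrm N}}{\to}\mathcal A_{\mathrm N}\to1$ is exact and $\mathsf A_{\mathrm N}\circ h=\mathrm{id}_{\mathcal A_{\mathrm N}}$. If $\widetilde Y_I=\{w\in N_I\mid(\Phi^{\perp I})^+=w\cdot(\Phi^{\perp I})^+\}$, then $h(\mathcal A_{\mathrm N})\subseteq\widetilde Y_I$, the sequence $1\to Y_I\hookrightarrow\widetilde Y_I\overset{\mathsf A_{\mathrm N}}{\to}\mathcal A_{\mathrm N}\to1$ is exact, and $N_I=W^{\perp I}\rtimes\widetilde Y_I$, where $\widetilde Y_I$ acts on $W^{\perp I}$ as automorphisms of the Coxeter system $(W^{\perp I},R^I)$. Hence $$N_W(W_I)=W_I\rtimes(W^{\perp I}\rtimes\widetilde Y_I)=(W_I\times W^{\perp I})\rtimes\widetilde Y_I.$$ Moreover, for $q\in\pi_1(\mathcal Y^1;x_I)$ and $\rho,\rho_1,\dots,\rho_k\in\mathcal A_{\mathrm N}$, putting $\rho_{[i]}=\rho_1\rho_2\cdots\rho_i$, the following hold in $W$: $$h_\rho^{-1}\,q\,h_\rho=\rho^{-1}\bigl(q_{(\rho(x_I))}\bigr),$$ $$h_{\rho_1}h_{\rho_2}\cdots h_{\rho_k}=p_{x_I,\rho_1(x_I)}\,\rho_{[1]}(p_{x_I,\rho_2(x_I)})\,\rho_{[2]}(p_{x_I,\rho_3(x_I)})\cdots\rh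o_{[k-1]}(p_{x_I,\rho_k(x_I)})\,p_{\rho_{[k]}(x_I),x_I}\,h_{\rho_{[k]}}.$$
   Context: **Coxeter groups.** $(W,S)$ is a Coxeter system, $S$ possibly infinite; $m_{s,t}$ is the order of $st$; $\Gamma$ is the Coxeter graph ($s\ne t$ adjacent iff $m_{s,t}\ge 3$, including $\infty$). $V$ is the real space with basis $\{\alpha_s\mid s\in S\}$ and form $\langle\alpha_s,\alpha_t\rangle=-\cos(\pi/m_{s,t})$ ($=-1$ if $m_{s,t}=\infty$); $W$ acts by $s\cdot v=v-2\langle\alpha_s,v\rangle\alpha_s$. $\Phi=\{w\cdot\alpha_s\}$ is the root system, $\Phi^+$ the positive roots, $\Psi^+=\Psi\cap\Phi^+$ for $\Psi\subseteq\Phi$; $s_\gamma=wsw^{-1}$ for $\gamma=w\cdot\alpha_s$. For $J\subseteq S$, $W_J=\langle J\rangle$, $\Pi_J=\{\alpha_s\mid s\in J\}$; $J$ is of finite type if $W_J$ is finite, and then $w_0(J)$ is the longest element of $W_J$. For $J,K\subseteq S$, $J_{\sim K}$ is the union of those connected components of the full subgraph of $\Gamma$ on $J\cup K$ which meet $K$; $J_{\sim s}=J_{\sim\{s\}}$. $N_W(W_I)$ is the normalizer of $W_I$ in $W$, and $N_I=\{w\in W\mid w\cdot\Pi_I=\Pi_I\}$; it is known that $N_W(W_I)=W_I\rtimes N_I$. **Orthogonal part.** For $J\subseteq S$, $\Phi^{\perp J}=\{\gamma\in\Phi\mid\langle\gamma,\alpha_s\rangle=0\ \forall s\in J\}$,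 $W^{\perp J}=\langle s_\gamma\mid\gamma\in\Phi^{\perp J}\rangle$. It is known that $(W^{\perp J},R^J)$ is a Coxeter system, where $R^J$ consists of the $s_\gamma$ with $\gamma\in(\Phi^{\perp J})^+$ such that in any expression $\gamma=\sum_i c_i\beta_i$ with $c_i>0$, $\beta_i\in(\Phi^{\perp J})^+$, all $\beta_i=\gamma$. **Groupoids.** Fix a set $\Lambda$ with $|\Lambda|=|I|$. $S^{(\Lambda)}$ is the set of injections $x:\Lambda\to S$, $x_\lambda=x(\lambda)$, $[x]=x(\Lambda)$. Fix $x_I\in S^{(\Lambda)}$ with $[x_I]=I$. For $x,y\in S^{(\Lambda)}$ put $C_{x,y}=\{w\in W\mid\alpha_{x_\lambda}=w\cdot\alpha_{y_\lambda}\ \forall\lambda\}$, $\mathcal V(C)=\{x\mid C_{x,x_I}\ne\emptyset\}$; if $w\in C_{x,y}$ write $x=w\cdot y$. $Y_{x,y}=\{w\in C_{x,y}\mid w\cdot(\Phi^{\perp[y]})^+\subseteq\Phi^+\}$, $C_I=C_{x_I,x_I}$, $Y_I=Y_{x_I,x_I}$. **Graph and tree.** For $x\in\mathcal V(C)$ and $s\in S\smallsetminus[x]$ with $[x]_{\sim s}$ of finite type, let $w_x^s=w_0([x]_{\sim s})w_0([x]_{\sim s}\smallsetminus\{s\})$; it lies in $C_{y,x}$ for a unique $y\in\mathcal V(C)$. $\mathcal C$ is the graph with vertex set $\mathcal V(C)$ and edges $w_x^s$ from $x$ to $w_x^s\cdot x$, where $w_x^s$ and its inverse $w_y^t$ ($y=w_x^s\cdot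 x$, $\{t\}=([x]\cup\{s\})\smallsetminus[y]$) are identified as the two orientations of one edge. $\mathcal Y^1$ is $\mathcal C$ with all loops deleted; it is connected. Fix a maximal tree $\mathcal T$ of $\mathcal Y^1$; $p_{z,y}$ is the non-backtracking path in $\mathcal T$ from $y$ to $z$. Paths are written from right to left, and a path from $y$ to $z$ also denotes the element of $C_{z,y}\subseteq W$ it represents. For a path $q$ from $y$ to $z$, $q_{(x)}=p_{x,z}\,q\,p_{y,x}$. **$\mathcal A_{\mathrm N}$, $\mathsf A_{\mathrm N}$, $h$.** Bijections $\rho:\Lambda\to\Lambda$ act on $S^{(\Lambda)}$ by $\rho(y)_\lambda=y_{\rho^{-1}(\lambda)}$. $\mathcal A_{\mathrm N}$ is the set of bijections $\rho$ with $\rho(x_I)\in\mathcal V(C)$; it is a subgroup of $\mathrm{Sym}(\Lambda)$ and acts on the graph $\mathcal C$ by $y\mapsto\rho(y)$, $w_y^s\mapsto w_{\rho(y)}^s$, hence on paths; $p$ and $\rho(p)$ represent the same element of $W$. One has $N_I=\bigsqcup_{\rho\in\mathcal A_{\mathrm N}}C_{x_I,\rho(x_I)}$; $\mathsf A_{\mathrm N}:N_I\to\mathcal A_{\mathrm N}$ sends every $w\in C_{x_I,\rho(x_I)}$ to $\rho$ (a homomorphism), and $h:\mathcal A_{\mathrm N}\to N_I$ is $\rho\mapsto h_\rho=p_{x_I,\rho(x_I)}$. *)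

theory Defs
  imports
    Complex_Main
    "HOL-Algebra.Bij"
    "HOL-Algebra.Exact_Sequence"
    "HOL-Algebra.Generated_Groups"
    "HOL-Algebra.Group_Action"
    "HOL-Algebra.Multiplicative_Group"
    "Graph_Theory.Arc_Walk"
    "Graph_Theory.Digraph_Component"
begin

section \<open>Coxeter systems\<close>

text \<open>\<open>m\<^sub>s\<^sub>,\<^sub>t\<close> is the order of \<open>st\<close>; the value \<open>0\<close> of \<^const>\<open>group.ord\<close> stands for infinite order.\<close>

definition cox_m :: "('a, 'b) monoid_scheme \<Rightarrow> 'a \<Rightarrow> 'a \<Rightarrow> nat"
  where "cox_m W s t = group.ord W (s \<otimes>\<^bsub>W\<^esub> t)"

definition word_prod :: "('a, 'b) monoid_scheme \<Rightarrow> 'a list \<Rightarrow> 'a"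
  where "word_prod W ws = foldr (monoid.mult W) ws \<one>\<^bsub>W\<^esub>"

text \<open>
  \<open>W\<close> has the presentation with generators \<open>S\<close> and relations \<open>(st)\<^sup>m = 1\<close>, where \<open>m = m\<^sub>s\<^sub>,\<^sub>t\<close> is
  finite. The relations \<open>s = t\<close> read \<open>ss = 1\<close>, so it suffices to use words in the letters \<open>S\<close> without
  formal inverses. For \<open>m\<^sub>s\<^sub>,\<^sub>t = \<infinity>\<close> the inserted word is empty and imposes no relation.
\<close>

definition cox_step :: "('a, 'b) monoid_scheme \<Rightarrow> 'a set \<Rightarrow> ('a list \<times> 'a list) set"
  where "cox_step W S = {(u @ v, u @ concat (replicate (cox_m W s t) [s, t]) @ v) | u v s t.
           u \<in> lists S \<and> v \<in> lists S \<and> s \<in> S \<and> t \<in> S}"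

definition coxeter_system :: "('a, 'b) monoid_scheme \<Rightarrow> 'a set \<Rightarrow> bool"
  where "coxeter_system W S \<longleftrightarrow>
    group W \<and> S \<subseteq> carrier W \<and> generate W S = carrier W \<and>
    (\<forall>s\<in>S. group.ord W s = 2) \<and>
    (\<forall>u\<in>lists S. word_prod W u = \<one>\<^bsub>W\<^esub> \<longrightarrow> (u, []) \<in> (cox_step W S \<union> (cox_step W S)\<inverse>)\<^sup>*)"

definition cox_adj :: "('a, 'b) monoid_scheme \<Rightarrow> 'a \<Rightarrow> 'a \<Rightarrow> bool"
  where "cox_adj W s t \<longleftrightarrow> s \<noteq> t \<and> (3 \<le> cox_m W s t \<or> cox_m W s t = 0)"

text \<open>\<open>J\<^sub>\<sim>\<^sub>K\<close>: the vertices in \<open>J \<union> K\<close> joined to an element of \<open>K\<close> by a path inside \<open>J \<union> K\<close>.\<close>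

definition component_hull :: "('a, 'b) monoid_scheme \<Rightarrow> 'a set \<Rightarrow> 'a set \<Rightarrow> 'a set"
  where "component_hull W J K =
    {(s, t). s \<in> J \<union> K \<and> t \<in> J \<union> K \<and> cox_adj W s t}\<^sup>* `` K"

definition cox_length :: "('a, 'b) monoid_scheme \<Rightarrow> 'a set \<Rightarrow> 'a \<Rightarrow> nat"
  where "cox_length W S w = (LEAST n. \<exists>ws\<in>lists S. length ws = n \<and> word_prod W ws = w)"

definition longest :: "('a, 'b) monoid_scheme \<Rightarrow> 'a set \<Rightarrow> 'a set \<Rightarrow> 'a"
  where "longest W S J = (ARG_MAX (cox_length W S) w. w \<in> generate W J)"


section \<open>The geometric representation\<close>

text \<open>
  Vectors of \<open>V\<close> are given by their coordinates with respect to the basis \<open>\<alpha>\<^sub>s\<close>, i.e. as finitely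
  supported functions vanishing outside \<open>S\<close>.
\<close>

type_synonym 'a vec = "'a \<Rightarrow> real"

definition simple_root :: "'a \<Rightarrow> 'a vec"
  where "simple_root s = (\<lambda>t. if t = s then 1 else 0)"

definition cox_form :: "('a, 'b) monoid_scheme \<Rightarrow> 'a vec \<Rightarrow> 'a vec \<Rightarrow> real"
  where "cox_form W u v = (\<Sum>s | u s \<noteq> 0. \<Sum>t | v t \<noteq> 0.
    u s * v t * (if cox_m W s t = 0 then - 1 else - cos (pi / real (cox_m W s t))))"

definition reflect :: "('a, 'b) monoid_scheme \<Rightarrow> 'a \<Rightarrow> 'a vec \<Rightarrow> 'a vec"
  where "reflect W s v = (\<lambda>t. v t - 2 * cox_form W (simple_root s) v * simple_root s t)"

text \<open>
  The action of \<open>W\<close> on \<open>V\<close>: apply the simple reflections along any expression of \<open>w\<close>. For a Coxeter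
  system the result does not depend on the expression.
\<close>

definition cox_act :: "('a, 'b) monoid_scheme \<Rightarrow> 'a set \<Rightarrow> 'a \<Rightarrow> 'a vec \<Rightarrow> 'a vec"
  where "cox_act W S w v =
    (THE v'. \<exists>ws\<in>lists S. word_prod W ws = w \<and> v' = foldr (reflect W) ws v)"

definition roots :: "('a, 'b) monoid_scheme \<Rightarrow> 'a set \<Rightarrow> 'a vec set"
  where "roots W S = {cox_act W S w (simple_root s) | w s. w \<in> carrier W \<and> s \<in> S}"

definition positive_part :: "'a vec set \<Rightarrow> 'a vec set"
  where "positive_part \<Psi> = {\<gamma> \<in> \<Psi>. \<forall>s. 0 \<le> \<gamma> s}"

definition root_reflection :: "('a, 'b) monoid_scheme \<Rightarrow> 'a set \<Rightarrow> 'a vec \<Rightarrow> 'a"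
  where "root_reflection W S \<gamma> = (THE r. \<exists>w\<in>carrier W. \<exists>s\<in>S.
    \<gamma> = cox_act W S w (simple_root s) \<and> r = w \<otimes>\<^bsub>W\<^esub> s \<otimes>\<^bsub>W\<^esub> inv\<^bsub>W\<^esub> w)"

definition perp_roots :: "('a, 'b) monoid_scheme \<Rightarrow> 'a set \<Rightarrow> 'a set \<Rightarrow> 'a vec set"
  where "perp_roots W S J = {\<gamma> \<in> roots W S. \<forall>s\<in>J. cox_form W \<gamma> (simple_root s) = 0}"

definition perp_group :: "('a, 'b) monoid_scheme \<Rightarrow> 'a set \<Rightarrow> 'a set \<Rightarrow> 'a set"
  where "perp_group W S J = generate W (root_reflection W S ` perp_roots W S J)"

definition perp_gens :: "('a, 'b) monoid_scheme \<Rightarrow> 'a set \<Rightarrow> 'a set \<Rightarrow> 'a set"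
  where "perp_gens W S J = root_reflection W S `
    {\<gamma> \<in> positive_part (perp_roots W S J).
       \<forall>(n::nat) c \<beta>. (\<forall>i<n. 0 < c i \<and> \<beta> i \<in> positive_part (perp_roots W S J)) \<and>
                 \<gamma> = (\<lambda>t. \<Sum>i<n. c i * \<beta> i t) \<longrightarrow> (\<forall>i<n. \<beta> i = \<gamma>)}"

definition NI :: "('a, 'b) monoid_scheme \<Rightarrow> 'a set \<Rightarrow> 'a set \<Rightarrow> 'a set"
  where "NI W S I = {w \<in> carrier W. cox_act W S w ` simple_root ` I = simple_root ` I}"

definition Y_tilde :: "('a, 'b) monoid_scheme \<Rightarrow> 'a set \<Rightarrow> 'a set \<Rightarrow> 'a set"
  where "Y_tilde W S I = {w \<in> NI W S I.
    positive_part (perp_roots W S I) = cox_act W S w ` positive_part (perp_roots W S I)}"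


section \<open>The groupoids\<close>

text \<open>Maps on \<open>\<Lambda>\<close> are taken extensional, so that equality of maps is equality on \<open>\<Lambda>\<close>.\<close>

definition inj_maps :: "'l set \<Rightarrow> 'a set \<Rightarrow> ('l \<Rightarrow> 'a) set"
  where "inj_maps \<Lambda> S = {x \<in> \<Lambda> \<rightarrow>\<^sub>E S. inj_on x \<Lambda>}"

definition C_hom :: "('a, 'b) monoid_scheme \<Rightarrow> 'a set \<Rightarrow> 'l set \<Rightarrow> ('l \<Rightarrow> 'a) \<Rightarrow> ('l \<Rightarrow> 'a) \<Rightarrow> 'a set"
  where "C_hom W S \<Lambda> x y =
    {w \<in> carrier W. \<forall>l\<in>\<Lambda>. simple_root (x l) = cox_act W S w (simple_root (y l))}"

definition C_verts :: "('a, 'b) monoid_scheme \<Rightarrow> 'a set \<Rightarrow> 'l set \<Rightarrow> ('l \<Rightarrow> 'a) \<Rightarrow> ('l \<Rightarrow> 'a) set"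
  where "C_verts W S \<Lambda> xI = {x \<in> inj_maps \<Lambda> S. C_hom W S \<Lambda> x xI \<noteq> {}}"

text \<open>\<open>w \<cdot> y\<close>, meaningful if \<open>w \<in> C\<^sub>x\<^sub>,\<^sub>y\<close> for some \<open>x\<close>.\<close>

definition map_act :: "('a, 'b) monoid_scheme \<Rightarrow> 'a set \<Rightarrow> 'l set \<Rightarrow> 'a \<Rightarrow> ('l \<Rightarrow> 'a) \<Rightarrow> 'l \<Rightarrow> 'a"
  where "map_act W S \<Lambda> w y = (THE x. x \<in> inj_maps \<Lambda> S \<and> w \<in> C_hom W S \<Lambda> x y)"

definition Y_hom :: "('a, 'b) monoid_scheme \<Rightarrow> 'a set \<Rightarrow> 'l set \<Rightarrow> ('l \<Rightarrow> 'a) \<Rightarrow> ('l \<Rightarrow> 'a) \<Rightarrow> 'a set"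
  where "Y_hom W S \<Lambda> x y = {w \<in> C_hom W S \<Lambda> x y.
    cox_act W S w ` positive_part (perp_roots W S (y ` \<Lambda>)) \<subseteq> positive_part (roots W S)}"


section \<open>Paths, trees and fundamental groups\<close>

text \<open>
  Graphs are digraphs together with a map \<open>einv\<close> sending an oriented edge to the same edge with the
  opposite orientation. Paths are written from right to left: the last arc in the list is traversed
  first, and \<open>p @ q\<close> is the path \<open>q\<close> followed by \<open>p\<close>.
\<close>

definition is_path :: "('v, 'e) pre_digraph \<Rightarrow> 'v \<Rightarrow> 'e list \<Rightarrow> 'v \<Rightarrow> bool"
  where "is_path G z p y \<longleftrightarrow> pre_digraph.awalk G y (rev p) z"

definition non_backtracking :: "('e \<Rightarrow> 'e) \<Rightarrow> 'e list \<Rightarrow> bool"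
  where "non_backtracking einv p \<longleftrightarrow> successively (\<lambda>e f. e \<noteq> einv f) p"

text \<open>
  The arcs of a tree are closed under \<open>einv\<close>, hence strong connectedness is connectedness. A directed
  cycle is a circuit of the undirected graph unless it runs back and forth along a single edge.
\<close>

definition is_tree :: "('e \<Rightarrow> 'e) \<Rightarrow> ('v, 'e) pre_digraph \<Rightarrow> bool"
  where "is_tree einv G \<longleftrightarrow> einv ` arcs G \<subseteq> arcs G \<and> strongly_connected G \<and>
    \<not> (\<exists>p. pre_digraph.cycle G p \<and> non_backtracking einv p)"

definition maximal_tree :: "('e \<Rightarrow> 'e) \<Rightarrow> ('v, 'e) pre_digraph \<Rightarrow> ('v, 'e) pre_digraph \<Rightarrow> bool"
  where "maximal_tree einv G T \<longleftrightarrow> pre_digraph.max_subgraph G (is_tree einv) T"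

definition tree_path :: "('e \<Rightarrow> 'e) \<Rightarrow> ('v, 'e) pre_digraph \<Rightarrow> 'v \<Rightarrow> 'v \<Rightarrow> 'e list"
  where "tree_path einv T z y = (THE p. is_path T z p y \<and> non_backtracking einv p)"

text \<open>Two closed paths are homotopic if they differ by inserting and deleting subpaths \<open>e\<inverse>e\<close>.\<close>

definition homotopy :: "('e \<Rightarrow> 'e) \<Rightarrow> ('v, 'e) pre_digraph \<Rightarrow> 'v \<Rightarrow> ('e list \<times> 'e list) set"
  where "homotopy einv G x =
    (let R = {(p @ q, p @ [einv e, e] @ q) | p q e.
                is_path G x (p @ q) x \<and> is_path G x (p @ [einv e, e] @ q) x}
     in Restr ((R \<union> R\<inverse>)\<^sup>*) {p. is_path G x p x})"

definition pi1 :: "('e \<Rightarrow> 'e) \<Rightarrow> ('v, 'e) pre_digraph \<Rightarrow> 'v \<Rightarrow> 'e list set set"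
  where "pi1 einv G x = {p. is_path G x p x} // homotopy einv G x"

text \<open>\<open>q\<^sub>(\<^sub>x\<^sub>)\<close> for a path \<open>q\<close> from \<open>y\<close> to \<open>z\<close>.\<close>

definition transport ::
    "('e \<Rightarrow> 'e) \<Rightarrow> ('v, 'e) pre_digraph \<Rightarrow> 'v \<Rightarrow> 'v \<Rightarrow> 'v \<Rightarrow> 'e list \<Rightarrow> 'e list"
  where "transport einv T x z y q = tree_path einv T x z @ q @ tree_path einv T y x"


section \<open>The graph \<open>\<C>\<close>\<close>

text \<open>The oriented edge \<open>w\<^sub>x\<^sup>s\<close> starting at \<open>x\<close> is encoded as the pair \<open>(x, s)\<close>.\<close>

type_synonym ('l, 'a) edge = "('l \<Rightarrow> 'a) \<times> 'a"

fun edge_elt :: "('a, 'b) monoid_scheme \<Rightarrow> 'a set \<Rightarrow> 'l set \<Rightarrow> ('l, 'a) edge \<Rightarrow> 'a"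
  where "edge_elt W S \<Lambda> (x, s) =
    (let K = component_hull W (x ` \<Lambda>) {s} in longest W S K \<otimes>\<^bsub>W\<^esub> longest W S (K - {s}))"

definition edge_target :: "('a, 'b) monoid_scheme \<Rightarrow> 'a set \<Rightarrow> 'l set \<Rightarrow> ('l, 'a) edge \<Rightarrow> 'l \<Rightarrow> 'a"
  where "edge_target W S \<Lambda> e = map_act W S \<Lambda> (edge_elt W S \<Lambda> e) (fst e)"

definition edge_inv :: "('a, 'b) monoid_scheme \<Rightarrow> 'a set \<Rightarrow> 'l set \<Rightarrow> ('l, 'a) edge \<Rightarrow> ('l, 'a) edge"
  where "edge_inv W S \<Lambda> e = (let y = edge_target W S \<Lambda> e in
    (y, THE t. {t} = (fst e ` \<Lambda> \<union> {snd e}) - y ` \<Lambda>))"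

definition C_graph ::
    "('a, 'b) monoid_scheme \<Rightarrow> 'a set \<Rightarrow> 'l set \<Rightarrow> ('l \<Rightarrow> 'a) \<Rightarrow> ('l \<Rightarrow> 'a, ('l, 'a) edge) pre_digraph"
  where "C_graph W S \<Lambda> xI =
    \<lparr>verts = C_verts W S \<Lambda> xI,
     arcs = {(x, s). x \<in> C_verts W S \<Lambda> xI \<and> s \<in> S - x ` \<Lambda> \<and>
                     finite (generate W (component_hull W (x ` \<Lambda>) {s}))},
     tail = fst,
     head = edge_target W S \<Lambda>\<rparr>"

definition Y1_graph ::
    "('a, 'b) monoid_scheme \<Rightarrow> 'a set \<Rightarrow> 'l set \<Rightarrow> ('l \<Rightarrow> 'a) \<Rightarrow> ('l \<Rightarrow> 'a, ('l, 'a) edge) pre_digraph"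
  where "Y1_graph W S \<Lambda> xI =
    (let G = C_graph W S \<Lambda> xI in G\<lparr>arcs := {e \<in> arcs G. tail G e \<noteq> head G e}\<rparr>)"

definition path_elt :: "('a, 'b) monoid_scheme \<Rightarrow> 'a set \<Rightarrow> 'l set \<Rightarrow> ('l, 'a) edge list \<Rightarrow> 'a"
  where "path_elt W S \<Lambda> p = word_prod W (map (edge_elt W S \<Lambda>) p)"


section \<open>The group \<open>\<A>\<^sub>N\<close> and its section\<close>

definition perm_act :: "'l set \<Rightarrow> ('l \<Rightarrow> 'l) \<Rightarrow> ('l \<Rightarrow> 'a) \<Rightarrow> 'l \<Rightarrow> 'a"
  where "perm_act \<Lambda> \<rho> y = compose \<Lambda> y (inv\<^bsub>BijGroup \<Lambda>\<^esub> \<rho>)"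

definition perm_path :: "'l set \<Rightarrow> ('l \<Rightarrow> 'l) \<Rightarrow> ('l, 'a) edge list \<Rightarrow> ('l, 'a) edge list"
  where "perm_path \<Lambda> \<rho> = map (\<lambda>(y, s). (perm_act \<Lambda> \<rho> y, s))"

definition AN :: "('a, 'b) monoid_scheme \<Rightarrow> 'a set \<Rightarrow> 'l set \<Rightarrow> ('l \<Rightarrow> 'a) \<Rightarrow> ('l \<Rightarrow> 'l) set"
  where "AN W S \<Lambda> xI = {\<rho> \<in> Bij \<Lambda>. perm_act \<Lambda> \<rho> xI \<in> C_verts W S \<Lambda> xI}"

definition AN_group :: "('a, 'b) monoid_scheme \<Rightarrow> 'a set \<Rightarrow> 'l set \<Rightarrow> ('l \<Rightarrow> 'a) \<Rightarrow> ('l \<Rightarrow> 'l) monoid"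
  where "AN_group W S \<Lambda> xI = (BijGroup \<Lambda>)\<lparr>carrier := AN W S \<Lambda> xI\<rparr>"

definition AN_map :: "('a, 'b) monoid_scheme \<Rightarrow> 'a set \<Rightarrow> 'l set \<Rightarrow> ('l \<Rightarrow> 'a) \<Rightarrow> 'a \<Rightarrow> 'l \<Rightarrow> 'l"
  where "AN_map W S \<Lambda> xI w =
    (THE \<rho>. \<rho> \<in> AN W S \<Lambda> xI \<and> w \<in> C_hom W S \<Lambda> xI (perm_act \<Lambda> \<rho> xI))"

definition p_path :: "('a, 'b) monoid_scheme \<Rightarrow> 'a set \<Rightarrow> 'l set \<Rightarrow>
    ('l \<Rightarrow> 'a, ('l, 'a) edge) pre_digraph \<Rightarrow> ('l \<Rightarrow> 'a) \<Rightarrow> ('l \<Rightarrow> 'a) \<Rightarrow> ('l, 'a) edge list"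
  where "p_path W S \<Lambda> T z y = tree_path (edge_inv W S \<Lambda>) T z y"

definition h_map :: "('a, 'b) monoid_scheme \<Rightarrow> 'a set \<Rightarrow> 'l set \<Rightarrow>
    ('l \<Rightarrow> 'a, ('l, 'a) edge) pre_digraph \<Rightarrow> ('l \<Rightarrow> 'a) \<Rightarrow> ('l \<Rightarrow> 'l) \<Rightarrow> 'a"
  where "h_map W S \<Lambda> T xI \<rho> = path_elt W S \<Lambda> (p_path W S \<Lambda> T xI (perm_act \<Lambda> \<rho> xI))"

definition perm_prod :: "'l set \<Rightarrow> (nat \<Rightarrow> 'l \<Rightarrow> 'l) \<Rightarrow> nat \<Rightarrow> 'l \<Rightarrow> 'l"
  where "perm_prod \<Lambda> r i = foldr (monoid.mult (BijGroup \<Lambda>)) (map r [1..<Suc i]) \<one>\<^bsub>BijGroup \<Lambda>\<^esub>"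


section \<open>Exact sequences and products of subgroups\<close>

text \<open>
  The library's \<open>short_exact_sequence\<close> requires all groups to have the same element type; this is
  the characterization from its lemma \<open>short_exact_sequence_iff\<close> for different types.
\<close>

definition short_exact :: "('a, 'c) monoid_scheme \<Rightarrow> ('b, 'd) monoid_scheme \<Rightarrow> ('e, 'f) monoid_scheme
    \<Rightarrow> ('a \<Rightarrow> 'b) \<Rightarrow> ('b \<Rightarrow> 'e) \<Rightarrow> bool"
  where "short_exact A B C f g \<longleftrightarrow> group A \<and> group B \<and> group C \<and>
    f \<in> mon A B \<and> g \<in> epi B C \<and> kernel B C g = f ` carrier A"

lemma short_exact_iff_library:
  "short_exact A B C f g \<longleftrightarrow> short_exact_sequence C B A g f"
  unfolding short_exact_def short_exact_sequence_iff
  by (auto simp: group_hom_def group_hom_axioms_def mon_def epi_def)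

text \<open>The subgroup \<open>A\<close> of \<open>G\<close> is the internal semidirect product \<open>N \<rtimes> H\<close>, resp. the internal direct
  product \<open>N \<times> K\<close>.\<close>

definition is_semidirect :: "('a, 'b) monoid_scheme \<Rightarrow> 'a set \<Rightarrow> 'a set \<Rightarrow> 'a set \<Rightarrow> bool"
  where "is_semidirect G A N H \<longleftrightarrow> subgroup A G \<and> N \<lhd> G\<lparr>carrier := A\<rparr> \<and>
    subgroup H (G\<lparr>carrier := A\<rparr>) \<and> N \<inter> H = {\<one>\<^bsub>G\<^esub>} \<and> N <#>\<^bsub>G\<^esub> H = A"

definition is_direct :: "('a, 'b) monoid_scheme \<Rightarrow> 'a set \<Rightarrow> 'a set \<Rightarrow> 'a set \<Rightarrow> bool"
  where "is_direct G A N K \<longleftrightarrow> subgroup A G \<and> N \<lhd> G\<lparr>carrier := A\<rparr> \<and>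
    K \<lhd> G\<lparr>carrier := A\<rparr> \<and> N \<inter> K = {\<one>\<^bsub>G\<^esub>} \<and> N <#>\<^bsub>G\<^esub> K = A"

definition conj_on :: "('a, 'b) monoid_scheme \<Rightarrow> 'a set \<Rightarrow> 'a \<Rightarrow> 'a \<Rightarrow> 'a"
  where "conj_on G N w = (\<lambda>u\<in>N. w \<otimes>\<^bsub>G\<^esub> u \<otimes>\<^bsub>G\<^esub> inv\<^bsub>G\<^esub> w)"

definition coxeter_Aut :: "('a, 'b) monoid_scheme \<Rightarrow> 'a set \<Rightarrow> ('a \<Rightarrow> 'a) monoid"
  where "coxeter_Aut G R = (AutoGroup G)\<lparr>carrier := {f \<in> auto G. f ` R = R}\<rparr>"

end

theory Submission
  imports Defs
begin

text \<open>
  Every root is positive or negative (by induction on length, splitting off a maximal dihedral suffix),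
  so \<open>W\<close> acts faithfully on \<open>V\<close> and an element inverts only finitely many positive roots.

  For a set of roots \<open>\<Psi>\<close> closed under its own reflections, multiplying by \<open>s\<^sub>\<gamma>\<close> for an inverted \<open>\<gamma> \<in> \<Psi>\<close>
  lowers the number of inverted roots of \<open>\<Psi>\<close>, and an element of the reflection group of \<open>\<Psi>\<close> that
  inverts no root of \<open>\<Psi>\<close> is trivial. For \<open>\<Psi> = \<Phi>\<^sup>\<bottom>\<^sup>I\<close> this gives the semidirect decomposition of \<open>N\<^sub>I\<close>;
  that of the normalizer follows because a minimal representative of a coset of \<open>W\<^sub>I\<close> normalizing \<open>W\<^sub>I\<close>
  permutes \<open>\<Pi>\<^sub>I\<close>.

  If \<open>w \<in> C\<^sub>x\<^sub>,\<^sub>y\<close> inverts \<open>\<alpha>\<^sub>s\<close>, it inverts all positive roots supported in \<open>[y]\<^sub>\<sim>\<^sub>s\<close> that involve \<open>s\<close>. These are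
  finitely many, which forces \<open>[y]\<^sub>\<sim>\<^sub>s\<close> to be of finite type, and \<open>w\<close> splits off \<open>w\<^sub>y\<^sup>s\<close> on the right, so the
  graph is connected and the maximal tree spans it. If \<open>w\<^sub>x\<^sup>s\<close> inverts a root orthogonal to \<open>[x]\<close>, it is
  the reflection in that root and hence a loop; so paths in \<open>\<Y>\<^sup>1\<close>, in particular the elements \<open>h\<^sub>\<rho>\<close>,
  lie in the groupoid \<open>Y\<close>.
\<close>

section \<open>The geometric representation\<close>

text \<open>W may be infinite and of infinite rank, so neither a longest element of W nor a finite
  root system is at hand. Once the signs of roots are known, inductions mostly count inverted roots:
  these are finite in number and, unlike word length, can be restricted to a subset \<Psi> of the
  roots. The objects given by definite description each need their own uniqueness argument:
  \<open>cox_act\<close> the braid relations on V, \<open>root_reflection\<close> the faithfulness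
  of the action, \<open>tree_path\<close> the acyclicity of the tree. The two exact sequences are
  instances of one statement about a subgroup of N_I that meets C_hom from \<rho>(x_I) to x_I for
  every \<rho>; the elements h_\<rho> are the witnesses in both cases. The map h need not be a
  homomorphism, and the closing formula expresses its defect by paths.\<close>

lemma support_sum_extend:
  fixes u :: "'a \<Rightarrow> real"
  assumes "finite F" "{s. u s \<noteq> 0} \<subseteq> F"
  shows "(\<Sum>s | u s \<noteq> 0. u s * f s) = (\<Sum>s\<in>F. u s * f s)"
  using assms by (intro sum.mono_neutral_left) auto

text \<open>The entries of the form on simple roots, named so that bilinear computations do not meet
  the case split on infinite order.\<close>

definition gram :: "('a, 'b) monoid_scheme \<Rightarrow> 'a \<Rightarrow> 'a \<Rightarrow> real"
  where "gram W s t = (if cox_m W s t = 0 then - 1 else - cos (pi / real (cox_m W s t)))"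

text \<open>Vectors are bare functions, so linearity of every map is phrased through this one binary
  combination; negation and reflections are instances of it.\<close>

definition lincomb :: "real \<Rightarrow> 'a vec \<Rightarrow> real \<Rightarrow> 'a vec \<Rightarrow> 'a vec"
  where "lincomb a u b v = (\<lambda>t. a * u t + b * v t)"

lemma lincomb_apply: "lincomb a u b v t = a * u t + b * v t"
  by (simp add: lincomb_def)

lemma simple_root_apply: "simple_root s t = (if t = s then 1 else 0)"
  by (simp add: simple_root_def)

lemma simple_root_inj: "simple_root s = simple_root t \<longleftrightarrow> s = t"
  by (metis simple_root_def zero_neq_one)

lemma supp_simple_root [simp]: "{t. simple_root s t \<noteq> 0} = {s}"
  by (auto simp: simple_root_def)

locale coxeter = group W for W :: "('a, 'b) monoid_scheme" (structure) +
  fixes S :: "'a set"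
  assumes coxeter: "coxeter_system W S"
begin

abbreviation act where "act \<equiv> cox_act W S"
abbreviation B where "B \<equiv> cox_form W"
abbreviation kf where "kf \<equiv> gram W"
abbreviation wp where "wp \<equiv> word_prod W"
abbreviation rf where "rf \<equiv> reflect W"

lemma S_carrier: "S \<subseteq> carrier W" and S_generate: "generate W S = carrier W"
  and S_ord: "s \<in> S \<Longrightarrow> ord s = 2"
  and S_relations: "\<lbrakk>u \<in> lists S; wp u = \<one>\<rbrakk> \<Longrightarrow> (u, []) \<in> (cox_step W S \<union> (cox_step W S)\<inverse>)\<^sup>*"
  using coxeter unfolding coxeter_system_def by auto

lemma S_closed [simp, intro]: "s \<in> S \<Longrightarrow> s \<in> carrier W"
  using S_carrier by auto

lemma S_square: "s \<in> S \<Longrightarrow> s \<otimes> s = \<one>"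
  using pow_ord_eq_1[of s] S_ord[of s] by (auto simp: numeral_2_eq_2)

lemma S_inv [simp]: "s \<in> S \<Longrightarrow> inv s = s"
  using S_square by (simp add: inv_equality)

lemma wp_Nil [simp]: "wp [] = \<one>"
  by (simp add: word_prod_def)

lemma wp_Cons [simp]: "wp (x # xs) = x \<otimes> wp xs"
  by (simp add: word_prod_def)

lemma wp_closed: "xs \<in> lists (carrier W) \<Longrightarrow> wp xs \<in> carrier W"
  by (induction xs) auto

lemma wp_append: "\<lbrakk>xs \<in> lists (carrier W); ys \<in> lists (carrier W)\<rbrakk> \<Longrightarrow> wp (xs @ ys) = wp xs \<otimes> wp ys"
  by (induction xs) (auto simp: m_assoc wp_closed)

lemma lists_S_carrier: "xs \<in> lists S \<Longrightarrow> xs \<in> lists (carrier W)"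
  using S_carrier by auto

lemma wp_closed_S [simp]: "xs \<in> lists S \<Longrightarrow> wp xs \<in> carrier W"
  using wp_closed lists_S_carrier by blast

lemma wp_append_S: "\<lbrakk>xs \<in> lists S; ys \<in> lists S\<rbrakk> \<Longrightarrow> wp (xs @ ys) = wp xs \<otimes> wp ys"
  using wp_append lists_S_carrier by blast

lemma wp_rev_involutions:
  assumes "xs \<in> lists X" "X \<subseteq> carrier W" "\<And>x. x \<in> X \<Longrightarrow> inv x = x"
  shows "wp (rev xs) = inv (wp xs)"
  using assms(1)
proof (induction xs)
  case (Cons x xs)
  then have "x \<in> carrier W" "rev xs \<in> lists (carrier W)" "xs \<in> lists (carrier W)"
    using assms(2) by auto
  then show ?case
    using Cons assms(3)[of x] by (auto simp: wp_append wp_closed inv_mult_group)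
qed auto

text \<open>Inverses of generators are generators, so words without formal inverses reach the whole
  subgroup. Used for subsets of S and for sets of reflections alike.\<close>

lemma generate_involutions:
  assumes "X \<subseteq> carrier W" "\<And>x. x \<in> X \<Longrightarrow> inv x = x"
  shows "generate W X = wp ` lists X"
proof -
  have X: "xs \<in> lists X \<Longrightarrow> xs \<in> lists (carrier W)" for xs
    using assms(1) by auto
  have "w \<in> wp ` lists X" if "w \<in> generate W X" for w
    using that
  proof (induction w)
    case one
    have "\<one> = wp []" by simp
    then show ?case by blast
  next
    case (incl h)
    then have "h = wp [h]" using assms(1) by auto
    then show ?case using incl by (metis image_eqI lists.Cons lists.Nil)
  next
    case (inv h)
    then have "inv h = wp [h]" using assms by auto
    then show ?case using inv by (metis image_eqI lists.Cons lists.Nil)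
  next
    case (eng h1 h2)
    then obtain xs ys where "h1 = wp xs" "h2 = wp ys" "xs \<in> lists X" "ys \<in> lists X" by auto
    then have "h1 \<otimes> h2 = wp (xs @ ys)" "xs @ ys \<in> lists X" using X by (simp_all add: wp_append)
    then show ?case by blast
  qed
  moreover have "wp xs \<in> generate W X" if "xs \<in> lists X" for xs
    using that by (induction xs) (auto intro: generate.intros)
  ultimately show ?thesis by blast
qed

lemma generate_eq_words: "J \<subseteq> S \<Longrightarrow> generate W J = wp ` lists J"
  by (rule generate_involutions) auto

lemma word_exists:
  assumes "w \<in> carrier W" obtains ws where "ws \<in> lists S" "wp ws = w"
proof -
  have "w \<in> wp ` lists S" using assms S_generate generate_eq_words[of S] by simp
  then show ?thesis using that by (elim imageE) simp
qed

lemma generate_S_closed: "\<lbrakk>J \<subseteq> S; w \<in> generate W J\<rbrakk> \<Longrightarrow> w \<in> carrier W"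
  using generate_incl S_carrier by blast

section \<open>The space V and its bilinear form\<close>

definition V :: "'a vec set" where "V = {v. finite {s. v s \<noteq> 0} \<and> {s. v s \<noteq> 0} \<subseteq> S}"

lemma V_I: "\<lbrakk>finite F; F \<subseteq> S; \<And>s. s \<notin> F \<Longrightarrow> v s = 0\<rbrakk> \<Longrightarrow> v \<in> V"
  unfolding V_def by (auto intro: finite_subset[of _ F])

lemma V_fin: "v \<in> V \<Longrightarrow> finite {s. v s \<noteq> 0}" and V_supp: "v \<in> V \<Longrightarrow> v s \<noteq> 0 \<Longrightarrow> s \<in> S"
  unfolding V_def by auto

lemma simple_root_V [simp]: "s \<in> S \<Longrightarrow> simple_root s \<in> V"
  by (auto simp: V_def)

lemma lincomb_V [simp]: "\<lbrakk>u \<in> V; v \<in> V\<rbrakk> \<Longrightarrow> lincomb a u b v \<in> V"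
  by (rule V_I[of "{s. u s \<noteq> 0} \<union> {s. v s \<noteq> 0}"]) (auto simp: V_fin V_supp lincomb_def)

lemma m_sym: "\<lbrakk>s \<in> S; t \<in> S\<rbrakk> \<Longrightarrow> cox_m W s t = cox_m W t s"
  using ord_inv[of "s \<otimes> t"] by (simp add: cox_m_def inv_mult_group)

lemma kf_sym: "\<lbrakk>s \<in> S; t \<in> S\<rbrakk> \<Longrightarrow> kf s t = kf t s"
  using m_sym by (simp add: gram_def)

lemma m_same: "s \<in> S \<Longrightarrow> cox_m W s s = 1"
  by (simp add: cox_m_def S_square)

lemma kf_same [simp]: "s \<in> S \<Longrightarrow> kf s s = 1"
  by (simp add: gram_def m_same)

lemma m_eq_1: "\<lbrakk>s \<in> S; t \<in> S; cox_m W s t = 1\<rbrakk> \<Longrightarrow> s = t"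
  by (metis S_closed S_inv cox_m_def inv_equality m_closed ord_eq_1)

text \<open>The angle \<pi>/m is at most \<pi>/3, so its cosine is positive. Strict negativity along
  edges is what propagates non-orthogonality through a component in
  \<open>component_finite\<close>.\<close>

lemma kf_less_0:
  assumes "cox_adj W s t" shows "kf s t < 0"
proof (cases "cox_m W s t = 0")
  case False
  then have m: "cox_m W s t \<ge> 3" using assms by (auto simp: cox_adj_def)
  then have "pi / real (cox_m W s t) \<le> pi / 3" by (intro divide_left_mono) auto
  moreover have "0 \<le> pi / real (cox_m W s t)" by simp
  moreover have "pi/3 < pi/2" by simp
  ultimately have "cos (pi / real (cox_m W s t)) > 0" by (intro cos_gt_zero_pi) linarith+
  then show ?thesis using False by (simp add: gram_def)
qed (simp add: gram_def)

lemma kf_eq_0: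
  assumes "s \<in> S" "t \<in> S" "s \<noteq> t" "\<not> cox_adj W s t" shows "kf s t = 0"
proof -
  have "cox_m W s t \<noteq> 1" using assms m_eq_1 by auto
  then have "cox_m W s t = 2" using assms by (auto simp: cox_adj_def)
  then show ?thesis by (simp add: gram_def)
qed

lemma cox_adj_sym: "\<lbrakk>s \<in> S; t \<in> S; cox_adj W s t\<rbrakk> \<Longrightarrow> cox_adj W t s"
  using m_sym by (auto simp: cox_adj_def)

text \<open>Frees the double sum from the exact supports, so that vectors with different supports
  can be summed over common index sets.\<close>

lemma B_eq:
  assumes "finite F" "finite G" "{s. u s \<noteq> 0} \<subseteq> F" "{s. v s \<noteq> 0} \<subseteq> G"
  shows "B u v = (\<Sum>s\<in>F. \<Sum>t\<in>G. u s * v t * kf s t)"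
proof -
  have "B u v = (\<Sum>s | u s \<noteq> 0. u s * (\<Sum>t | v t \<noteq> 0. v t * kf s t))"
    unfolding cox_form_def gram_def by (simp add: sum_distrib_left mult.assoc)
  also have "\<dots> = (\<Sum>s\<in>F. u s * (\<Sum>t\<in>G. v t * kf s t))"
    using assms by (simp add: support_sum_extend)
  finally show ?thesis by (simp add: sum_distrib_left mult.assoc)
qed

lemma B_sym:
  assumes "u \<in> V" "v \<in> V" shows "B u v = B v u"
proof -
  let ?F = "{s. u s \<noteq> 0}" and ?G = "{s. v s \<noteq> 0}"
  have "B u v = (\<Sum>s\<in>?F. \<Sum>t\<in>?G. u s * v t * kf s t)"
    using assms by (intro B_eq) (auto simp: V_fin)
  also have "\<dots> = (\<Sum>t\<in>?G. \<Sum>s\<in>?F. u s * v t * kf s t)" by (rule sum.swap)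
  also have "\<dots> = (\<Sum>t\<in>?G. \<Sum>s\<in>?F. v t * u s * kf t s)"
    using assms V_supp by (intro sum.cong refl) (auto simp: kf_sym)
  also have "\<dots> = B v u" using assms by (intro B_eq[symmetric]) (auto simp: V_fin)
  finally show ?thesis .
qed

lemma B_lincomb_right:
  assumes "u \<in> V" "v \<in> V" "w \<in> V"
  shows "B w (lincomb a u b v) = a * B w u + b * B w v"
proof -
  let ?F = "{s. w s \<noteq> 0}" and ?G = "{s. u s \<noteq> 0} \<union> {s. v s \<noteq> 0}"
  have fin: "finite ?F" "finite ?G" using assms V_fin by auto
  have "B w (lincomb a u b v) = (\<Sum>s\<in>?F. \<Sum>t\<in>?G. w s * (lincomb a u b v t) * kf s t)"
    by (rule B_eq[OF fin]) (auto simp: lincomb_def)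
  also have "\<dots> = a * (\<Sum>s\<in>?F. \<Sum>t\<in>?G. w s * u t * kf s t) + b * (\<Sum>s\<in>?F. \<Sum>t\<in>?G. w s * v t * kf s t)"
    by (simp add: lincomb_def algebra_simps sum.distrib sum_distrib_left)
  also have "(\<Sum>s\<in>?F. \<Sum>t\<in>?G. w s * u t * kf s t) = B w u" by (rule B_eq[OF fin, symmetric]) auto
  also have "(\<Sum>s\<in>?F. \<Sum>t\<in>?G. w s * v t * kf s t) = B w v" by (rule B_eq[OF fin, symmetric]) auto
  finally show ?thesis .
qed

lemma B_lincomb_left:
  assumes "u \<in> V" "v \<in> V" "w \<in> V"
  shows "B (lincomb a u b v) w = a * B u w + b * B v w"
  using assms B_lincomb_right by (simp add: B_sym[of _ w])

lemma B_simple: "s \<in> S \<Longrightarrow> t \<in> S \<Longrightarrow> B (simple_root s) (simple_root t) = kf s t"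
  by (subst B_eq[of "{s}" "{t}"]) (auto simp: simple_root_def)

lemma B_simple_left: "v \<in> V \<Longrightarrow> B (simple_root s) v = (\<Sum>t | v t \<noteq> 0. v t * kf s t)"
  by (subst B_eq[of "{s}" "{t. v t \<noteq> 0}"]) (auto simp: V_fin simple_root_def)

lemma rf_eq: "rf s v = lincomb 1 v (- 2 * B (simple_root s) v) (simple_root s)"
  by (simp add: reflect_def lincomb_def)

lemma rf_V [simp]: "\<lbrakk>s \<in> S; v \<in> V\<rbrakk> \<Longrightarrow> rf s v \<in> V"
  by (simp add: rf_eq)

lemma rf_lincomb: "\<lbrakk>s \<in> S; u \<in> V; v \<in> V\<rbrakk> \<Longrightarrow> rf s (lincomb a u b v) = lincomb a (rf s u) b (rf s v)"
  by (auto simp: reflect_def B_lincomb_right) (auto simp: lincomb_def algebra_simps)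

lemma rf_B: "\<lbrakk>s \<in> S; u \<in> V; v \<in> V\<rbrakk> \<Longrightarrow> B (rf s u) (rf s v) = B u v"
  by (simp add: rf_eq B_lincomb_left B_lincomb_right B_simple B_sym[of u "simple_root s"] algebra_simps)

lemma rf_rf: "\<lbrakk>s \<in> S; v \<in> V\<rbrakk> \<Longrightarrow> rf s (rf s v) = v"
  by (simp add: rf_eq[of s v] rf_lincomb) (simp add: reflect_def lincomb_def B_simple algebra_simps)

abbreviation wact :: "'a list \<Rightarrow> 'a vec \<Rightarrow> 'a vec" where "wact ws v \<equiv> foldr rf ws v"

lemma wact_V [simp]: "\<lbrakk>ws \<in> lists S; v \<in> V\<rbrakk> \<Longrightarrow> wact ws v \<in> V"
  by (induction ws) auto

lemma wact_lincomb:
  "\<lbrakk>ws \<in> lists S; u \<in> V; v \<in> V\<rbrakk> \<Longrightarrow> wact ws (lincomb a u b v) = lincomb a (wact ws u) b (wact ws v)"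
  by (induction ws) (auto simp: rf_lincomb)

lemma wact_B: "\<lbrakk>ws \<in> lists S; u \<in> V; v \<in> V\<rbrakk> \<Longrightarrow> B (wact ws u) (wact ws v) = B u v"
  by (induction ws) (auto simp: rf_B)

lemma wact_rev: "\<lbrakk>ws \<in> lists S; v \<in> V\<rbrakk> \<Longrightarrow> wact (rev ws) (wact ws v) = v"
  by (induction ws arbitrary: v) (auto simp: rf_rf)

section \<open>Dihedral rotations and the braid relations\<close>

lemma rf_plane:
  assumes "s \<in> S" "t \<in> S"
  shows "rf s (lincomb a (simple_root s) b (simple_root t))
    = lincomb (- a - 2 * kf s t * b) (simple_root s) b (simple_root t)"
proof -
  have "B (simple_root s) (lincomb a (simple_root s) b (simple_root t)) = a + b * kf s t"
    using assms by (simp add: B_lincomb_right B_simple)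
  then show ?thesis
    unfolding reflect_def by (auto simp: lincomb_def algebra_simps)
qed

lemma rf_plane':
  assumes "s \<in> S" "t \<in> S"
  shows "rf t (lincomb a (simple_root s) b (simple_root t))
    = lincomb a (simple_root s) (- b - 2 * kf s t * a) (simple_root t)"
proof -
  have "B (simple_root t) (lincomb a (simple_root s) b (simple_root t)) = b + a * kf s t"
    using assms by (simp add: B_lincomb_right B_simple kf_sym[of t s])
  then show ?thesis
    unfolding reflect_def by (auto simp: lincomb_def algebra_simps)
qed

lemma rf_perp: "\<lbrakk>s \<in> S; v \<in> V; B (simple_root s) v = 0\<rbrakk> \<Longrightarrow> rf s v = v"
  by (simp add: reflect_def)

lemma sin_rec: "sin (x + y) = 2 * cos y * sin x - sin (x - y)" for x y :: real
  by (simp add: sin_add sin_diff algebra_simps)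

text \<open>With <\<alpha>_s, \<alpha>_t> = -cos \<theta> the product st rotates the plane of the
  two roots by 2\<theta>. The quotients sin (k\<theta>) / sin \<theta> are Chebyshev polynomials in
  cos \<theta>; each reflection advances their recursion \<open>sin_rec\<close> by one step.\<close>

lemma rotation_power:
  assumes "s \<in> S" "t \<in> S" "- kf s t = cos \<theta>" "sin \<theta> \<noteq> 0"
  shows "wact (concat (replicate n [s, t])) (lincomb p (simple_root s) q (simple_root t)) =
    lincomb (p * (sin ((2*real n+1)*\<theta>) / sin \<theta>) - q * (sin (2*real n*\<theta>) / sin \<theta>)) (simple_root s)
      (p * (sin (2*real n*\<theta>) / sin \<theta>) - q * (sin ((2*real n - 1)*\<theta>) / sin \<theta>)) (simple_root t)"
proof (induction n)
  case 0
  then show ?case using assms(4) by simp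
next
  case (Suc n)
  define a where "a = p * (sin ((2*real n+1)*\<theta>) / sin \<theta>) - q * (sin (2*real n*\<theta>) / sin \<theta>)"
  define b where "b = p * (sin (2*real n*\<theta>) / sin \<theta>) - q * (sin ((2*real n - 1)*\<theta>) / sin \<theta>)"
  have 1: "sin (2*real (Suc n)*\<theta>) = 2 * cos \<theta> * sin ((2*real n+1)*\<theta>) - sin (2*real n*\<theta>)"
    using sin_rec[of "(2*real n+1)*\<theta>" \<theta>] by (simp add: algebra_simps)
  have 2: "sin ((2*real (Suc n)+1)*\<theta>) = 2 * cos \<theta> * sin (2*real (Suc n)*\<theta>) - sin ((2*real n+1)*\<theta>)"
    using sin_rec[of "2*real (Suc n)*\<theta>" \<theta>] by (simp add: algebra_simps)
  have 3: "sin ((2*real n+1)*\<theta>) = 2 * cos \<theta> * sin (2*real n*\<theta>) - sin ((2*real n - 1)*\<theta>)"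
    using sin_rec[of "2*real n*\<theta>" \<theta>] by (simp add: algebra_simps)
  \<comment> \<open>The common shape of both coefficient updates, stated for arbitrary numerators so
    that the sine recursions only have to be substituted.\<close>
  have gen: "2 * k * (p * (A / r) - q * (C / r)) - (p * (C / r) - q * (D / r))
      = p * ((2 * k * A - C) / r) - q * ((2 * k * C - D) / r)" for k r A C D :: real
    by (simp add: diff_divide_distrib algebra_simps)
  have b': "- b - 2 * kf s t * a = p * (sin (2*real (Suc n)*\<theta>) / sin \<theta>) - q * (sin ((2*real n+1)*\<theta>) / sin \<theta>)"
    (is "?b = ?b'")
  proof -
    have "?b = 2 * (- kf s t) * a - b" by simp
    also have "\<dots> = 2 * cos \<theta> * a - b" unfolding assms(3) ..
    also have "\<dots> = ?b'" unfolding a_def b_def 1 3 by (rule gen)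
    finally show ?thesis .
  qed
  have a': "- a - 2 * kf s t * ?b = p * (sin ((2*real (Suc n)+1)*\<theta>) / sin \<theta>) - q * (sin (2*real (Suc n)*\<theta>) / sin \<theta>)"
    (is "?a = ?a'")
  proof -
    have "?a = 2 * (- kf s t) * ?b - a" by simp
    also have "\<dots> = 2 * cos \<theta> * ?b' - a" unfolding b' assms(3) ..
    also have "\<dots> = ?a'" unfolding a_def 2 using gen[of "cos \<theta>"] 1 by metis
    finally show ?thesis .
  qed
  have s: "2 * real (Suc n) - 1 = 2 * real n + 1" by simp
  have "wact (concat (replicate (Suc n) [s, t])) (lincomb p (simple_root s) q (simple_root t))
    = rf s (rf t (wact (concat (replicate n [s, t])) (lincomb p (simple_root s) q (simple_root t))))"
    by simp
  also have "\<dots> = rf s (rf t (lincomb a (simple_root s) b (simple_root t)))"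
    unfolding Suc.IH a_def b_def ..
  also have "\<dots> = lincomb ?a (simple_root s) ?b (simple_root t)"
    using assms by (simp only: rf_plane' rf_plane)
  finally show ?case
    unfolding a' unfolding b' unfolding s .
qed

text \<open>For finite m \<ge> 2 the Gram determinant 1 - cos^2 \<theta> of the plane is nonzero, so
  v splits into a part orthogonal to both roots, which the reflections fix, and a planar part, on
  which the m-th power is rotation by 2\<pi>. For infinite order the word is empty.\<close>

lemma braid_relation:
  assumes "s \<in> S" "t \<in> S" "v \<in> V"
  shows "wact (concat (replicate (cox_m W s t) [s, t])) v = v"
proof -
  define m where "m = cox_m W s t"
  consider "s = t" | "m = 0" | "s \<noteq> t" "m \<ge> 2"
    using m_eq_1[of s t] assms unfolding m_def by linarith
  then show ?thesis
  proof cases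
    case 1
    then show ?thesis using assms by (simp add: m_same rf_rf)
  next
    case 2
    then show ?thesis by (simp add: m_def)
  next
    case 3
    define \<theta> where "\<theta> = pi / m"
    have "0 < \<theta>" "\<theta> < pi" using 3 by (auto simp: \<theta>_def field_simps)
    then have s0: "sin \<theta> \<noteq> 0" using sin_gt_zero by fastforce
    have c: "- kf s t = cos \<theta>" using 3 by (simp add: gram_def \<theta>_def m_def)
    let ?c = "cos \<theta>"
    have d0: "1 - ?c\<^sup>2 \<noteq> 0" using s0 by (simp add: sin_squared_eq[symmetric])
    let ?x = "B (simple_root s) v" and ?y = "B (simple_root t) v"
    \<comment> \<open>Cramer's rule for the projection of v to the plane, whose Gram matrix has
      diagonal 1 and off-diagonal entries -cos \<theta>.\<close>
    define p where "p = (?x + ?c * ?y) / (1 - ?c\<^sup>2)"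
    define q where "q = (?y + ?c * ?x) / (1 - ?c\<^sup>2)"
    let ?u = "lincomb p (simple_root s) q (simple_root t)"
    define v0 where "v0 = lincomb 1 v (-1) ?u"
    have u: "?u \<in> V" and v0: "v0 \<in> V" using assms by (auto simp: v0_def)
    have v: "v = lincomb 1 v0 1 ?u" by (auto simp: v0_def lincomb_def)
    have k: "kf s t = - ?c" "kf t s = - ?c" using c kf_sym[of s t] assms by auto
    have pq: "p - ?c * q = ?x" "q - ?c * p = ?y"
    proof -
      have pd: "p * (1 - ?c\<^sup>2) = ?x + ?c * ?y" and qd: "q * (1 - ?c\<^sup>2) = ?y + ?c * ?x"
        using d0 by (simp_all add: p_def q_def)
      have "(p - ?c * q) * (1 - ?c\<^sup>2) = p * (1 - ?c\<^sup>2) - ?c * (q * (1 - ?c\<^sup>2))"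
        by (simp add: left_diff_distrib)
      also have "\<dots> = ?x * (1 - ?c\<^sup>2)" unfolding pd qd by (simp add: algebra_simps power2_eq_square)
      finally have 1: "(p - ?c * q) * (1 - ?c\<^sup>2) = ?x * (1 - ?c\<^sup>2)" .
      have "(q - ?c * p) * (1 - ?c\<^sup>2) = q * (1 - ?c\<^sup>2) - ?c * (p * (1 - ?c\<^sup>2))"
        by (simp add: left_diff_distrib)
      also have "\<dots> = ?y * (1 - ?c\<^sup>2)" unfolding pd qd by (simp add: algebra_simps power2_eq_square)
      finally have 2: "(q - ?c * p) * (1 - ?c\<^sup>2) = ?y * (1 - ?c\<^sup>2)" .
      then show "p - ?c * q = ?x" "q - ?c * p = ?y" using 1 2 d0 by simp_all
    qed
    have "B (simple_root s) v0 = 0" "B (simple_root t) v0 = 0"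
      using assms u pq by (simp_all add: v0_def B_lincomb_right B_simple k algebra_simps)
    then have fix0: "wact (concat (replicate n [s, t])) v0 = v0" for n
      by (induction n) (use assms v0 in \<open>simp_all add: rf_perp\<close>)
    have L: "concat (replicate n [s, t]) \<in> lists S" for n
      by (induction n) (use assms in auto)
    \<comment> \<open>Since m\<theta> = \<pi>, the three arguments are \<theta>, 0 and -\<theta>
      modulo 2\<pi>.\<close>
    have sins: "sin ((2*real m+1)*\<theta>) = sin \<theta>" "sin (2*real m*\<theta>) = 0" "sin ((2*real m - 1)*\<theta>) = - sin \<theta>"
    proof -
      have m\<theta>: "m * \<theta> = pi" using 3 by (simp add: \<theta>_def)
      have "2 * real m * \<theta> = 2 * pi" "(2*real m+1)*\<theta> = \<theta> + 2 * pi" "(2*real m - 1)*\<theta> = - \<theta> + 2 * pi"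
        using m\<theta> by (simp_all add: algebra_simps)
      then show "sin ((2*real m+1)*\<theta>) = sin \<theta>" "sin (2*real m*\<theta>) = 0" "sin ((2*real m - 1)*\<theta>) = - sin \<theta>"
        by (simp_all only: sin_periodic sin_minus sin_two_pi)
    qed
    have "wact (concat (replicate m [s, t])) v
      = lincomb 1 (wact (concat (replicate m [s, t])) v0) 1 (wact (concat (replicate m [s, t])) ?u)"
      by (subst (1) v) (rule wact_lincomb[OF L v0 u])
    also have "\<dots> = v"
      unfolding fix0 rotation_power[OF assms(1,2) c s0] sins using s0 v by simp
    finally show ?thesis by (simp add: m_def)
  qed
qed

section \<open>Invariants of rewriting and the action of W\<close>

lemma step_words:
  assumes "(x, y) \<in> cox_step W S"
  shows "x \<in> lists S" "y \<in> lists S" "wp x = wp y" "v \<in> V \<Longrightarrow> wact x v = wact y v"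
    "even (length x) = even (length y)"
proof -
  obtain u w s t where *: "x = u @ w" "y = u @ concat (replicate (cox_m W s t) [s, t]) @ w"
    "u \<in> lists S" "w \<in> lists S" "s \<in> S" "t \<in> S"
    using assms unfolding cox_step_def by blast
  let ?r = "\<lambda>n. concat (replicate n [s, t])"
  have L: "?r n \<in> lists S" for n
    by (induction n) (use * in auto)
  have "wp (?r n) = (s \<otimes> t) [^] n" for n
  proof (induction n)
    case (Suc n)
    have "wp (?r (Suc n)) = (s \<otimes> t) \<otimes> wp (?r n)" using * L[of n] by (simp add: m_assoc)
    then show ?case using Suc * by (simp only: nat_pow_Suc2 m_closed S_closed)
  qed simp
  then have 1: "wp (?r (cox_m W s t)) = \<one>" using * by (simp add: cox_m_def pow_ord_eq_1)
  have len: "even (length (?r n))" for n by (induction n) auto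
  show "x \<in> lists S" "y \<in> lists S" using * L by auto
  show "wp x = wp y" using * L[of "cox_m W s t"] 1 by (simp add: wp_append_S)
  show "even (length x) = even (length y)" using * len by simp
  show "wact x v = wact y v" if "v \<in> V" using * that braid_relation[of s t "wact w v"] by simp
qed

lemma relation_words:
  assumes "u \<in> lists S" "wp u = \<one>"
  shows "v \<in> V \<Longrightarrow> wact u v = v" "even (length u)"
proof -
  have "(v \<in> V \<longrightarrow> wact x v = wact y v) \<and> even (length x) = even (length y)"
    if "(x, y) \<in> (cox_step W S \<union> (cox_step W S)\<inverse>)\<^sup>*" for x y
    using that by (induction rule: rtrancl_induct) (auto simp: step_words(4,5))
  from this[OF S_relations[OF assms]]
  show "v \<in> V \<Longrightarrow> wact u v = v" "even (length u)" by auto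
qed

lemma word_inv: "xs \<in> lists S \<Longrightarrow> wp (rev xs) = inv (wp xs)"
  by (rule wp_rev_involutions[where X = S]) auto

text \<open>Two words for one element differ by the relation word \<open>rev ys @ xs\<close>. The
  action becomes well defined, and the parity of the length takes the place of the sign character
  when equal lengths of w and ws are excluded in \<open>len_gen_neq\<close>.\<close>

lemma equal_words:
  assumes "xs \<in> lists S" "ys \<in> lists S" "wp xs = wp ys"
  shows "v \<in> V \<Longrightarrow> wact xs v = wact ys v" "even (length xs) = even (length ys)"
proof -
  let ?u = "rev ys @ xs"
  have r: "rev ys \<in> lists S" using assms by auto
  then have u: "?u \<in> lists S" "wp ?u = \<one>"
    using assms by (auto simp: wp_append_S word_inv)
  show "even (length xs) = even (length ys)" using relation_words(2)[OF u] by auto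
  show "wact xs v = wact ys v" if v: "v \<in> V"
  proof -
    have "wact (rev ys) (wact xs v) = v" using relation_words(1)[OF u v] by simp
    then have "wact (rev (rev ys)) v = wact xs v"
      using wact_rev[OF r, of "wact xs v"] v assms by simp
    then show ?thesis by simp
  qed
qed

lemma act_word: "\<lbrakk>xs \<in> lists S; v \<in> V\<rbrakk> \<Longrightarrow> act (wp xs) v = wact xs v"
  unfolding cox_act_def by (rule the_equality) (use equal_words(1) in blast)+

lemma act_V [simp]: "\<lbrakk>w \<in> carrier W; v \<in> V\<rbrakk> \<Longrightarrow> act w v \<in> V"
  by (metis act_word wact_V word_exists)

lemma act_one [simp]: "v \<in> V \<Longrightarrow> act \<one> v = v"
  using act_word[of "[]"] by simp

lemma act_mult: "\<lbrakk>g \<in> carrier W; h \<in> carrier W; v \<in> V\<rbrakk> \<Longrightarrow> act (g \<otimes> h) v = act g (act h v)"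
proof -
  assume *: "g \<in> carrier W" "h \<in> carrier W" "v \<in> V"
  obtain xs ys where x: "xs \<in> lists S" "wp xs = g" "ys \<in> lists S" "wp ys = h"
    using * word_exists by metis
  then have "g \<otimes> h = wp (xs @ ys)" "xs @ ys \<in> lists S" by (auto simp: wp_append_S)
  then have "act (g \<otimes> h) v = wact (xs @ ys) v" using * by (simp only: act_word)
  also have "\<dots> = act g (act h v)" using x * by (auto simp: act_word simp flip: x(2,4))
  finally show ?thesis .
qed

lemma act_gen: "\<lbrakk>s \<in> S; v \<in> V\<rbrakk> \<Longrightarrow> act s v = rf s v"
  using act_word[of "[s]" v] by simp

lemma act_lincomb: "\<lbrakk>w \<in> carrier W; u \<in> V; v \<in> V\<rbrakk> \<Longrightarrow> act w (lincomb a u b v) = lincomb a (act w u) b (act w v)"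
  by (metis act_word lincomb_V wact_lincomb word_exists)

lemma act_B: "\<lbrakk>w \<in> carrier W; u \<in> V; v \<in> V\<rbrakk> \<Longrightarrow> B (act w u) (act w v) = B u v"
  by (metis act_word wact_B word_exists)

lemma act_inv1 [simp]: "\<lbrakk>w \<in> carrier W; v \<in> V\<rbrakk> \<Longrightarrow> act (inv w) (act w v) = v"
  by (simp flip: act_mult)

lemma act_inv2 [simp]: "\<lbrakk>w \<in> carrier W; v \<in> V\<rbrakk> \<Longrightarrow> act w (act (inv w) v) = v"
  by (simp flip: act_mult)

end

definition nonneg :: "'a vec \<Rightarrow> bool" where "nonneg v \<longleftrightarrow> (\<forall>t. 0 \<le> v t)"

definition opp :: "'a vec \<Rightarrow> 'a vec" where "opp v = (\<lambda>t. - v t)"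

lemma opp_opp [simp]: "opp (opp v) = v" by (simp add: opp_def)

lemma opp_inj: "opp u = opp v \<longleftrightarrow> u = v" by (metis opp_opp)

lemma opp_lincomb: "opp v = lincomb (-1) v 0 v" by (simp add: opp_def lincomb_def)

lemma nonneg_simple_root [simp]: "nonneg (simple_root s)"
  by (simp add: nonneg_def simple_root_def)

lemma nonneg_lincomb: "\<lbrakk>nonneg u; nonneg v; 0 \<le> a; 0 \<le> b\<rbrakk> \<Longrightarrow> nonneg (lincomb a u b v)"
  by (simp add: nonneg_def lincomb_def)

text \<open>Built from the right so that the last letter is always t: this letter is the first to
  act on \<alpha>_s. The leftmost letter depends on the parity of the length.\<close>

fun alternating :: "'a \<Rightarrow> 'a \<Rightarrow> nat \<Rightarrow> 'a list" where
  "alternating s t 0 = []"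
| "alternating s t (Suc n) = alternating t s n @ [t]"

lemma alternating_Cons: "alternating s t (Suc n) = (if even n then t else s) # alternating s t n"
  by (induction n arbitrary: s t) auto

lemma alternating_lists: "alternating s t n \<in> lists {s, t}"
  by (induction n arbitrary: s t) auto

lemma length_alternating [simp]: "length (alternating s t n) = n"
  by (induction n arbitrary: s t) auto

lemma alternating_split: "\<exists>ys\<in>lists {s, t}. length ys = k \<and> alternating s t (k + m) = ys @ alternating s t m"
proof (induction m arbitrary: s t)
  case 0
  then show ?case using alternating_lists[of s t k] by auto
next
  case (Suc m)
  obtain ys where "ys \<in> lists {t, s}" "length ys = k" "alternating t s (k + m) = ys @ alternating t s m"
    using Suc[of t s] by blast
  then show ?case by (intro bexI[of _ ys]) auto
qed

context coxeter
begin

section \<open>The length function\<close>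

abbreviation len where "len \<equiv> cox_length W S"

lemma len_word:
  assumes "w \<in> carrier W"
  obtains ws where "ws \<in> lists S" "wp ws = w" "length ws = len w"
proof -
  have "\<exists>n. \<exists>ws\<in>lists S. length ws = n \<and> wp ws = w" by (metis word_exists[OF assms])
  from LeastI_ex[OF this] obtain ws where "ws \<in> lists S" "length ws = len w" "wp ws = w"
    unfolding cox_length_def by (elim bexE conjE)
  then show ?thesis by (intro that)
qed

lemma len_le: "ws \<in> lists S \<Longrightarrow> len (wp ws) \<le> length ws"
  unfolding cox_length_def by (rule Least_le) auto

lemma len_mult_word: "\<lbrakk>g \<in> carrier W; ws \<in> lists S\<rbrakk> \<Longrightarrow> len (g \<otimes> wp ws) \<le> len g + length ws"
  by (metis append_in_lists_conv len_le len_word length_append wp_append_S)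

lemma len_gen: "\<lbrakk>g \<in> carrier W; s \<in> S\<rbrakk> \<Longrightarrow> len (g \<otimes> s) \<le> Suc (len g)"
  using len_mult_word[of g "[s]"] by simp

lemma mult_gen_gen [simp]: "\<lbrakk>g \<in> carrier W; s \<in> S\<rbrakk> \<Longrightarrow> g \<otimes> s \<otimes> s = g"
  by (simp add: m_assoc S_square)

lemma inv_cancel_left [simp]: "\<lbrakk>g \<in> carrier W; x \<in> carrier W\<rbrakk> \<Longrightarrow> inv g \<otimes> (g \<otimes> x) = x"
  and inv_cancel_left' [simp]: "\<lbrakk>g \<in> carrier W; x \<in> carrier W\<rbrakk> \<Longrightarrow> g \<otimes> (inv g \<otimes> x) = x"
  by (simp_all flip: m_assoc)

lemma len_gen': "\<lbrakk>g \<in> carrier W; s \<in> S\<rbrakk> \<Longrightarrow> len g \<le> Suc (len (g \<otimes> s))"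
  using len_gen[of "g \<otimes> s" s] by simp

lemma len_gen_neq:
  assumes "g \<in> carrier W" "s \<in> S" shows "len (g \<otimes> s) \<noteq> len g"
proof
  assume eq: "len (g \<otimes> s) = len g"
  obtain xs ys where "xs \<in> lists S" "wp xs = g" "length xs = len g"
    "ys \<in> lists S" "wp ys = g \<otimes> s" "length ys = len (g \<otimes> s)"
    using assms len_word[of g] len_word[of "g \<otimes> s"] by (metis S_closed m_closed)
  moreover from this have "wp (xs @ [s]) = wp ys" "xs @ [s] \<in> lists S" using assms by (auto simp: wp_append_S)
  ultimately show False using equal_words(2)[of "xs @ [s]" ys] eq by auto
qed

section \<open>Roots are positive or negative\<close>

lemma wp_alternating_even: "\<lbrakk>s \<in> S; t \<in> S\<rbrakk> \<Longrightarrow> wp (alternating s t (2 * k)) = (s \<otimes> t) [^] k"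
proof (induction k)
  case (Suc k)
  have "alternating s t (2 * Suc k) = [s, t] @ alternating s t (2 * k)"
    by (simp add: alternating_Cons del: alternating.simps(2))
  moreover have "alternating s t (2 * k) \<in> lists S"
    using Suc alternating_lists[of s t "2*k"] by auto
  ultimately have "wp (alternating s t (2 * Suc k)) = (s \<otimes> t) \<otimes> (s \<otimes> t) [^] k"
    using Suc by (simp add: m_assoc)
  also have "\<dots> = (s \<otimes> t) [^] (Suc k)" using Suc by (simp only: nat_pow_Suc2 m_closed S_closed)
  finally show ?case .
qed simp

text \<open>For m = 2k or m = 2k + 1 the relation (st)^m = 1 reads (st)^k = (ts)^(m-k). This is the
  braid relation for the two alternating words; in the odd case one more letter t is multiplied on
  from the left.\<close>

lemma wp_alternating_swap:
  assumes "s \<in> S" "t \<in> S" "(s \<otimes> t) [^] m = \<one>"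
  shows "wp (alternating s t m) = wp (alternating t s m)"
proof -
  let ?r = "s \<otimes> t" and ?q = "t \<otimes> s"
  have q: "?q = inv ?r" and r: "?r \<in> carrier W" using assms by (auto simp: inv_mult_group)
  have rq: "?q [^] k = inv (?r [^] k)" for k :: nat unfolding q using nat_pow_inv[OF r] by simp
  obtain k where "m = 2 * k \<or> m = Suc (2 * k)" by (metis even_two_times_div_two odd_two_times_div_two_succ Suc_eq_plus1)
  then show ?thesis
  proof
    assume m: "m = 2 * k"
    then have "?r [^] k \<otimes> ?r [^] k = \<one>" using assms(3) r by (simp add: nat_pow_mult mult_2)
    then have "?r [^] k = ?q [^] k" unfolding rq using r by (simp add: inv_equality)
    then show ?thesis using assms m wp_alternating_even by auto
  next
    assume m: "m = Suc (2 * k)"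
    then have "?r [^] k \<otimes> ?r [^] Suc k = \<one>" using assms(3) r by (simp add: nat_pow_mult mult_2 del: nat_pow_Suc flip: m_assoc)
    then have "?r [^] k = ?q [^] Suc k"
      unfolding rq using r by (simp add: inv_equality del: nat_pow_Suc)
    also have "\<dots> = ?q \<otimes> ?q [^] k" using assms by (simp only: nat_pow_Suc2 m_closed S_closed)
    finally have "t \<otimes> ?r [^] k = t \<otimes> (?q \<otimes> ?q [^] k)" by simp
    also have "\<dots> = t \<otimes> t \<otimes> s \<otimes> ?q [^] k" using assms by (simp add: m_assoc)
    also have "\<dots> = s \<otimes> ?q [^] k" using assms by (simp add: S_square)
    finally show ?thesis using assms m by (simp add: alternating_Cons wp_alternating_even del: alternating.simps(2))
  qed
qed

text \<open>An abstract solution u of the recursion lets finite order, with u n = sin (n\<theta>) /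
  sin \<theta>, and infinite order, with u n = n, share one induction.\<close>

lemma act_alternating:
  fixes u :: "nat \<Rightarrow> real"
  assumes "s \<in> S" "t \<in> S" "u 0 = 0" "u 1 = 1" "\<And>n. u (Suc (Suc n)) = - 2 * kf s t * u (Suc n) - u n"
  shows "wact (alternating s t n) (simple_root s) =
    (if even n then lincomb (u (Suc n)) (simple_root s) (u n) (simple_root t)
     else lincomb (u n) (simple_root s) (u (Suc n)) (simple_root t))"
proof (induction n)
  case 0
  then show ?case using assms by (simp add: lincomb_def)
next
  case (Suc n)
  have "wact (alternating s t (Suc n)) (simple_root s)
    = rf (if even n then t else s) (wact (alternating s t n) (simple_root s))"
    by (simp add: alternating_Cons del: alternating.simps(2))
  moreover have "- u n - 2 * kf s t * u (Suc n) = u (Suc (Suc n))" using assms(5)[of n] by simp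
  ultimately show ?case
    using assms(1,2) by (simp add: Suc rf_plane rf_plane' del: alternating.simps)
qed

text \<open>The sines of k\<pi>/m are nonnegative for k \<le> m, and n < m is what makes both
  indices n and n + 1 admissible. For infinite order the entry -1 turns the recursion into that of
  the identity sequence.\<close>

lemma alternating_nonneg:
  assumes "s \<in> S" "t \<in> S" "s \<noteq> t" "cox_m W s t = 0 \<or> n < cox_m W s t"
  shows "\<exists>a b. 0 \<le> a \<and> 0 \<le> b \<and> wact (alternating s t n) (simple_root s) = lincomb a (simple_root s) b (simple_root t)"
proof -
  let ?m = "cox_m W s t"
  have "\<exists>u :: nat \<Rightarrow> real. u 0 = 0 \<and> u 1 = 1 \<and> (\<forall>n. u (Suc (Suc n)) = - 2 * kf s t * u (Suc n) - u n)
    \<and> 0 \<le> u n \<and> 0 \<le> u (Suc n)"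
  proof (cases "?m = 0")
    case True
    show ?thesis by (rule exI[of _ real]) (use True in \<open>simp add: gram_def\<close>)
  next
    case False
    define \<theta> where "\<theta> = pi / ?m"
    have m: "?m \<ge> 2" using False m_eq_1[of s t] assms by linarith
    have "0 < \<theta>" "\<theta> < pi" using m by (auto simp: \<theta>_def field_simps)
    then have s0: "sin \<theta> > 0" using sin_gt_zero by simp
    have pos: "sin (real k * \<theta>) \<ge> 0" if "k \<le> ?m" for k
    proof (rule sin_ge_zero)
      show "0 \<le> real k * \<theta>" using \<open>0 < \<theta>\<close> by simp
      have "real k * \<theta> \<le> ?m * \<theta>" using \<open>0 < \<theta>\<close> that by simp
      also have "\<dots> = pi" using m by (simp add: \<theta>_def)
      finally show "real k * \<theta> \<le> pi" .
    qed
    have c: "kf s t = - cos \<theta>" using False by (simp add: gram_def \<theta>_def)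
    have rec: "sin (real (Suc (Suc k)) * \<theta>) = 2 * cos \<theta> * sin (real (Suc k) * \<theta>) - sin (real k * \<theta>)" for k
      using sin_rec[of "real (Suc k) * \<theta>" \<theta>] by (simp add: algebra_simps)
    have eq: "sin (real (Suc (Suc k)) * \<theta>) / sin \<theta>
      = - 2 * kf s t * (sin (real (Suc k) * \<theta>) / sin \<theta>) - sin (real k * \<theta>) / sin \<theta>" for k
      unfolding rec c by (simp add: diff_divide_distrib)
    show ?thesis
      by (rule exI[of _ "\<lambda>k. sin (real k * \<theta>) / sin \<theta>"])
        (use s0 eq[unfolded of_nat_Suc] pos[of n] pos[of "Suc n"] assms(4) False in simp)
  qed
  then obtain u :: "nat \<Rightarrow> real" where u: "u 0 = 0" "u 1 = 1"
    "\<And>n. u (Suc (Suc n)) = - 2 * kf s t * u (Suc n) - u n" "0 \<le> u n" "0 \<le> u (Suc n)" by blast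
  show ?thesis using u(4,5) act_alternating[OF assms(1,2) u(1-3), of n] by (cases "even n") auto
qed

text \<open>A last letter s would make multiplication by s shorten d, so the last letter is t.
  Removing it exchanges the roles of s and t and reproduces both minimality hypotheses.\<close>

lemma reduced_alternating:
  assumes "d \<in> lists {s, t}" "s \<in> S" "t \<in> S"
    and "\<And>e. \<lbrakk>e \<in> lists {s, t}; wp e = wp d\<rbrakk> \<Longrightarrow> length d \<le> length e"
    and "\<And>e. \<lbrakk>e \<in> lists {s, t}; wp e = wp d \<otimes> s\<rbrakk> \<Longrightarrow> length d < length e"
  shows "d = alternating s t (length d)"
  using assms
proof (induction d arbitrary: s t rule: rev_induct)
  case (snoc x d)
  have d: "d \<in> lists {s, t}" "d \<in> lists S" "x \<in> S" using snoc.prems by auto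
  have st: "z \<in> lists {s, t} \<Longrightarrow> z \<in> lists S" for z using snoc.prems by auto
  have "x \<noteq> s"
  proof
    assume "x = s"
    then have "wp d = wp (d @ [x]) \<otimes> s" using d by (simp add: wp_append_S)
    from snoc.prems(5)[OF d(1) this] show False by simp
  qed
  then have x: "x = t" using snoc.prems by auto
  have "d = alternating t s (length d)"
  proof (rule snoc.IH)
    fix e assume e: "e \<in> lists {t, s}"
    then have e': "e \<in> lists {s, t}" "e \<in> lists S" "e @ [t] \<in> lists {s, t}" using snoc.prems by auto
    show "length d \<le> length e" if "wp e = wp d"
      using snoc.prems(4)[OF e'(3)] that x d e' by (simp add: wp_append_S)
    show "length d < length e" if "wp e = wp d \<otimes> t"
      using snoc.prems(4)[OF e'(1)] that x d by (simp add: wp_append_S)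
  qed (use d snoc.prems in auto)
  then show ?case using x by simp
qed simp

text \<open>Strip from \<open>w\<close> a longest suffix in the dihedral subgroup generated by \<open>s\<close> and the last letter \<open>t\<close>
  of a reduced word of \<open>w\<close>: what remains lengthens under both generators, and the suffix, being
  alternating and short, sends \<open>\<alpha>\<^sub>s\<close> to a nonnegative combination of \<open>\<alpha>\<^sub>s\<close> and \<open>\<alpha>\<^sub>t\<close>.\<close>

lemma act_simple_root_nonneg:
  assumes "w \<in> carrier W" "s \<in> S" "len w < len (w \<otimes> s)"
  shows "nonneg (act w (simple_root s))"
  using assms
proof (induction "len w" arbitrary: w s rule: less_induct)
  case less
  show ?case
  proof (cases "w = \<one>")
    case True
    then show ?thesis using less.prems by simp
  next
    case False
    obtain ws where ws: "ws \<in> lists S" "wp ws = w" "length ws = len w" using less.prems len_word by metis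
    then have "ws \<noteq> []" using False by auto
    then obtain us t where us: "ws = us @ [t]" by (metis rev_exhaust)
    have t: "t \<in> S" "us \<in> lists S" using ws us by auto
    have w_us: "w = wp us \<otimes> t" using ws us t by (simp add: wp_append_S flip: ws(2))
    have lus: "len (wp us) + 1 = len w"
      using len_le[OF t(2)] len_gen[of "wp us" t] t ws us w_us by auto
    have "wp us \<in> carrier W" using t(2) by (rule wp_closed_S)
    then have ts: "t \<noteq> s" using lus less.prems w_us by auto
    have st: "z \<in> lists {s, t} \<Longrightarrow> z \<in> lists S" for z using less.prems t by auto
    define Q where "Q j \<longleftrightarrow> (\<exists>v\<in>carrier W. \<exists>d\<in>lists {s, t}. w = v \<otimes> wp d \<and> len v + length d = len w \<and> length d = j)" for j
    have Q1: "Q 1" unfolding Q_def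
      by (rule bexI[of _ "wp us"], rule bexI[of _ "[t]"]) (use w_us t lus in auto)
    have "\<forall>j. Q j \<longrightarrow> j \<le> len w" unfolding Q_def by auto
    then obtain j where j: "Q j" "\<And>i. Q i \<Longrightarrow> i \<le> j"
      using GreatestI_nat[of Q 1] Greatest_le_nat[of Q] Q1 by metis
    then obtain v d where vd: "v \<in> carrier W" "d \<in> lists {s, t}" "w = v \<otimes> wp d" "len v + length d = len w" "length d = j"
      unfolding Q_def by blast
    have dS: "d \<in> lists S" using vd st by blast
    have "j \<ge> 1" using j Q1 by blast
    then have lv: "len v < len w" using vd by simp
    have up: "len v < len (v \<otimes> x)" if x: "x \<in> {s, t}" for x
    proof (rule ccontr)
      assume "\<not> len v < len (v \<otimes> x)"
      moreover have xS: "x \<in> S" using x t less.prems by auto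
      ultimately have l: "len v = Suc (len (v \<otimes> x))"
        using len_gen_neq[of v x] len_gen'[of v x] vd by simp
      have "w = v \<otimes> x \<otimes> wp (x # d)"
        using vd xS dS by (simp add: m_assoc S_square flip: m_assoc[of x x])
      then have "Q (Suc j)" unfolding Q_def using vd l x xS
        by (intro bexI[of _ "v \<otimes> x"] bexI[of _ "x # d"]) auto
      then show False using j(2)[of "Suc j"] by simp
    qed
    have red: "length d \<le> length e" if e: "e \<in> lists {s, t}" "wp e = wp d" for e
      using len_mult_word[of v e] st[OF e(1)] e vd by simp
    have red': "length d < length e" if e: "e \<in> lists {s, t}" "wp e = wp d \<otimes> s" for e
    proof -
      have "w \<otimes> s = v \<otimes> wp e" using e vd dS less.prems by (simp add: m_assoc)
      then show ?thesis using len_mult_word[of v e] st[OF e(1)] vd less.prems(3) by simp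
    qed
    have d: "d = alternating s t j"
      unfolding vd(5)[symmetric]
      by (rule reduced_alternating[OF vd(2) less.prems(2) t(1)]) (erule (1) red, erule (1) red')
    \<comment> \<open>If j reached m, the last m letters of d could be flipped by the braid relation
      to end in s; then d times s would have a shorter word, against \<open>red'\<close>.\<close>
    have m: "cox_m W s t = 0 \<or> j < cox_m W s t"
    proof (rule ccontr)
      let ?m = "cox_m W s t"
      assume "\<not> (?m = 0 \<or> j < ?m)"
      then have m: "?m > 0" "?m \<le> j" by auto
      obtain ys where ys: "ys \<in> lists {s, t}" "length ys = j - ?m" "d = ys @ alternating s t ?m"
        using alternating_split[of s t "j - ?m" ?m] m d by auto
      have "wp (alternating s t ?m) = wp (alternating t s ?m)"
        using wp_alternating_swap[of s t ?m] less.prems t by (simp add: cox_m_def pow_ord_eq_1)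
      also have "alternating t s ?m = alternating s t (?m - 1) @ [s]"
        using m by (cases ?m) auto
      finally have "wp (alternating s t ?m) = wp (alternating s t (?m - 1)) \<otimes> s"
        using st[OF alternating_lists[of s t "?m - 1"]] less.prems by (simp add: wp_append_S)
      then have "wp d \<otimes> s = wp (ys @ alternating s t (?m - 1))"
        using ys st[OF ys(1)] st[OF alternating_lists[of s t "?m - 1"]] st[OF alternating_lists[of s t "?m"]] less.prems
        by (simp add: wp_append_S m_assoc S_square)
      moreover have "ys @ alternating s t (?m - 1) \<in> lists {s, t}" using ys alternating_lists[of s t "?m - 1"] by simp
      ultimately have "length d < length (ys @ alternating s t (?m - 1))" using red' by metis
      then show False using ys m vd by simp
    qed
    obtain a b where ab: "0 \<le> a" "0 \<le> b" "wact d (simple_root s) = lincomb a (simple_root s) b (simple_root t)"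
      using alternating_nonneg[OF less.prems(2) t(1) ts[symmetric] m] d by auto
    have "act w (simple_root s) = act v (wact d (simple_root s))"
      using vd dS less.prems by (simp add: act_mult act_word)
    also have "\<dots> = lincomb a (act v (simple_root s)) b (act v (simple_root t))"
      unfolding ab(3) using vd t less.prems by (simp add: act_lincomb)
    finally show ?thesis
      using less.hyps[OF lv vd(1)] less.prems t up ab by (auto intro: nonneg_lincomb)
  qed
qed

abbreviation \<Phi> where "\<Phi> \<equiv> roots W S"

lemma opp_V [simp]: "v \<in> V \<Longrightarrow> opp v \<in> V" by (simp add: opp_lincomb)

lemma act_opp: "\<lbrakk>w \<in> carrier W; v \<in> V\<rbrakk> \<Longrightarrow> act w (opp v) = opp (act w v)"
  by (simp add: opp_lincomb act_lincomb)

lemma rf_self: "s \<in> S \<Longrightarrow> rf s (simple_root s) = opp (simple_root s)"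
  by (auto simp: reflect_def B_simple opp_def)

lemma root_E:
  assumes "\<gamma> \<in> \<Phi>" obtains w s where "w \<in> carrier W" "s \<in> S" "\<gamma> = act w (simple_root s)"
  using assms unfolding roots_def by blast

lemma root_I: "\<lbrakk>w \<in> carrier W; s \<in> S\<rbrakk> \<Longrightarrow> act w (simple_root s) \<in> \<Phi>"
  unfolding roots_def by blast

lemma root_V [simp]: "\<gamma> \<in> \<Phi> \<Longrightarrow> \<gamma> \<in> V"
  by (erule root_E) simp

lemma root_act [simp]: "\<lbrakk>w \<in> carrier W; \<gamma> \<in> \<Phi>\<rbrakk> \<Longrightarrow> act w \<gamma> \<in> \<Phi>"
  by (erule root_E) (metis act_mult m_closed root_I simple_root_V)

lemma simple_root_root [simp]: "s \<in> S \<Longrightarrow> simple_root s \<in> \<Phi>"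
  using root_I[of \<one> s] by simp

lemma root_opp [simp]: "\<gamma> \<in> \<Phi> \<Longrightarrow> opp \<gamma> \<in> \<Phi>"
proof (erule root_E)
  fix w s assume *: "w \<in> carrier W" "s \<in> S" "\<gamma> = act w (simple_root s)"
  then have "act (w \<otimes> s) (simple_root s) = opp \<gamma>" by (simp add: act_mult act_gen rf_self act_opp)
  then show ?thesis using * root_I[of "w \<otimes> s" s] by simp
qed

lemma root_norm: "\<gamma> \<in> \<Phi> \<Longrightarrow> B \<gamma> \<gamma> = 1"
  by (erule root_E) (simp add: act_B B_simple)

text \<open>One of w and ws is lengthened by s, and passing from w to ws negates the image of
  \<alpha>_s.\<close>

lemma root_cases:
  assumes "\<gamma> \<in> \<Phi>" shows "nonneg \<gamma> \<or> nonneg (opp \<gamma>)"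
proof -
  obtain w s where *: "w \<in> carrier W" "s \<in> S" "\<gamma> = act w (simple_root s)" using assms by (rule root_E)
  show ?thesis
  proof (cases "len w < len (w \<otimes> s)")
    case True
    then show ?thesis using * act_simple_root_nonneg by auto
  next
    case False
    then have "len (w \<otimes> s) < len (w \<otimes> s \<otimes> s)" using * len_gen_neq[of w s] by simp
    then have "nonneg (act (w \<otimes> s) (simple_root s))" using * act_simple_root_nonneg[of "w \<otimes> s" s] by simp
    then show ?thesis using * by (simp add: act_mult act_gen rf_self act_opp)
  qed
qed

lemma root_nonzero: "\<gamma> \<in> \<Phi> \<Longrightarrow> \<exists>t. \<gamma> t \<noteq> 0"
  using root_norm[of \<gamma>] by (rule_tac ccontr) (simp add: cox_form_def)

lemma root_not_both: "\<gamma> \<in> \<Phi> \<Longrightarrow> nonneg (opp \<gamma>) \<longleftrightarrow> \<not> nonneg \<gamma>"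
  using root_cases[of \<gamma>] root_nonzero[of \<gamma>]
  by (metis (mono_tags) neg_0_le_iff_le nonneg_def opp_def order_antisym)

lemma root_coord_nonneg: "\<lbrakk>\<gamma> \<in> \<Phi>; 0 < \<gamma> t\<rbrakk> \<Longrightarrow> nonneg \<gamma>"
  using root_cases[of \<gamma>] unfolding nonneg_def opp_def by (metis neg_0_le_iff_le not_le)

lemma act_simple_root_nonneg_iff:
  assumes "w \<in> carrier W" "s \<in> S"
  shows "nonneg (act w (simple_root s)) \<longleftrightarrow> len w < len (w \<otimes> s)"
proof
  assume n: "nonneg (act w (simple_root s))"
  show "len w < len (w \<otimes> s)"
  proof (rule ccontr)
    assume "\<not> len w < len (w \<otimes> s)"
    then have "len (w \<otimes> s) < len (w \<otimes> s \<otimes> s)" using assms len_gen_neq[of w s] by simp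
    then have "nonneg (act (w \<otimes> s) (simple_root s))" using assms act_simple_root_nonneg[of "w \<otimes> s" s] by simp
    then have "nonneg (opp (act w (simple_root s)))" using assms by (simp add: act_mult act_gen rf_self act_opp)
    then show False using n assms root_not_both root_I by blast
  qed
qed (use assms act_simple_root_nonneg in blast)

text \<open>Roots have norm 1, so the only positive root on the line of \<alpha>_s is
  \<alpha>_s.\<close>

lemma root_multiple_simple:
  assumes "\<gamma> \<in> \<Phi>" "nonneg \<gamma>" "\<And>t. t \<noteq> s \<Longrightarrow> \<gamma> t = 0" "s \<in> S"
  shows "\<gamma> = simple_root s"
proof -
  have \<gamma>: "\<gamma> = lincomb (\<gamma> s) (simple_root s) 0 (simple_root s)"
    using assms by (auto simp: lincomb_def simple_root_def)
  have "B \<gamma> \<gamma> = \<gamma> s * \<gamma> s"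
    by (subst (1 2) \<gamma>) (use assms in \<open>simp add: B_lincomb_left B_lincomb_right B_simple\<close>)
  then have "\<gamma> s * \<gamma> s = 1" using root_norm assms by simp
  then have "\<gamma> s = 1" using assms unfolding nonneg_def by (smt (verit) square_eq_1_iff)
  then show ?thesis using assms by (auto simp: simple_root_def)
qed

lemma rf_coord: "t \<noteq> s \<Longrightarrow> rf s v t = v t"
  by (simp add: reflect_def simple_root_def)

text \<open>Some coordinate of \<gamma> other than the one at s is positive; s leaves it unchanged,
  and one positive coordinate decides the sign of a root.\<close>

lemma simple_reflection_nonneg:
  assumes "s \<in> S" "\<gamma> \<in> \<Phi>" "nonneg \<gamma>" "\<gamma> \<noteq> simple_root s"
  shows "nonneg (act s \<gamma>)"
proof -
  obtain t where t: "t \<noteq> s" "\<gamma> t \<noteq> 0" using assms root_multiple_simple by blast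
  then have "act s \<gamma> t > 0" using assms by (simp add: act_gen rf_coord nonneg_def less_le)
  then show ?thesis using assms root_coord_nonneg[of "act s \<gamma>" t] by simp
qed

text \<open>The inversion set. Intersected with a set of roots it gives an induction measure adapted
  to a reflection subgroup.\<close>

definition Inv :: "'a \<Rightarrow> 'a vec set" where
  "Inv w = {\<gamma> \<in> \<Phi>. nonneg \<gamma> \<and> nonneg (opp (act w \<gamma>))}"

text \<open>Prepending a letter s adds at most one inversion, the root that the rest of the word
  sends to \<alpha>_s.\<close>

lemma finite_Inv:
  assumes "w \<in> carrier W" shows "finite (Inv w)"
proof -
  have "finite (Inv (wp ws))" if "ws \<in> lists S" for ws
    using that
  proof (induction ws)
    case Nil
    have "Inv \<one> = {}" using root_not_both by (auto simp: Inv_def)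
    then show ?case by simp
  next
    case (Cons s ws)
    have "\<gamma> \<in> Inv (wp ws) \<union> {act (inv (wp ws)) (simple_root s)}" if "\<gamma> \<in> Inv (s \<otimes> wp ws)" for \<gamma>
    proof (rule ccontr)
      assume n: "\<gamma> \<notin> Inv (wp ws) \<union> {act (inv (wp ws)) (simple_root s)}"
      have wc: "wp ws \<in> carrier W" using Cons.hyps(2) by (rule wp_closed_S)
      then have \<gamma>: "\<gamma> \<in> \<Phi>" "nonneg \<gamma>" "nonneg (opp (act s (act (wp ws) \<gamma>)))"
        using that Cons.hyps(1) act_mult[OF S_closed[OF Cons.hyps(1)], of "wp ws" \<gamma>] by (auto simp: Inv_def)
      let ?d = "act (wp ws) \<gamma>"
      have "?d \<in> \<Phi>" using \<gamma> Cons by simp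
      moreover have "?d \<noteq> simple_root s" using n act_inv1[OF wc root_V[OF \<gamma>(1)]] by auto
      moreover have "nonneg ?d" using n \<gamma> root_cases[OF \<open>?d \<in> \<Phi>\<close>] by (auto simp: Inv_def)
      ultimately have "nonneg (act s ?d)" using simple_reflection_nonneg Cons by simp
      then show False using \<gamma> root_not_both[of "act s ?d"] \<open>?d \<in> \<Phi>\<close> Cons by simp
    qed
    then have "Inv (wp (s # ws)) \<subseteq> Inv (wp ws) \<union> {act (inv (wp ws)) (simple_root s)}" by auto
    then show ?case using Cons finite_subset by fastforce
  qed
  then show ?thesis using assms word_exists by metis
qed

lemma descent_exists:
  assumes "w \<in> carrier W" "w \<noteq> \<one>" shows "\<exists>s\<in>S. nonneg (opp (act w (simple_root s)))"
proof -
  obtain ws where ws: "ws \<in> lists S" "wp ws = w" "length ws = len w" using assms len_word by metis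
  then have "ws \<noteq> []" using assms by auto
  then obtain us s where us: "ws = us @ [s]" by (metis rev_exhaust)
  then have *: "s \<in> S" "us \<in> lists S" "w \<otimes> s = wp us" using ws by (auto simp: wp_append_S simp flip: ws(2))
  then have "\<not> len w < len (w \<otimes> s)" using len_le[OF *(2)] ws us by simp
  then show ?thesis using act_simple_root_nonneg_iff root_not_both root_I * assms by blast
qed

lemma all_nonneg_one:
  "\<lbrakk>w \<in> carrier W; \<And>s. s \<in> S \<Longrightarrow> nonneg (act w (simple_root s))\<rbrakk> \<Longrightarrow> w = \<one>"
  using descent_exists root_not_both root_I by blast

lemma act_faithful:
  assumes "g \<in> carrier W" "h \<in> carrier W" "\<And>s. s \<in> S \<Longrightarrow> act g (simple_root s) = act h (simple_root s)"
  shows "g = h"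
proof -
  have "inv h \<otimes> g = \<one>"
    by (rule all_nonneg_one) (use assms in \<open>auto simp: act_mult\<close>)
  then show ?thesis using assms by (metis inv_closed inv_comm inv_equality inv_inv)
qed

section \<open>Reflections in roots\<close>

abbreviation rr where "rr \<equiv> root_reflection W S"

lemma act_conj_gen:
  assumes "w \<in> carrier W" "s \<in> S" "v \<in> V" "\<gamma> = act w (simple_root s)"
  shows "act (w \<otimes> s \<otimes> inv w) v = lincomb 1 v (- 2 * B \<gamma> v) \<gamma>"
proof -
  have "B (simple_root s) (act (inv w) v) = B \<gamma> v"
    using act_B[of w "simple_root s" "act (inv w) v"] assms by simp
  then have "act s (act (inv w) v) = lincomb 1 (act (inv w) v) (- 2 * B \<gamma> v) (simple_root s)"
    using assms by (simp add: act_gen rf_eq)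
  then show ?thesis using assms by (simp add: act_mult act_lincomb)
qed

text \<open>A conjugate w s w^-1 acts on V by a formula in the root w\<alpha>_s alone, so
  faithfulness makes it independent of the chosen w and s.\<close>

lemma rr_eq:
  assumes "w \<in> carrier W" "s \<in> S"
  shows "rr (act w (simple_root s)) = w \<otimes> s \<otimes> inv w"
  unfolding root_reflection_def
proof (rule the_equality)
  fix r assume "\<exists>w'\<in>carrier W. \<exists>s'\<in>S. act w (simple_root s) = act w' (simple_root s') \<and> r = w' \<otimes> s' \<otimes> inv w'"
  then obtain w' s' where *: "w' \<in> carrier W" "s' \<in> S" "act w (simple_root s) = act w' (simple_root s')" "r = w' \<otimes> s' \<otimes> inv w'"
    by blast
  show "r = w \<otimes> s \<otimes> inv w" unfolding *(4)
    by (rule act_faithful) (use * assms in \<open>auto simp: act_conj_gen simp flip: *(3)\<close>)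
qed (use assms in blast)

lemma rr_closed [simp]: "\<gamma> \<in> \<Phi> \<Longrightarrow> rr \<gamma> \<in> carrier W"
  by (erule root_E) (simp add: rr_eq)

lemma rr_simple: "s \<in> S \<Longrightarrow> rr (simple_root s) = s"
  using rr_eq[of \<one> s] by simp

lemma act_rr: "\<lbrakk>\<gamma> \<in> \<Phi>; v \<in> V\<rbrakk> \<Longrightarrow> act (rr \<gamma>) v = lincomb 1 v (- 2 * B \<gamma> v) \<gamma>"
  by (erule root_E) (simp add: rr_eq act_conj_gen)

lemma rr_act: "\<lbrakk>w \<in> carrier W; \<gamma> \<in> \<Phi>\<rbrakk> \<Longrightarrow> rr (act w \<gamma>) = w \<otimes> rr \<gamma> \<otimes> inv w"
proof (erule root_E)
  fix u s assume *: "w \<in> carrier W" "u \<in> carrier W" "s \<in> S" "\<gamma> = act u (simple_root s)"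
  then have "rr (act w \<gamma>) = rr (act (w \<otimes> u) (simple_root s))" by (simp add: act_mult)
  also have "\<dots> = w \<otimes> rr \<gamma> \<otimes> inv w" using * by (simp only: rr_eq m_closed) (simp add: m_assoc inv_mult_group)
  finally show ?thesis .
qed

lemma rr_square: "\<gamma> \<in> \<Phi> \<Longrightarrow> rr \<gamma> \<otimes> rr \<gamma> = \<one>"
proof (erule root_E)
  fix w s assume *: "w \<in> carrier W" "s \<in> S" "\<gamma> = act w (simple_root s)"
  have "s \<otimes> (s \<otimes> inv w) = inv w" using * by (simp add: S_square flip: m_assoc)
  then show ?thesis using * by (simp add: rr_eq m_assoc)
qed

lemma rr_inv [simp]: "\<gamma> \<in> \<Phi> \<Longrightarrow> inv (rr \<gamma>) = rr \<gamma>"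
  by (simp add: inv_equality rr_square)

lemma act_rr_self: "\<gamma> \<in> \<Phi> \<Longrightarrow> act (rr \<gamma>) \<gamma> = opp \<gamma>"
  by (auto simp: act_rr root_norm lincomb_def opp_def)

lemma rr_opp: "\<gamma> \<in> \<Phi> \<Longrightarrow> rr (opp \<gamma>) = rr \<gamma>"
  using rr_act[of "rr \<gamma>" \<gamma>] by (simp add: act_rr_self m_assoc rr_square)

section \<open>Reflection subgroups\<close>

lemma wp_rr_closed [simp]: "ds \<in> lists \<Phi> \<Longrightarrow> wp (map rr ds) \<in> carrier W"
  by (rule wp_closed) (auto simp: in_lists_conv_set)

lemma wp_rr_append: "\<lbrakk>ds \<in> lists \<Phi>; es \<in> lists \<Phi>\<rbrakk> \<Longrightarrow> wp (map rr (ds @ es)) = wp (map rr ds) \<otimes> wp (map rr es)"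
  by (simp only: map_append, rule wp_append) (auto simp: in_lists_conv_set)

lemma generate_rr:
  assumes "\<Delta> \<subseteq> \<Phi>" shows "generate W (rr ` \<Delta>) = (\<lambda>ds. wp (map rr ds)) ` lists \<Delta>"
proof -
  have "generate W (rr ` \<Delta>) = wp ` lists (rr ` \<Delta>)"
    by (rule generate_involutions) (use assms in auto)
  then show ?thesis by (simp add: lists_image image_image)
qed

text \<open>The exchange condition for words in reflections. Reading from the right, \<gamma> is
  kept in \<Psi> until a letter equals the current root; that letter then cancels against the
  reflection in \<gamma>.\<close>

lemma root_exchange:
  assumes "\<Delta> \<subseteq> \<Psi>" "\<Psi> \<subseteq> \<Phi>" and perm: "\<And>\<delta> \<gamma>. \<lbrakk>\<delta> \<in> \<Delta>; \<gamma> \<in> \<Psi>; \<gamma> \<noteq> \<delta>\<rbrakk> \<Longrightarrow> act (rr \<delta>) \<gamma> \<in> \<Psi>"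
    and "ds \<in> lists \<Delta>" "\<gamma> \<in> \<Delta>"
  shows "act (wp (map rr ds)) \<gamma> \<in> \<Psi> \<or>
    (\<exists>as d bs. ds = as @ d # bs \<and> wp (map rr ds) \<otimes> rr \<gamma> = wp (map rr (as @ bs)))"
  using assms(4)
proof (induction ds)
  case Nil
  have "\<gamma> \<in> \<Psi>" "\<gamma> \<in> V" using assms by auto
  then show ?case by simp
next
  case (Cons d ds)
  let ?p = "wp (map rr ds)"
  have \<gamma>: "\<gamma> \<in> \<Phi>" and d: "d \<in> \<Phi>" and ds: "ds \<in> lists \<Phi>" using assms Cons by auto
  have p: "?p \<in> carrier W" using ds by (rule wp_rr_closed)
  show ?case
  proof (cases "act ?p \<gamma> \<in> \<Psi>")
    case True
    show ?thesis
    proof (cases "act ?p \<gamma> = d")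
      case True
      have "rr d = ?p \<otimes> rr \<gamma> \<otimes> inv ?p" using rr_act[OF p \<gamma>] True by simp
      then have "rr d \<otimes> ?p \<otimes> rr \<gamma> = ?p" using p \<gamma> by (simp add: m_assoc rr_square)
      then have "d # ds = [] @ d # ds \<and> wp (map rr (d # ds)) \<otimes> rr \<gamma> = wp (map rr ([] @ ds))" by simp
      then show ?thesis by blast
    next
      case False
      then have "act (rr d) (act ?p \<gamma>) \<in> \<Psi>" using perm True Cons.hyps by simp
      then show ?thesis using p \<gamma> d by (simp add: act_mult)
    qed
  next
    case False
    then obtain as e bs where *: "ds = as @ e # bs" "?p \<otimes> rr \<gamma> = wp (map rr (as @ bs))" using Cons by auto
    have "wp (map rr (d # ds)) \<otimes> rr \<gamma> = wp (map rr ((d # as) @ bs))"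
      using * p \<gamma> d by (simp add: m_assoc)
    moreover have "d # ds = (d # as) @ e # bs" using * by simp
    ultimately show ?thesis by blast
  qed
qed

text \<open>The last root of a shortest reflection word works: if the remaining word moved it out of
  \<Psi>, the exchange condition would produce a shorter word.\<close>

lemma reflection_descent:
  assumes "\<Delta> \<subseteq> \<Psi>" "\<Psi> \<subseteq> {\<gamma> \<in> \<Phi>. nonneg \<gamma>}"
    and perm: "\<And>\<delta> \<gamma>. \<lbrakk>\<delta> \<in> \<Delta>; \<gamma> \<in> \<Psi>; \<gamma> \<noteq> \<delta>\<rbrakk> \<Longrightarrow> act (rr \<delta>) \<gamma> \<in> \<Psi>"
    and "u \<in> generate W (rr ` \<Delta>)" "u \<noteq> \<one>"
  shows "\<exists>\<delta>\<in>\<Delta>. nonneg (opp (act u \<delta>))"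
proof -
  let ?P = "\<lambda>ds. ds \<in> lists \<Delta> \<and> wp (map rr ds) = u"
  have \<Delta>: "\<Delta> \<subseteq> \<Phi>" using assms by auto
  then obtain ds0 where "?P ds0" using assms(4) generate_rr by auto
  from ex_has_least_nat[of ?P, OF this, of length]
  obtain ds where ds: "?P ds" and min: "\<And>es. ?P es \<Longrightarrow> length ds \<le> length es" by blast
  have "ds \<noteq> []" using ds assms by auto
  then obtain es \<delta> where es: "ds = es @ [\<delta>]" by (metis rev_exhaust)
  have \<delta>: "\<delta> \<in> \<Delta>" "\<delta> \<in> \<Phi>" "es \<in> lists \<Delta>" "es \<in> lists \<Phi>" using ds es \<Delta> by auto
  let ?p = "wp (map rr es)"
  have p: "?p \<in> carrier W" using \<delta>(4) by (rule wp_rr_closed)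
  have u: "u = ?p \<otimes> rr \<delta>" using ds es \<delta> wp_rr_append[OF \<delta>(4), of "[\<delta>]"] by auto
  have "act ?p \<delta> \<in> \<Psi>"
  proof (rule ccontr)
    assume "act ?p \<delta> \<notin> \<Psi>"
    moreover have "\<Psi> \<subseteq> \<Phi>" using assms by auto
    ultimately obtain as d bs where *: "es = as @ d # bs" "?p \<otimes> rr \<delta> = wp (map rr (as @ bs))"
      using root_exchange[OF assms(1) _ perm \<delta>(3,1)] by blast
    then have "?P (as @ bs)" using \<delta> u by auto
    from min[OF this] show False using * es by simp
  qed
  then have "nonneg (opp (act u \<delta>))"
    using assms(2) u p \<delta> by (auto simp: act_mult act_rr_self act_opp)
  then show ?thesis using \<delta> by blast
qed

lemma parabolic_descent:
  assumes "J \<subseteq> S" "u \<in> generate W J" "u \<noteq> \<one>"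
  shows "\<exists>s\<in>J. nonneg (opp (act u (simple_root s)))"
proof -
  have "rr ` simple_root ` J = J" using assms(1) rr_simple by force
  then have u: "u \<in> generate W (rr ` simple_root ` J)" using assms by simp
  have "\<exists>\<delta>\<in>simple_root ` J. nonneg (opp (act u \<delta>))"
    by (rule reflection_descent[OF _ _ _ u assms(3), where \<Psi> = "{\<gamma> \<in> \<Phi>. nonneg \<gamma>}"])
      (use assms simple_reflection_nonneg in \<open>auto simp: rr_simple\<close>)
  then show ?thesis by blast
qed

lemma parabolic_one:
  assumes "J \<subseteq> S" "u \<in> generate W J" "\<And>s. s \<in> J \<Longrightarrow> nonneg (act u (simple_root s))"
  shows "u = \<one>"
  using assms parabolic_descent root_not_both root_I generate_S_closed by (metis subsetD)

text \<open>Isolates what coset representatives and the triviality criterion below use of the roots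
  orthogonal to J.\<close>

definition reflection_closed :: "'a vec set \<Rightarrow> bool" where
  "reflection_closed \<Psi> \<longleftrightarrow> \<Psi> \<subseteq> \<Phi> \<and> (\<forall>\<gamma>\<in>\<Psi>. opp \<gamma> \<in> \<Psi>) \<and> (\<forall>\<gamma>\<in>\<Psi>. \<forall>\<delta>\<in>\<Psi>. act (rr \<gamma>) \<delta> \<in> \<Psi>)"

lemma root_add_nonneg_not_opp:
  assumes "\<alpha> \<in> \<Phi>" "nonneg (lincomb 1 (opp \<alpha>) c \<beta>)" "0 < c" "nonneg (opp \<beta>)"
  shows "nonneg (opp \<alpha>)"
  unfolding nonneg_def
proof
  fix t
  have "0 \<le> opp \<alpha> t + c * \<beta> t" "\<beta> t \<le> 0" using assms by (auto simp: nonneg_def lincomb_def opp_def)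
  then show "0 \<le> opp \<alpha> t" using assms(3) by (smt (verit) mult_nonneg_nonpos)
qed

text \<open>If \<open>w\<close> inverts \<open>\<gamma>\<close>, then \<open>\<beta> \<mapsto> s\<^sub>\<gamma>\<beta>\<close> (or \<open>\<beta>\<close>, if \<open>s\<^sub>\<gamma>\<beta>\<close> is negative) injects the roots inverted by
  \<open>w s\<^sub>\<gamma>\<close> into those inverted by \<open>w\<close>, missing \<open>\<gamma>\<close>.\<close>

lemma Inv_mult_rr:
  assumes \<Psi>: "reflection_closed \<Psi>" and w: "w \<in> carrier W" and \<gamma>: "\<gamma> \<in> Inv w \<inter> \<Psi>"
  shows "card (Inv (w \<otimes> rr \<gamma>) \<inter> \<Psi>) < card (Inv w \<inter> \<Psi>)"
proof -
  let ?r = "act (rr \<gamma>)"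
  define f where "f \<beta> = (if nonneg (?r \<beta>) then ?r \<beta> else \<beta>)" for \<beta>
  have g: "\<gamma> \<in> \<Phi>" "nonneg \<gamma>" "nonneg (opp (act w \<gamma>))" "\<gamma> \<in> \<Psi>" using \<gamma> by (auto simp: Inv_def)
  have rrr: "?r (?r \<beta>) = \<beta>" if "\<beta> \<in> \<Phi>" for \<beta>
    using that g act_mult[of "rr \<gamma>" "rr \<gamma>" \<beta>] by (simp add: rr_square)
  have "f \<beta> \<in> Inv w \<inter> \<Psi> - {\<gamma>}" if "\<beta> \<in> Inv (w \<otimes> rr \<gamma>) \<inter> \<Psi>" for \<beta>
  proof -
    have b: "\<beta> \<in> \<Phi>" "nonneg \<beta>" "nonneg (opp (act w (?r \<beta>)))" "\<beta> \<in> \<Psi>"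
      using that w g by (auto simp: Inv_def act_mult)
    have r\<Psi>: "?r \<beta> \<in> \<Psi>" using \<Psi> g b by (auto simp: reflection_closed_def)
    have "\<beta> \<noteq> \<gamma>"
      using b g w root_not_both[of "act w \<gamma>"] by (auto simp: act_rr_self act_opp)
    have "?r \<beta> \<noteq> \<gamma>"
      using rrr[OF b(1)] b(2) g root_not_both[of "\<gamma>"] by (auto simp: act_rr_self)
    show ?thesis
    proof (cases "nonneg (?r \<beta>)")
      case True
      then show ?thesis using b g r\<Psi> \<open>?r \<beta> \<noteq> \<gamma>\<close> by (auto simp: f_def Inv_def)
    next
      case False
      let ?c = "2 * B \<gamma> \<beta>"
      have r: "?r \<beta> = lincomb 1 \<beta> (- ?c) \<gamma>" using b g by (simp add: act_rr)
      have c: "0 < ?c"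
      proof (rule ccontr)
        assume "\<not> 0 < ?c"
        then have "nonneg (?r \<beta>)" unfolding r using b g by (intro nonneg_lincomb) auto
        then show False using False by simp
      qed
      \<comment> \<open>The left side is nonnegative, while on the right the positive multiple of
        w\<gamma> is nonpositive; this forces w\<beta> to be negative.\<close>
      have "opp (act w (?r \<beta>)) = lincomb 1 (opp (act w \<beta>)) ?c (act w \<gamma>)"
        unfolding r using b g w by (simp add: act_lincomb) (auto simp: opp_def lincomb_def)
      then have "nonneg (opp (act w \<beta>))"
        using root_add_nonneg_not_opp[of "act w \<beta>" ?c "act w \<gamma>"] b c g w by simp
      then show ?thesis using False b \<open>\<beta> \<noteq> \<gamma>\<close> by (auto simp: f_def Inv_def)
    qed
  qed
  then have im: "f ` (Inv (w \<otimes> rr \<gamma>) \<inter> \<Psi>) \<subseteq> Inv w \<inter> \<Psi> - {\<gamma>}" by blast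
  have inj: "inj_on f (Inv (w \<otimes> rr \<gamma>) \<inter> \<Psi>)"
  proof (rule inj_onI)
    fix \<alpha> \<beta> assume "\<alpha> \<in> Inv (w \<otimes> rr \<gamma>) \<inter> \<Psi>" "\<beta> \<in> Inv (w \<otimes> rr \<gamma>) \<inter> \<Psi>" "f \<alpha> = f \<beta>"
    then have ab: "\<alpha> \<in> \<Phi>" "\<beta> \<in> \<Phi>" "nonneg \<alpha>" "nonneg \<beta>" "f \<alpha> = f \<beta>" by (auto simp: Inv_def)
    show "\<alpha> = \<beta>"
    proof (cases "nonneg (?r \<alpha>) = nonneg (?r \<beta>)")
      case True
      then show ?thesis using ab(5) rrr[OF ab(1)] rrr[OF ab(2)] unfolding f_def by metis
    next
      case False
      then show ?thesis using ab rrr[OF ab(1)] rrr[OF ab(2)] unfolding f_def by metis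
    qed
  qed
  have fin: "finite (Inv w \<inter> \<Psi>)" using finite_Inv[OF w] by simp
  have "card (Inv (w \<otimes> rr \<gamma>) \<inter> \<Psi>) \<le> card (Inv w \<inter> \<Psi> - {\<gamma>})"
    using card_inj_on_le[OF inj im] fin by simp
  also have "\<dots> < card (Inv w \<inter> \<Psi>)" using fin \<gamma> by (intro card_Diff1_less)
  finally show ?thesis .
qed

lemma generate_rr_closed:
  assumes "reflection_closed \<Psi>" "u \<in> generate W (rr ` \<Psi>)"
  shows "u \<in> carrier W"
proof -
  have "rr ` \<Psi> \<subseteq> carrier W" using assms(1) by (auto simp: reflection_closed_def)
  then show ?thesis using generate_incl assms(2) by blast
qed

lemma reflection_group_act:
  assumes \<Psi>: "reflection_closed \<Psi>" and "u \<in> generate W (rr ` \<Psi>)" "\<gamma> \<in> \<Psi>"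
  shows "act u \<gamma> \<in> \<Psi>"
proof -
  have sub: "\<Psi> \<subseteq> \<Phi>" using \<Psi> by (simp add: reflection_closed_def)
  obtain ds where ds: "ds \<in> lists \<Psi>" "u = wp (map rr ds)" using assms generate_rr[OF sub] by auto
  have "act (wp (map rr ds)) \<gamma> \<in> \<Psi>" using ds(1)
  proof (induction ds)
    case Nil
    then show ?case using assms sub by auto
  next
    case (Cons d ds)
    have "d \<in> \<Phi>" "\<gamma> \<in> \<Phi>" "ds \<in> lists \<Phi>" using Cons sub assms by auto
    then have "act (wp (map rr (d # ds))) \<gamma> = act (rr d) (act (wp (map rr ds)) \<gamma>)"
      using act_mult[of "rr d" "wp (map rr ds)" \<gamma>] wp_rr_closed[of ds] by simp
    then show ?case using Cons \<Psi> by (simp add: reflection_closed_def)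
  qed
  then show ?thesis using ds by simp
qed

text \<open>Inverted roots of \<Psi> are removed one reflection at a time; the process ends because
  w inverts only finitely many roots and their number in \<Psi> drops.\<close>

lemma reflection_coset_rep:
  assumes \<Psi>: "reflection_closed \<Psi>" and "w \<in> carrier W"
  shows "\<exists>u\<in>generate W (rr ` \<Psi>). \<forall>\<gamma>\<in>\<Psi>. nonneg \<gamma> \<longrightarrow> nonneg (act (w \<otimes> u) \<gamma>)"
  using assms(2)
proof (induction "card (Inv w \<inter> \<Psi>)" arbitrary: w rule: less_induct)
  case less
  have sub: "\<Psi> \<subseteq> \<Phi>" using \<Psi> by (simp add: reflection_closed_def)
  show ?case
  proof (cases "Inv w \<inter> \<Psi> = {}")
    case True
    have "nonneg (act (w \<otimes> \<one>) \<gamma>)" if "\<gamma> \<in> \<Psi>" "nonneg \<gamma>" for \<gamma>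
    proof -
      have g: "\<gamma> \<in> \<Phi>" "act w \<gamma> \<in> \<Phi>" using sub that less.prems by auto
      have "\<not> nonneg (opp (act w \<gamma>))" using True g that unfolding Inv_def by blast
      then show ?thesis using root_cases[OF g(2)] less.prems by simp
    qed
    then show ?thesis using generate.one by blast
  next
    case False
    then obtain \<gamma> where \<gamma>: "\<gamma> \<in> Inv w \<inter> \<Psi>" by blast
    then have r: "\<gamma> \<in> \<Phi>" "rr \<gamma> \<in> generate W (rr ` \<Psi>)" by (auto simp: Inv_def intro: generate.incl)
    obtain u where u: "u \<in> generate W (rr ` \<Psi>)" "\<forall>\<delta>\<in>\<Psi>. nonneg \<delta> \<longrightarrow> nonneg (act (w \<otimes> rr \<gamma> \<otimes> u) \<delta>)"
      using less.hyps[OF Inv_mult_rr[OF \<Psi> less.prems \<gamma>]] less.prems r by auto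
    have "w \<otimes> rr \<gamma> \<otimes> u = w \<otimes> (rr \<gamma> \<otimes> u)"
      using generate_rr_closed[OF \<Psi> u(1)] less.prems r by (simp add: m_assoc)
    then show ?thesis using u r generate.eng[OF r(2) u(1)] by auto
  qed
qed

text \<open>The roots \<open>x \<alpha>\<^sub>s \<in> \<Psi>\<close>, where \<open>x\<inverse>\<close> inverts no root of \<open>\<Psi>\<close>, play the role of simple roots:
  walking along a word, a letter \<open>s\<close> either keeps \<open>x s\<close> of this kind or can be pulled to the left
  as \<open>s\<^bsub>x \<alpha>\<^sub>s\<^esub>\<close>.\<close>

lemma reflection_group_one:
  assumes \<Psi>: "reflection_closed \<Psi>" and u: "u \<in> generate W (rr ` \<Psi>)"
    and pos: "\<And>\<gamma>. \<lbrakk>\<gamma> \<in> \<Psi>; nonneg \<gamma>\<rbrakk> \<Longrightarrow> nonneg (act u \<gamma>)"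
  shows "u = \<one>"
proof -
  have sub: "\<Psi> \<subseteq> \<Phi>" using \<Psi> by (simp add: reflection_closed_def)
  define X where "X = {x \<in> carrier W. \<forall>\<gamma>\<in>\<Psi>. nonneg \<gamma> \<longrightarrow> nonneg (act (inv x) \<gamma>)}"
  have Xc: "x \<in> carrier W" if "x \<in> X" for x using that X_def by blast
  have X_iff: "nonneg (act (inv x) \<gamma>) \<longleftrightarrow> nonneg \<gamma>" if x: "x \<in> X" and \<gamma>: "\<gamma> \<in> \<Psi>" for x \<gamma>
  proof -
    have "opp \<gamma> \<in> \<Psi>" using \<Psi> \<gamma> by (simp add: reflection_closed_def)
    then have "nonneg (opp \<gamma>) \<Longrightarrow> nonneg (opp (act (inv x) \<gamma>))"
      using x \<gamma> sub by (auto simp: X_def act_opp[symmetric])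
    moreover have g: "\<gamma> \<in> \<Phi>" "act (inv x) \<gamma> \<in> \<Phi>" using sub \<gamma> Xc[OF x] by auto
    moreover have "nonneg \<gamma> \<Longrightarrow> nonneg (act (inv x) \<gamma>)" using x \<gamma> by (simp add: X_def)
    ultimately show ?thesis using root_not_both[OF g(1)] root_not_both[OF g(2)] by blast
  qed
  define \<Delta> where "\<Delta> = {act x (simple_root s) | x s. x \<in> X \<and> s \<in> S \<and> act x (simple_root s) \<in> \<Psi>}"
  define \<Psi>p where "\<Psi>p = {\<gamma> \<in> \<Psi>. nonneg \<gamma>}"
  have \<Delta>\<Psi>: "\<Delta> \<subseteq> \<Psi>" unfolding \<Delta>_def by auto
  have \<Delta>p: "\<Delta> \<subseteq> \<Psi>p"
  proof
    fix \<delta> assume "\<delta> \<in> \<Delta>"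
    then obtain x s where *: "\<delta> = act x (simple_root s)" "x \<in> X" "s \<in> S" "\<delta> \<in> \<Psi>" unfolding \<Delta>_def by auto
    then have "nonneg (act (inv x) \<delta>)" using Xc by simp
    then show "\<delta> \<in> \<Psi>p" using X_iff * by (simp add: \<Psi>p_def)
  qed
  \<comment> \<open>Pulled back by x, which respects signs on \<Psi>, the root \<delta> becomes
    \<alpha>_s, and \<alpha>_s is the only positive root that s makes negative.\<close>
  have perm: "act (rr \<delta>) \<gamma> \<in> \<Psi>p" if "\<delta> \<in> \<Delta>" "\<gamma> \<in> \<Psi>p" "\<gamma> \<noteq> \<delta>" for \<delta> \<gamma>
  proof -
    obtain x s where *: "\<delta> = act x (simple_root s)" "x \<in> X" "s \<in> S" "\<delta> \<in> \<Psi>"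
      using \<open>\<delta> \<in> \<Delta>\<close> unfolding \<Delta>_def by blast
    note xc = Xc[OF *(2)]
    have \<gamma>: "\<gamma> \<in> \<Psi>" "\<gamma> \<in> \<Phi>" "nonneg (act (inv x) \<gamma>)" using that sub X_iff * by (auto simp: \<Psi>p_def)
    have "act (inv x) \<gamma> \<noteq> simple_root s" using that(3) *(1) act_inv2[OF xc root_V[OF \<gamma>(2)]] by metis
    then have "nonneg (act s (act (inv x) \<gamma>))"
      using simple_reflection_nonneg \<gamma> * xc by simp
    moreover have "rr \<delta> = x \<otimes> s \<otimes> inv x" using * xc by (simp add: rr_eq)
    ultimately have "nonneg (act (inv x) (act (rr \<delta>) \<gamma>))" using * xc \<gamma> by (simp add: act_mult)
    moreover have "act (rr \<delta>) \<gamma> \<in> \<Psi>" using * \<gamma> \<Psi> by (simp add: reflection_closed_def)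
    ultimately show ?thesis using X_iff * by (simp add: \<Psi>p_def)
  qed
  let ?D = "generate W (rr ` \<Delta>)"
  have D\<Psi>: "?D \<subseteq> generate W (rr ` \<Psi>)" using \<Delta>\<Psi> by (intro mono_generate) auto
  have Dc: "v \<in> carrier W" if "v \<in> ?D" for v using that D\<Psi> generate_rr_closed[OF \<Psi>] by auto
  have \<Delta>c: "rr ` \<Delta> \<subseteq> carrier W"
  proof (rule image_subsetI)
    fix \<delta> assume "\<delta> \<in> \<Delta>"
    from subsetD[OF sub subsetD[OF \<Delta>\<Psi> this]] show "rr \<delta> \<in> carrier W" by (rule rr_closed)
  qed
  have walk: "\<exists>v\<in>?D. \<exists>x\<in>X. wp ws = v \<otimes> x" if "ws \<in> lists S" for ws
    using that
  proof (induction ws rule: rev_induct)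
    case Nil
    have "\<one> \<in> X" using sub by (auto simp: X_def)
    then show ?case by (intro bexI[of _ \<one>]) (simp_all add: generate.one)
  next
    case (snoc s ws)
    then have s: "s \<in> S" "ws \<in> lists S" by auto
    then obtain v x where vx: "v \<in> ?D" "x \<in> X" "wp ws = v \<otimes> x" using snoc by blast
    note c = Dc[OF vx(1)] Xc[OF vx(2)]
    have w: "wp (ws @ [s]) = v \<otimes> x \<otimes> s" using s vx by (simp add: wp_append_S)
    show ?case
    proof (cases "act x (simple_root s) \<in> \<Psi>")
      case True
      let ?r = "rr (act x (simple_root s))"
      have "act x (simple_root s) \<in> \<Delta>" using True vx(2) s(1) unfolding \<Delta>_def by blast
      then have "?r \<in> ?D" by (intro generate.incl imageI)
      then have "v \<otimes> ?r \<in> ?D" by (rule generate.eng[OF vx(1)])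
      moreover have "wp (ws @ [s]) = v \<otimes> ?r \<otimes> x" using c s w by (simp add: rr_eq m_assoc)
      ultimately show ?thesis using vx(2) by (intro bexI[of _ "v \<otimes> ?r"] bexI[of _ x])
    next
      case False
      have "nonneg (act (inv (x \<otimes> s)) \<gamma>)" if \<gamma>: "\<gamma> \<in> \<Psi>" "nonneg \<gamma>" for \<gamma>
      proof -
        have g: "\<gamma> \<in> \<Phi>" "nonneg (act (inv x) \<gamma>)" using \<gamma> sub vx X_iff by auto
        have "act (inv x) \<gamma> \<noteq> simple_root s" using False \<gamma>(1) act_inv2[OF c(2) root_V[OF g(1)]] by metis
        then have "nonneg (act s (act (inv x) \<gamma>))" using simple_reflection_nonneg g s c by simp
        then show ?thesis using g s c by (simp add: inv_mult_group act_mult)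
      qed
      then have "x \<otimes> s \<in> X" using c s by (simp add: X_def)
      moreover have "wp (ws @ [s]) = v \<otimes> (x \<otimes> s)" using w c s by (simp add: m_assoc)
      ultimately show ?thesis using vx(1) by (intro bexI[of _ v] bexI[of _ "x \<otimes> s"])
    qed
  qed
  \<comment> \<open>With \<gamma> = w\<alpha>_s and w = v x from \<open>walk\<close>, the root
    x\<alpha>_s = v^-1 \<gamma> lies in \<Psi>, as the reflection group of \<Psi> preserves \<Psi>.
    So it lies in \<Delta>, and v conjugates its reflection to that in \<gamma>.\<close>
  have "rr \<gamma> \<in> ?D" if \<gamma>: "\<gamma> \<in> \<Psi>" for \<gamma>
  proof -
    obtain w s where w: "w \<in> carrier W" "s \<in> S" "\<gamma> = act w (simple_root s)" using \<gamma> sub root_E by blast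
    obtain v x where vx: "v \<in> ?D" "x \<in> X" "w = v \<otimes> x" using walk word_exists[OF w(1)] by metis
    note c = Dc[OF vx(1)] Xc[OF vx(2)]
    let ?d = "act x (simple_root s)"
    have g: "\<gamma> = act v ?d" using w vx c by (simp add: act_mult)
    then have "?d = act (inv v) \<gamma>" using c w by simp
    moreover have iD: "inv v \<in> ?D" by (rule generate_m_inv_closed[OF \<Delta>c vx(1)])
    ultimately have "?d \<in> \<Psi>" using reflection_group_act[OF \<Psi> subsetD[OF D\<Psi> iD] \<gamma>] by simp
    then have "?d \<in> \<Delta>" using vx(2) w(2) unfolding \<Delta>_def by blast
    then have "rr ?d \<in> ?D" by (intro generate.incl imageI)
    then have "v \<otimes> rr ?d \<otimes> inv v \<in> ?D" by (intro generate.eng vx(1) iD)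
    then show ?thesis using g c w by (simp add: rr_act)
  qed
  then have "rr ` \<Psi> \<subseteq> ?D" by (rule image_subsetI)
  then have uD: "u \<in> ?D"
    using u generate_subgroup_incl[OF _ generate_is_subgroup[OF \<Delta>c]] by (rule_tac subsetD)
  show ?thesis
  proof (rule ccontr)
    assume "u \<noteq> \<one>"
    moreover have "\<Psi>p \<subseteq> {\<gamma> \<in> \<Phi>. nonneg \<gamma>}" using sub by (auto simp: \<Psi>p_def)
    ultimately obtain \<delta> where d: "\<delta> \<in> \<Delta>" "nonneg (opp (act u \<delta>))"
      using reflection_descent[OF \<Delta>p _ perm uD] by blast
    then have "\<delta> \<in> \<Phi>" "nonneg (act u \<delta>)" using \<Delta>p pos sub by (auto simp: \<Psi>p_def)
    then show False using d root_not_both generate_rr_closed[OF \<Psi> u] by simp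
  qed
qed

section \<open>Coordinates, supports and extremality of simple roots\<close>

lemma act_coord:
  assumes "J \<subseteq> S" "g \<in> generate W J" "v \<in> V" "r \<notin> J"
  shows "act g v r = v r"
proof -
  obtain ws where ws: "ws \<in> lists J" "g = wp ws" using assms generate_eq_words by auto
  then have "ws \<in> lists S" using assms by auto
  moreover have "wact ws v r = v r" using ws(1) assms(4)
  proof (induction ws)
    case (Cons s ws)
    then show ?case using rf_coord[of r s "wact ws v"] by auto
  qed simp
  ultimately show ?thesis using ws assms by (simp add: act_word)
qed

text \<open>Recovers full linearity from the binary combination, by induction over a finite set
  containing the support.\<close>

lemma act_expand:
  assumes "w \<in> carrier W" "v \<in> V"
  shows "act w v r = (\<Sum>t | v t \<noteq> 0. v t * act w (simple_root t) r)"
proof -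
  have "finite F \<Longrightarrow> \<forall>v\<in>V. {t. v t \<noteq> 0} \<subseteq> F \<longrightarrow> act w v r = (\<Sum>t\<in>F. v t * act w (simple_root t) r)" for F
  proof (induction F rule: finite_induct)
    case empty
    have "act w v r = 0" if "v \<in> V" "{t. v t \<noteq> 0} \<subseteq> {}" for v
    proof -
      have "v = lincomb 0 v 0 v" using that by (auto simp: lincomb_def)
      then have "act w v = lincomb 0 (act w v) 0 (act w v)" using act_lincomb[OF assms(1) that(1,1), of 0 0] by simp
      then show ?thesis by (metis lincomb_apply add_0 mult_zero_left)
    qed
    then show ?case by (metis sum.empty)
  next
    case (insert s F)
    show ?case
    proof (intro ballI impI)
      fix v assume v: "v \<in> V" "{t. v t \<noteq> 0} \<subseteq> insert s F"
      show "act w v r = (\<Sum>t\<in>insert s F. v t * act w (simple_root t) r)"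
      proof (cases "s \<in> S")
        case False
        then have "{t. v t \<noteq> 0} \<subseteq> F" "v s = 0" using v V_supp by auto
        then show ?thesis using insert v by simp
      next
        case True
        let ?u = "v(s := 0)"
        have u: "?u \<in> V" "{t. ?u t \<noteq> 0} \<subseteq> F" using v by (auto simp: V_def elim: finite_subset[rotated])
        have "v = lincomb 1 ?u (v s) (simple_root s)" by (auto simp: lincomb_def simple_root_def)
        then have "act w v = lincomb 1 (act w ?u) (v s) (act w (simple_root s))"
          using act_lincomb[OF assms(1) u(1) simple_root_V[OF True]] by metis
        then have "act w v r = act w ?u r + v s * act w (simple_root s) r" by (simp add: lincomb_apply)
        also have "act w ?u r = (\<Sum>t\<in>F. ?u t * act w (simple_root t) r)" using insert u by blast
        also have "\<dots> = (\<Sum>t\<in>F. v t * act w (simple_root t) r)" using insert by (intro sum.cong) auto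
        finally show ?thesis using insert by simp
      qed
    qed
  qed
  then show ?thesis using assms V_fin by blast
qed

lemma act_nonneg:
  assumes "w \<in> carrier W" "v \<in> V" "nonneg v" "\<And>t. v t \<noteq> 0 \<Longrightarrow> nonneg (act w (simple_root t))"
  shows "nonneg (act w v)"
  unfolding nonneg_def using assms by (auto simp: act_expand nonneg_def intro!: sum_nonneg)

lemma act_nonpos:
  assumes "w \<in> carrier W" "v \<in> V" "nonneg v" "\<And>t. v t \<noteq> 0 \<Longrightarrow> nonneg (opp (act w (simple_root t)))"
  shows "nonneg (opp (act w v))"
  unfolding nonneg_def using assms
  by (auto simp: act_expand nonneg_def opp_def intro!: sum_nonpos mult_nonneg_nonpos)

text \<open>In a nonnegative expression of \<alpha>_t by positive roots, the coordinates other than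
  t vanish term by term, so each root that occurs lies on the line of \<alpha>_t.\<close>

lemma extremal_simple_root:
  assumes "finite A" "t \<in> S" and f: "\<And>j. j \<in> A \<Longrightarrow> f j \<in> \<Phi>" "\<And>j. j \<in> A \<Longrightarrow> nonneg (f j)"
    and c: "\<And>j. j \<in> A \<Longrightarrow> 0 \<le> c j" and sum: "\<And>r. simple_root t r = (\<Sum>j\<in>A. c j * f j r)"
    and k: "k \<in> A" "c k \<noteq> 0"
  shows "f k = simple_root t"
proof -
  have "f k r = 0" if "r \<noteq> t" for r
  proof -
    have "(\<Sum>j\<in>A. c j * f j r) = 0" using sum[of r] that by (simp add: simple_root_def)
    moreover have "\<And>j. j \<in> A \<Longrightarrow> 0 \<le> c j * f j r" using f(2) c by (simp add: nonneg_def)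
    ultimately have "\<forall>j\<in>A. c j * f j r = 0"
      using sum_nonneg_eq_0_iff[of A "\<lambda>j. c j * f j r"] assms(1) by blast
    then show ?thesis using k by auto
  qed
  then show ?thesis using root_multiple_simple[of "f k" t] f k assms(2) by simp
qed

text \<open>Expand w\<alpha>_t over K and apply w^-1: \<alpha>_t becomes a nonnegative combination
  of positive roots w^-1 \<alpha>_k, and extremality forces every root that occurs to be
  \<alpha>_t.\<close>

lemma act_simple_root_simple:
  assumes "w \<in> carrier W" "t \<in> S" "K \<subseteq> S" "nonneg (act w (simple_root t))"
    and supp: "\<And>r. r \<notin> K \<Longrightarrow> act w (simple_root t) r = 0"
    and pos: "\<And>k. k \<in> K \<Longrightarrow> nonneg (act (inv w) (simple_root k))"
  shows "\<exists>k\<in>K. act w (simple_root t) = simple_root k"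
proof -
  let ?g = "act w (simple_root t)"
  have g: "?g \<in> \<Phi>" using assms by simp
  obtain k where k: "?g k \<noteq> 0" using root_nonzero[OF g] by blast
  have K: "j \<in> K" "j \<in> S" if "?g j \<noteq> 0" for j using supp that assms(3) by auto
  have "act (inv w) (simple_root k) = simple_root t"
  proof (rule extremal_simple_root[where A = "{j. ?g j \<noteq> 0}" and c = ?g])
    show "simple_root t r = (\<Sum>j | ?g j \<noteq> 0. ?g j * act (inv w) (simple_root j) r)" for r
      using act_expand[of "inv w" ?g r] assms by simp
  qed (use K assms g V_fin k in \<open>auto simp: nonneg_def\<close>)
  then have "?g = simple_root k" using act_inv2[OF assms(1) simple_root_V[OF K(2)[OF k]]] by metis
  then show ?thesis using K k by blast
qed

text \<open>The same expansion with coefficients and roots both negated; this version serves longest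
  elements.\<close>

lemma act_simple_root_opp_simple:
  assumes "w \<in> carrier W" "t \<in> S" "K \<subseteq> S" "nonneg (opp (act w (simple_root t)))"
    and supp: "\<And>r. r \<notin> K \<Longrightarrow> act w (simple_root t) r = 0"
    and neg: "\<And>k. k \<in> K \<Longrightarrow> nonneg (opp (act (inv w) (simple_root k)))"
  shows "\<exists>k\<in>K. act w (simple_root t) = opp (simple_root k)"
proof -
  let ?g = "act w (simple_root t)"
  have g: "?g \<in> \<Phi>" using assms by simp
  obtain k where k: "?g k \<noteq> 0" using root_nonzero[OF g] by blast
  have K: "j \<in> K" "j \<in> S" if "?g j \<noteq> 0" for j using supp that assms(3) by auto
  have "opp (act (inv w) (simple_root k)) = simple_root t"
  proof (rule extremal_simple_root[where A = "{j. ?g j \<noteq> 0}" and c = "opp ?g"])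
    show "simple_root t r = (\<Sum>j | ?g j \<noteq> 0. opp ?g j * opp (act (inv w) (simple_root j)) r)" for r
      using act_expand[of "inv w" ?g r] assms by (simp add: opp_def)
    show "0 \<le> opp ?g j" for j using assms(4) by (simp add: nonneg_def)
    show "opp ?g k \<noteq> 0" using k by (simp add: opp_def)
  qed (use K assms(1,2) neg g V_fin k in auto)
  then have "act (inv w) (simple_root k) = opp (simple_root t)" by (metis opp_opp)
  then have "simple_root k = act w (opp (simple_root t))"
    using act_inv2[OF assms(1) simple_root_V[OF K(2)[OF k]]] by metis
  then have "?g = opp (simple_root k)" using assms by (simp add: act_opp)
  then show ?thesis using K k by blast
qed

end

section \<open>Internal products and normalizers in a group\<close>

context group
begin

lemma normal_restrictI:
  assumes "subgroup A G" "subgroup N G" "N \<subseteq> A" "\<And>a n. \<lbrakk>a \<in> A; n \<in> N\<rbrakk> \<Longrightarrow> a \<otimes> n \<otimes> inv a \<in> N"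
  shows "N \<lhd> G\<lparr>carrier := A\<rparr>"
proof (rule group.normal_invI)
  show "group (G\<lparr>carrier := A\<rparr>)" using assms(1) by (rule subgroup_imp_group)
  show "subgroup N (G\<lparr>carrier := A\<rparr>)" using assms by (intro subgroup_incl)
  show "x \<otimes>\<^bsub>G\<lparr>carrier := A\<rparr>\<^esub> h \<otimes>\<^bsub>G\<lparr>carrier := A\<rparr>\<^esub> inv\<^bsub>G\<lparr>carrier := A\<rparr>\<^esub> x \<in> N"
    if "x \<in> carrier (G\<lparr>carrier := A\<rparr>)" "h \<in> N" for x h
    using that assms(1,4) by (simp add: m_inv_consistent)
qed

lemma is_semidirectI:
  assumes "subgroup A G" "subgroup N G" "subgroup H G" "N \<subseteq> A" "H \<subseteq> A"
    "\<And>a n. \<lbrakk>a \<in> A; n \<in> N\<rbrakk> \<Longrightarrow> a \<otimes> n \<otimes> inv a \<in> N"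
    "\<And>x. \<lbrakk>x \<in> N; x \<in> H\<rbrakk> \<Longrightarrow> x = \<one>" "\<And>a. a \<in> A \<Longrightarrow> \<exists>n\<in>N. \<exists>h\<in>H. a = n \<otimes> h"
  shows "is_semidirect G A N H"
proof -
  have "N \<inter> H = {\<one>}"
    using assms(7) subgroup.one_closed[OF assms(2)] subgroup.one_closed[OF assms(3)] by blast
  moreover have "N <#> H = A"
  proof (intro equalityI subsetI)
    fix a assume "a \<in> N <#> H"
    then obtain n h where "n \<in> N" "h \<in> H" "a = n \<otimes> h" unfolding set_mult_def by blast
    then show "a \<in> A" using assms(4,5) subgroup.m_closed[OF assms(1)] by blast
  next
    fix a assume "a \<in> A"
    then show "a \<in> N <#> H" using assms(8) unfolding set_mult_def by blast
  qed
  ultimately show ?thesis unfolding is_semidirect_def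
    using assms normal_restrictI[OF assms(1,2,4)] subgroup_incl[OF assms(3,1,5)] by blast
qed

lemma is_directI:
  assumes "subgroup N G" "subgroup K G" "\<And>n k. \<lbrakk>n \<in> N; k \<in> K\<rbrakk> \<Longrightarrow> n \<otimes> k = k \<otimes> n"
    "\<And>x. \<lbrakk>x \<in> N; x \<in> K\<rbrakk> \<Longrightarrow> x = \<one>"
  shows "is_direct G (N <#> K) N K"
proof -
  have c: "n \<in> carrier G" "k \<in> carrier G" if "n \<in> N" "k \<in> K" for n k
    using that assms subgroup.mem_carrier by metis+
  have one: "\<one> \<in> N" "\<one> \<in> K" using subgroup.one_closed[OF assms(1)] subgroup.one_closed[OF assms(2)] by auto
  have sub: "subgroup (N <#> K) G"
  proof (rule subgroupI)
    show "N <#> K \<subseteq> carrier G" using c by (auto simp: set_mult_def)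
    show "N <#> K \<noteq> {}" using one by (auto simp: set_mult_def)
    fix a assume "a \<in> N <#> K"
    then obtain n k where a: "n \<in> N" "k \<in> K" "a = n \<otimes> k" by (auto simp: set_mult_def)
    have "inv a = inv n \<otimes> inv k" using a c assms(3) by (metis inv_mult_group)
    then show "inv a \<in> N <#> K"
      using subgroup.m_inv_closed[OF assms(1) a(1)] subgroup.m_inv_closed[OF assms(2) a(2)]
      by (auto simp: set_mult_def)
    fix b assume "b \<in> N <#> K"
    then obtain n' k' where b: "n' \<in> N" "k' \<in> K" "b = n' \<otimes> k'" by (auto simp: set_mult_def)
    have "a \<otimes> b = n \<otimes> (k \<otimes> n') \<otimes> k'" using a b c by (simp add: m_assoc)
    also have "\<dots> = (n \<otimes> n') \<otimes> (k \<otimes> k')" using a b c assms(3)[of n' k, symmetric] by (simp add: m_assoc)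
    finally show "a \<otimes> b \<in> N <#> K"
      using subgroup.m_closed[OF assms(1) a(1) b(1)] subgroup.m_closed[OF assms(2) a(2) b(2)]
      by (auto simp: set_mult_def)
  qed
  have subs: "N \<subseteq> N <#> K" "K \<subseteq> N <#> K"
  proof -
    have "n = n \<otimes> \<one>" if "n \<in> N" for n using c(1)[OF that one(2)] by simp
    then show "N \<subseteq> N <#> K" unfolding set_mult_def using one(2) by blast
    have "k = \<one> \<otimes> k" if "k \<in> K" for k using c(2)[OF one(1) that] by simp
    then show "K \<subseteq> N <#> K" unfolding set_mult_def using one(1) by blast
  qed
  have conj: "n \<otimes> k \<otimes> x \<otimes> inv (n \<otimes> k) \<in> N" if "n \<in> N" "k \<in> K" "x \<in> N" for n k x
  proof -
    have "n \<otimes> k \<otimes> x \<otimes> inv (n \<otimes> k) = n \<otimes> (k \<otimes> x) \<otimes> inv k \<otimes> inv n"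
      using that c[OF that(1,2)] c[OF that(3,2)] by (simp add: m_assoc inv_mult_group)
    also have "\<dots> = n \<otimes> x \<otimes> inv n"
      using that c[OF that(1,2)] c[OF that(3,2)] assms(3)[of x k, symmetric] by (simp add: m_assoc)
    finally show ?thesis using that assms(1) by (simp add: subgroup.m_closed subgroup.m_inv_closed)
  qed
  have conj': "n \<otimes> k \<otimes> x \<otimes> inv (n \<otimes> k) \<in> K" if "n \<in> N" "k \<in> K" "x \<in> K" for n k x
  proof -
    have kx: "k \<otimes> x \<otimes> inv k \<in> K" using that assms(2) by (simp add: subgroup.m_closed subgroup.m_inv_closed)
    have "n \<otimes> k \<otimes> x \<otimes> inv (n \<otimes> k) = n \<otimes> (k \<otimes> x \<otimes> inv k) \<otimes> inv n"
      using that c[OF that(1,2)] c[OF that(1,3)] by (simp add: m_assoc inv_mult_group)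
    also have "\<dots> = k \<otimes> x \<otimes> inv k"
      unfolding assms(3)[OF that(1) kx] using c[OF that(1) kx] by (simp only: m_assoc inv_closed r_inv r_one)
    finally show ?thesis using kx by simp
  qed
  have "N \<inter> K = {\<one>}" using one assms(4) by blast
  moreover have "N \<lhd> G\<lparr>carrier := N <#> K\<rparr>"
    by (rule normal_restrictI[OF sub assms(1) subs(1)]) (auto simp: set_mult_def conj)
  moreover have "K \<lhd> G\<lparr>carrier := N <#> K\<rparr>"
    by (rule normal_restrictI[OF sub assms(2) subs(2)]) (auto simp: set_mult_def conj')
  ultimately show ?thesis unfolding is_direct_def using sub by blast
qed

text \<open>The normalizer is defined as a stabilizer under conjugation of subsets. The equality of
  sets splits into two inclusions, the second of which is conjugation by the inverse.\<close>

lemma normalizer_iff: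
  assumes "subgroup H G"
  shows "w \<in> normalizer G H \<longleftrightarrow> w \<in> carrier G \<and> (\<forall>h\<in>H. w \<otimes> h \<otimes> inv w \<in> H \<and> inv w \<otimes> h \<otimes> w \<in> H)"
proof (cases "w \<in> carrier G")
  case True
  have H: "H \<subseteq> carrier G" using assms subgroup.subset by blast
  have eq: "w <# H #> inv w = (\<lambda>h. w \<otimes> h \<otimes> inv w) ` H"
    by (auto simp: l_coset_def r_coset_def)
  have "w \<in> normalizer G H \<longleftrightarrow> (\<lambda>h. w \<otimes> h \<otimes> inv w) ` H = H"
    unfolding normalizer_def stabilizer_def using True H eq by simp
  also have "\<dots> \<longleftrightarrow> (\<forall>h\<in>H. w \<otimes> h \<otimes> inv w \<in> H \<and> inv w \<otimes> h \<otimes> w \<in> H)"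
  proof
    assume *: "(\<lambda>h. w \<otimes> h \<otimes> inv w) ` H = H"
    show "\<forall>h\<in>H. w \<otimes> h \<otimes> inv w \<in> H \<and> inv w \<otimes> h \<otimes> w \<in> H"
    proof
      fix h assume h: "h \<in> H"
      then obtain k where k: "k \<in> H" "h = w \<otimes> k \<otimes> inv w" using * by blast
      then have "k \<in> carrier G" using H by blast
      then have "inv w \<otimes> h \<otimes> w = k" using True k by (simp add: m_assoc) (simp flip: m_assoc)
      then show "w \<otimes> h \<otimes> inv w \<in> H \<and> inv w \<otimes> h \<otimes> w \<in> H" using * h k by blast
    qed
  next
    assume *: "\<forall>h\<in>H. w \<otimes> h \<otimes> inv w \<in> H \<and> inv w \<otimes> h \<otimes> w \<in> H"
    show "(\<lambda>h. w \<otimes> h \<otimes> inv w) ` H = H"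
    proof (intro equalityI subsetI)
      fix h assume h: "h \<in> H"
      then have "h \<in> carrier G" using H by blast
      then have "h = w \<otimes> (inv w \<otimes> h \<otimes> w) \<otimes> inv w" using True by (simp add: m_assoc) (simp flip: m_assoc)
      then show "h \<in> (\<lambda>h. w \<otimes> h \<otimes> inv w) ` H" using * h by blast
    qed (use * in auto)
  qed
  finally show ?thesis using True by simp
qed (simp add: normalizer_def stabilizer_def)

end

section \<open>Roots orthogonal to a standard parabolic\<close>

lemma positive_part_eq: "positive_part \<Psi> = {\<gamma> \<in> \<Psi>. nonneg \<gamma>}"
  by (simp add: positive_part_def nonneg_def)

context coxeter
begin

lemma perp_sub: "perp_roots W S J \<subseteq> \<Phi>"
  by (auto simp: perp_roots_def)

lemma perp_root: "\<gamma> \<in> perp_roots W S J \<Longrightarrow> \<gamma> \<in> \<Phi>"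
  by (simp add: perp_roots_def)

lemma perp_reflection_closed:
  assumes "J \<subseteq> S" shows "reflection_closed (perp_roots W S J)"
proof -
  have V: "s \<in> J \<Longrightarrow> simple_root s \<in> V" for s using assms by auto
  have "opp \<gamma> \<in> perp_roots W S J" if "\<gamma> \<in> perp_roots W S J" for \<gamma>
  proof -
    have "opp \<gamma> \<in> \<Phi>" using perp_root[OF that] by simp
    then show ?thesis using that V by (auto simp: perp_roots_def opp_lincomb B_lincomb_left)
  qed
  moreover have "act (rr \<gamma>) \<delta> \<in> perp_roots W S J"
    if "\<gamma> \<in> perp_roots W S J" "\<delta> \<in> perp_roots W S J" for \<gamma> \<delta>
  proof -
    have "act (rr \<gamma>) \<delta> \<in> \<Phi>" using that[THEN perp_root] by simp
    then show ?thesis using that V by (auto simp: perp_roots_def act_rr B_lincomb_left)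
  qed
  ultimately show ?thesis unfolding reflection_closed_def using perp_sub by blast
qed

lemma perp_group_closed: "J \<subseteq> S \<Longrightarrow> u \<in> perp_group W S J \<Longrightarrow> u \<in> carrier W"
  unfolding perp_group_def by (rule generate_rr_closed[OF perp_reflection_closed])

lemma perp_group_subgroup: "J \<subseteq> S \<Longrightarrow> subgroup (perp_group W S J) W"
  unfolding perp_group_def by (rule generate_is_subgroup) (auto dest: perp_root)

lemma perp_group_words: "perp_group W S J = (\<lambda>ds. wp (map rr ds)) ` lists (perp_roots W S J)"
  unfolding perp_group_def by (rule generate_rr[OF perp_sub])

lemma perp_group_fixes:
  assumes "J \<subseteq> S" "u \<in> perp_group W S J" "t \<in> J"
  shows "act u (simple_root t) = simple_root t"
proof -
  obtain ds where ds: "ds \<in> lists (perp_roots W S J)" "u = wp (map rr ds)"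
    using assms perp_group_words by auto
  have t: "simple_root t \<in> V" using assms by auto
  have "act (wp (map rr ds)) (simple_root t) = simple_root t" using ds(1)
  proof (induction ds)
    case (Cons d ds)
    have d: "d \<in> \<Phi>" "B d (simple_root t) = 0" using Cons assms by (auto simp: perp_roots_def)
    have "ds \<in> lists \<Phi>" using Cons perp_sub by (auto simp: in_lists_conv_set)
    then have "wp (map rr ds) \<in> carrier W" by (rule wp_rr_closed)
    then show ?case using Cons d t by (simp add: act_mult act_rr) (simp add: lincomb_def)
  qed (use t in simp)
  then show ?thesis using ds by simp
qed

lemma parabolic_subgroup: "J \<subseteq> S \<Longrightarrow> subgroup (generate W J) W"
  by (rule generate_is_subgroup) (use S_carrier in auto)

text \<open>Elements of the orthogonal part fix each \<alpha>_t with t in J, hence conjugate the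
  reflection t to itself.\<close>

lemma parabolic_perp_commute:
  assumes J: "J \<subseteq> S" and "u \<in> generate W J" "v \<in> perp_group W S J"
  shows "u \<otimes> v = v \<otimes> u"
proof -
  have v: "v \<in> carrier W" using assms perp_group_closed by blast
  obtain ws where ws: "ws \<in> lists J" "u = wp ws" using assms generate_eq_words by auto
  have "wp ws \<otimes> v = v \<otimes> wp ws" using ws(1)
  proof (induction ws)
    case (Cons t ws)
    have t: "t \<in> S" "ws \<in> lists S" using Cons J by (auto simp: in_lists_conv_set)
    have w: "wp ws \<in> carrier W" using t(2) by (rule wp_closed_S)
    have "v \<otimes> t \<otimes> inv v = t"
      using rr_eq[OF v t(1)] perp_group_fixes[OF J assms(3) Cons.hyps(1)] rr_simple[OF t(1)] by simp
    then have "v \<otimes> t = t \<otimes> v" using v t by (metis S_closed inv_solve_right m_closed)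
    then have "v \<otimes> (t \<otimes> wp ws) = t \<otimes> (v \<otimes> wp ws)" using v t w by (simp flip: m_assoc)
    then show ?case using Cons v t w by (simp add: m_assoc)
  qed (use v in simp)
  then show ?thesis using ws by simp
qed

lemma NI_closed: "w \<in> NI W S J \<Longrightarrow> w \<in> carrier W"
  by (simp add: NI_def)

lemma NI_act: "\<lbrakk>w \<in> NI W S J; t \<in> J\<rbrakk> \<Longrightarrow> \<exists>k\<in>J. act w (simple_root t) = simple_root k"
  unfolding NI_def by blast

lemma NI_act': "\<lbrakk>w \<in> NI W S J; k \<in> J\<rbrakk> \<Longrightarrow> \<exists>t\<in>J. act w (simple_root t) = simple_root k"
  by (auto simp: NI_def image_image image_iff set_eq_iff) metis

lemma NI_I:
  assumes "w \<in> carrier W" "J \<subseteq> S"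
    "\<And>t. t \<in> J \<Longrightarrow> \<exists>k\<in>J. act w (simple_root t) = simple_root k"
    "\<And>t. t \<in> J \<Longrightarrow> \<exists>k\<in>J. act (inv w) (simple_root t) = simple_root k"
  shows "w \<in> NI W S J"
proof -
  have "simple_root t \<in> act w ` simple_root ` J" if t: "t \<in> J" for t
  proof -
    obtain k where "k \<in> J" "act (inv w) (simple_root t) = simple_root k" using assms t by blast
    moreover have "simple_root t \<in> V" using t assms by auto
    ultimately have "simple_root t = act w (simple_root k)" using act_inv2[OF assms(1)] by metis
    then show ?thesis using \<open>k \<in> J\<close> by blast
  qed
  moreover have "act w (simple_root t) \<in> simple_root ` J" if t: "t \<in> J" for t
    using assms(3)[OF t] by auto
  ultimately show ?thesis using assms(1) by (auto simp: NI_def)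
qed

lemma NI_subgroup:
  assumes J: "J \<subseteq> S" shows "subgroup (NI W S J) W"
proof (rule subgroupI)
  show "NI W S J \<subseteq> carrier W" by (auto simp: NI_def)
  have V: "simple_root ` J \<subseteq> V" using J by auto
  have "act \<one> ` simple_root ` J = simple_root ` J" using V by force
  then have "\<one> \<in> NI W S J" by (simp add: NI_def)
  then show "NI W S J \<noteq> {}" by blast
  fix a assume a: "a \<in> NI W S J"
  then have ac: "a \<in> carrier W" "act a ` simple_root ` J = simple_root ` J" by (auto simp: NI_def)
  have "act (inv a) ` act a ` simple_root ` J = simple_root ` J"
    unfolding image_image by (rule image_cong) (use V ac(1) in auto)
  then show "inv a \<in> NI W S J" using ac by (simp add: NI_def)
  fix b assume b: "b \<in> NI W S J"
  then have bc: "b \<in> carrier W" "act b ` simple_root ` J = simple_root ` J" by (auto simp: NI_def)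
  have "act (a \<otimes> b) ` simple_root ` J = act a ` act b ` simple_root ` J"
    unfolding image_image by (rule image_cong) (use J ac bc in \<open>auto simp: act_mult\<close>)
  then show "a \<otimes> b \<in> NI W S J" using ac bc by (simp add: NI_def)
qed

text \<open>w preserves the form and its image of the simple roots of J covers those of K. Two sets
  are allowed, so that this serves N_I as well as morphisms between different vertices.\<close>

lemma act_perp:
  assumes "J \<subseteq> S" "K \<subseteq> S" "w \<in> carrier W" "\<gamma> \<in> perp_roots W S J"
    "\<And>k. k \<in> K \<Longrightarrow> \<exists>t\<in>J. act w (simple_root t) = simple_root k"
  shows "act w \<gamma> \<in> perp_roots W S K"
proof -
  have \<gamma>: "\<gamma> \<in> \<Phi>" using assms by (auto simp: perp_roots_def)
  have "B (act w \<gamma>) (simple_root k) = 0" if k: "k \<in> K" for k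
  proof -
    obtain t where t: "t \<in> J" "act w (simple_root t) = simple_root k" using assms(5) k by blast
    have "B (act w \<gamma>) (act w (simple_root t)) = B \<gamma> (simple_root t)"
      using assms \<gamma> t by (intro act_B) auto
    then show ?thesis using t assms(4) by (simp add: perp_roots_def)
  qed
  then show ?thesis using assms \<gamma> by (simp add: perp_roots_def)
qed

lemma NI_perp: "\<lbrakk>J \<subseteq> S; w \<in> NI W S J; \<gamma> \<in> perp_roots W S J\<rbrakk> \<Longrightarrow> act w \<gamma> \<in> perp_roots W S J"
  by (rule act_perp[OF _ _ NI_closed]) (auto dest: NI_act')

lemma NI_inv: "\<lbrakk>J \<subseteq> S; w \<in> NI W S J\<rbrakk> \<Longrightarrow> inv w \<in> NI W S J"
  using NI_subgroup subgroup.m_inv_closed by metis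

text \<open>If the preimage of \<delta> were negative, its opposite would be a positive root of
  \<Psi> that w sends to the negative root opposite to \<delta>.\<close>

lemma act_inv_nonneg:
  assumes "w \<in> carrier W" "\<Psi> \<subseteq> \<Phi>" "\<And>\<gamma>. \<gamma> \<in> \<Psi> \<Longrightarrow> opp \<gamma> \<in> \<Psi>"
    "\<And>\<gamma>. \<lbrakk>\<gamma> \<in> \<Psi>; nonneg \<gamma>\<rbrakk> \<Longrightarrow> nonneg (act w \<gamma>)"
    "act (inv w) \<delta> \<in> \<Psi>" "\<delta> \<in> \<Phi>" "nonneg \<delta>"
  shows "nonneg (act (inv w) \<delta>)"
proof (rule ccontr)
  let ?g = "act (inv w) \<delta>"
  assume "\<not> nonneg ?g"
  then have "nonneg (act w (opp ?g))" using assms root_cases[of ?g] by blast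
  then have "nonneg (opp \<delta>)" using assms by (simp add: act_opp)
  then show False using assms root_not_both by blast
qed

lemma perp_opp: "\<lbrakk>J \<subseteq> S; \<gamma> \<in> perp_roots W S J\<rbrakk> \<Longrightarrow> opp \<gamma> \<in> perp_roots W S J"
  using perp_reflection_closed by (simp add: reflection_closed_def)

text \<open>An element of N_J permutes the orthogonal roots and commutes with negation, so
  preserving positivity one way already yields the equality of sets.\<close>

lemma Y_tilde_iff:
  assumes J: "J \<subseteq> S"
  shows "w \<in> Y_tilde W S J \<longleftrightarrow>
    w \<in> NI W S J \<and> (\<forall>\<gamma>\<in>perp_roots W S J. nonneg \<gamma> \<longrightarrow> nonneg (act w \<gamma>))" (is "?l \<longleftrightarrow> ?r")
proof
  assume ?l then show ?r by (auto simp: Y_tilde_def positive_part_eq)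
next
  let ?P = "perp_roots W S J"
  assume r: ?r
  then have w: "w \<in> carrier W" "w \<in> NI W S J" using NI_closed by auto
  have "\<delta> \<in> act w ` {\<gamma> \<in> ?P. nonneg \<gamma>}" if d: "\<delta> \<in> ?P" "nonneg \<delta>" for \<delta>
  proof -
    have g: "act (inv w) \<delta> \<in> ?P" using NI_perp[OF J NI_inv[OF J w(2)] d(1)] .
    have \<delta>: "\<delta> \<in> \<Phi>" using d perp_sub by blast
    have "nonneg (act (inv w) \<delta>)"
      using act_inv_nonneg[OF w(1) perp_sub perp_opp[OF J] _ g \<delta> d(2)] r by blast
    moreover have "\<delta> = act w (act (inv w) \<delta>)" using w \<delta> by simp
    ultimately show ?thesis using g by blast
  qed
  moreover have "act w \<gamma> \<in> {\<gamma> \<in> ?P. nonneg \<gamma>}" if "\<gamma> \<in> ?P" "nonneg \<gamma>" for \<gamma>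
    using NI_perp[OF J w(2) that(1)] r that by simp
  ultimately show ?l using r by (auto simp: Y_tilde_def positive_part_eq)
qed

lemma Y_tilde_NI: "w \<in> Y_tilde W S J \<Longrightarrow> w \<in> NI W S J"
  by (simp add: Y_tilde_def)

lemma Y_tilde_closed: "w \<in> Y_tilde W S J \<Longrightarrow> w \<in> carrier W"
  using Y_tilde_NI NI_closed by blast

lemma Y_tilde_subgroup:
  assumes J: "J \<subseteq> S" shows "subgroup (Y_tilde W S J) W"
proof (rule subgroupI)
  let ?P = "perp_roots W S J"
  show "Y_tilde W S J \<subseteq> carrier W" using Y_tilde_closed by blast
  have "\<one> \<in> Y_tilde W S J"
    using subgroup.one_closed[OF NI_subgroup[OF J]] by (simp add: Y_tilde_iff[OF J] perp_root)
  then show "Y_tilde W S J \<noteq> {}" by blast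
  fix a assume a: "a \<in> Y_tilde W S J"
  then have ac: "a \<in> carrier W" "a \<in> NI W S J" using Y_tilde_closed Y_tilde_NI by auto
  have "nonneg (act (inv a) \<delta>)" if d: "\<delta> \<in> ?P" "nonneg \<delta>" for \<delta>
    using act_inv_nonneg[OF ac(1) perp_sub perp_opp[OF J] _ NI_perp[OF J NI_inv[OF J ac(2)] d(1)] _ d(2)]
      a d perp_sub Y_tilde_iff[OF J] by blast
  then show "inv a \<in> Y_tilde W S J" using NI_inv[OF J ac(2)] by (simp add: Y_tilde_iff[OF J])
  fix b assume b: "b \<in> Y_tilde W S J"
  then have bc: "b \<in> carrier W" "b \<in> NI W S J" using Y_tilde_closed Y_tilde_NI by auto
  have "nonneg (act (a \<otimes> b) \<delta>)" if d: "\<delta> \<in> ?P" "nonneg \<delta>" for \<delta>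
  proof -
    have "\<delta> \<in> \<Phi>" using d perp_sub by blast
    moreover have "nonneg (act a (act b \<delta>))"
      using a b NI_perp[OF J bc(2) d(1)] d unfolding Y_tilde_iff[OF J] by blast
    ultimately show ?thesis using ac bc by (simp add: act_mult)
  qed
  then show "a \<otimes> b \<in> Y_tilde W S J"
    using subgroup.m_closed[OF NI_subgroup[OF J] ac(2) bc(2)] by (simp add: Y_tilde_iff[OF J])
qed

lemma perp_group_NI:
  assumes J: "J \<subseteq> S" and u: "u \<in> perp_group W S J" shows "u \<in> NI W S J"
proof -
  have "inv u \<in> perp_group W S J" using perp_group_subgroup[OF J] u subgroup.m_inv_closed by metis
  then show ?thesis
    using perp_group_fixes[OF J] u by (intro NI_I perp_group_closed[OF J] J) auto
qed

lemma NI_conj_perp_group: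
  assumes J: "J \<subseteq> S" and w: "w \<in> NI W S J" and u: "u \<in> perp_group W S J"
  shows "w \<otimes> u \<otimes> inv w \<in> perp_group W S J"
proof -
  obtain ds where ds: "ds \<in> lists (perp_roots W S J)" "u = wp (map rr ds)" using u perp_group_words by auto
  have wc: "w \<in> carrier W" using w NI_closed by blast
  have "w \<otimes> wp (map rr ds) \<otimes> inv w = wp (map rr (map (act w) ds))" using ds(1)
  proof (induction ds)
    case (Cons d ds)
    have d: "d \<in> \<Phi>" using Cons perp_sub by auto
    have "ds \<in> lists \<Phi>" using Cons perp_sub by (auto simp: in_lists_conv_set)
    then have p: "wp (map rr ds) \<in> carrier W" by (rule wp_rr_closed)
    have "w \<otimes> (rr d \<otimes> wp (map rr ds)) \<otimes> inv w = (w \<otimes> rr d \<otimes> inv w) \<otimes> (w \<otimes> wp (map rr ds) \<otimes> inv w)"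
      using wc d p by (simp add: m_assoc)
    then show ?case using Cons rr_act[OF wc d] by simp
  qed (use wc in simp)
  moreover have "map (act w) ds \<in> lists (perp_roots W S J)"
    using ds NI_perp[OF J w] by (auto simp: in_lists_conv_set)
  ultimately show ?thesis unfolding ds(2) perp_group_words by (metis imageI)
qed

text \<open>The coset representative has its reflection factor on the right; since N_J normalizes
  the orthogonal part, the factor can be carried to the left.\<close>

lemma NI_decompose:
  assumes J: "J \<subseteq> S" and w: "w \<in> NI W S J"
  shows "\<exists>u\<in>perp_group W S J. \<exists>y\<in>Y_tilde W S J. w = u \<otimes> y"
proof -
  have wc: "w \<in> carrier W" using w NI_closed by blast
  obtain u where u: "u \<in> perp_group W S J" "\<forall>\<gamma>\<in>perp_roots W S J. nonneg \<gamma> \<longrightarrow> nonneg (act (w \<otimes> u) \<gamma>)"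
    using reflection_coset_rep[OF perp_reflection_closed[OF J] wc] by (auto simp: perp_group_def)
  have uc: "u \<in> carrier W" using u perp_group_closed[OF J] by blast
  have "w \<otimes> u \<in> Y_tilde W S J" unfolding Y_tilde_iff[OF J]
    using u subgroup.m_closed[OF NI_subgroup[OF J] w perp_group_NI[OF J u(1)]] by blast
  moreover have "w \<otimes> inv u \<otimes> inv w \<in> perp_group W S J"
    using NI_conj_perp_group[OF J w] u perp_group_subgroup[OF J] subgroup.m_inv_closed by metis
  moreover have "w = (w \<otimes> inv u \<otimes> inv w) \<otimes> (w \<otimes> u)" using wc uc by (simp add: m_assoc)
  ultimately show ?thesis by blast
qed

lemma perp_group_Int_Y_tilde:
  assumes J: "J \<subseteq> S" and "u \<in> perp_group W S J" "u \<in> Y_tilde W S J" shows "u = \<one>"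
  using reflection_group_one[OF perp_reflection_closed[OF J]] assms Y_tilde_iff[OF J]
  unfolding perp_group_def by blast

lemma NI_semidirect:
  assumes J: "J \<subseteq> S"
  shows "is_semidirect W (NI W S J) (perp_group W S J) (Y_tilde W S J)"
  by (rule is_semidirectI[OF NI_subgroup[OF J] perp_group_subgroup[OF J] Y_tilde_subgroup[OF J]])
    (use perp_group_NI[OF J] Y_tilde_NI NI_conj_perp_group[OF J] perp_group_Int_Y_tilde[OF J]
      NI_decompose[OF J] in blast)+

lemma perp_times_Y_tilde: "J \<subseteq> S \<Longrightarrow> perp_group W S J <#> Y_tilde W S J = NI W S J"
  using NI_semidirect by (simp add: is_semidirect_def)

lemma act_sum:
  fixes n :: nat
  assumes "w \<in> carrier W" "\<And>i. i < n \<Longrightarrow> \<beta> i \<in> V"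
  shows "(\<lambda>t. \<Sum>i<n. c i * \<beta> i t) \<in> V"
    "act w (\<lambda>t. \<Sum>i<n. c i * \<beta> i t) = (\<lambda>t. \<Sum>i<n. c i * act w (\<beta> i) t)"
proof -
  have "(\<lambda>t. \<Sum>i<n. c i * \<beta> i t) \<in> V \<and> act w (\<lambda>t. \<Sum>i<n. c i * \<beta> i t) = (\<lambda>t. \<Sum>i<n. c i * act w (\<beta> i) t)"
    using assms(2)
  proof (induction n)
    case 0
    have "(\<lambda>t. 0) \<in> V" by (simp add: V_def)
    moreover have "act w (\<lambda>t. 0) = (\<lambda>t. 0)" using act_expand[OF assms(1) \<open>(\<lambda>t. 0) \<in> V\<close>] by auto
    ultimately show ?case by simp
  next
    case (Suc n)
    have eq: "(\<lambda>t. \<Sum>i<Suc n. c i * f i t) = lincomb 1 (\<lambda>t. \<Sum>i<n. c i * f i t) (c n) (f n)" for f :: "nat \<Rightarrow> 'a vec"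
      by (simp add: lincomb_def)
    show ?case unfolding eq using Suc by (simp add: act_lincomb assms(1))
  qed
  then show "(\<lambda>t. \<Sum>i<n. c i * \<beta> i t) \<in> V"
    "act w (\<lambda>t. \<Sum>i<n. c i * \<beta> i t) = (\<lambda>t. \<Sum>i<n. c i * act w (\<beta> i) t)" by auto
qed

text \<open>The roots behind \<open>perp_gens\<close>. An element of \<open>Y_tilde\<close> acts on
  them directly, and its conjugation action on generators then follows from
  \<open>rr_act\<close>.\<close>

definition perp_simple :: "'a set \<Rightarrow> 'a vec set" where
  "perp_simple J = {\<gamma> \<in> positive_part (perp_roots W S J).
       \<forall>(n::nat) c \<beta>. (\<forall>i<n. 0 < c i \<and> \<beta> i \<in> positive_part (perp_roots W S J)) \<and>
                 \<gamma> = (\<lambda>t. \<Sum>i<n. c i * \<beta> i t) \<longrightarrow> (\<forall>i<n. \<beta> i = \<gamma>)}"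

lemma perp_gens_eq: "perp_gens W S J = rr ` perp_simple J"
  by (simp add: perp_gens_def perp_simple_def)

lemma perp_simple_sub: "perp_simple J \<subseteq> perp_roots W S J"
  by (auto simp: perp_simple_def positive_part_eq)

text \<open>Both w and its inverse permute the positive orthogonal roots, so a positive
  decomposition of w\<gamma> pulls back to one of \<gamma>, where all summands are equal.\<close>

lemma act_perp_simple:
  assumes J: "J \<subseteq> S" and w: "w \<in> Y_tilde W S J" and \<gamma>: "\<gamma> \<in> perp_simple J"
  shows "act w \<gamma> \<in> perp_simple J"
proof -
  let ?P = "positive_part (perp_roots W S J)"
  have wc: "w \<in> carrier W" using w Y_tilde_closed by blast
  have P\<Phi>: "?P \<subseteq> \<Phi>" using perp_sub by (auto simp: positive_part_eq)
  have wP: "act w \<delta> \<in> ?P" if "\<delta> \<in> ?P" for \<delta> using w that by (auto simp: Y_tilde_def)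
  have "inv w \<in> Y_tilde W S J" using w Y_tilde_subgroup[OF J] subgroup.m_inv_closed by metis
  then have iP: "act (inv w) \<delta> \<in> ?P" if "\<delta> \<in> ?P" for \<delta> using that by (auto simp: Y_tilde_def)
  have \<gamma>P: "\<gamma> \<in> ?P" using \<gamma> by (simp add: perp_simple_def)
  have ext_\<gamma>: "\<forall>i<n. \<beta> i = \<gamma>"
    if "\<forall>i<n. 0 < c i \<and> \<beta> i \<in> ?P" "\<gamma> = (\<lambda>t. \<Sum>i<n. c i * \<beta> i t)" for n :: nat and c \<beta>
    using \<gamma> that unfolding perp_simple_def by blast
  have "\<forall>i<n. \<beta> i = act w \<gamma>"
    if *: "(\<forall>i<n. 0 < c i \<and> \<beta> i \<in> ?P) \<and> act w \<gamma> = (\<lambda>t. \<Sum>i<n. c i * \<beta> i t)" for n :: nat and c \<beta>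
  proof -
    have V: "\<beta> i \<in> V" if "i < n" for i using * that P\<Phi> root_V by blast
    have "\<gamma> = act (inv w) (act w \<gamma>)" using wc \<gamma>P P\<Phi> root_V act_inv1 by (metis subsetD)
    also have "\<dots> = (\<lambda>t. \<Sum>i<n. c i * act (inv w) (\<beta> i) t)" using act_sum(2)[OF inv_closed[OF wc] V] * by auto
    finally have "\<forall>i<n. act (inv w) (\<beta> i) = \<gamma>"
      using * iP by (intro ext_\<gamma>[of n c]) auto
    then show ?thesis using act_inv2[OF wc V] by metis
  qed
  then show ?thesis using wP[OF \<gamma>P] unfolding perp_simple_def by blast
qed

lemma conj_perp_gens:
  assumes J: "J \<subseteq> S" and w: "w \<in> Y_tilde W S J"
  shows "(\<lambda>u. w \<otimes> u \<otimes> inv w) ` perp_gens W S J = perp_gens W S J"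
proof -
  have sub: "(\<lambda>u. v \<otimes> u \<otimes> inv v) ` perp_gens W S J \<subseteq> perp_gens W S J" if v: "v \<in> Y_tilde W S J" for v
  proof -
    have "v \<otimes> rr \<gamma> \<otimes> inv v = rr (act v \<gamma>)" if "\<gamma> \<in> perp_simple J" for \<gamma>
      using rr_act[OF Y_tilde_closed[OF v] subsetD[OF perp_sub subsetD[OF perp_simple_sub that]]] by simp
    then show ?thesis using act_perp_simple[OF J v] by (auto simp: perp_gens_eq)
  qed
  have wc: "w \<in> carrier W" using w Y_tilde_closed by blast
  have "inv w \<in> Y_tilde W S J" using w Y_tilde_subgroup[OF J] subgroup.m_inv_closed by metis
  note i = sub[OF this]
  have "r \<in> (\<lambda>u. w \<otimes> u \<otimes> inv w) ` perp_gens W S J" if r: "r \<in> perp_gens W S J" for r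
  proof -
    have rc: "r \<in> carrier W" using r perp_root[OF subsetD[OF perp_simple_sub]] by (auto simp: perp_gens_eq)
    have "inv w \<otimes> r \<otimes> inv (inv w) \<in> perp_gens W S J" using r i by blast
    moreover have "r = w \<otimes> (inv w \<otimes> r \<otimes> inv (inv w)) \<otimes> inv w" using wc rc by (simp add: m_assoc)
    ultimately show ?thesis by blast
  qed
  then show ?thesis using sub[OF w] by blast
qed

lemma conj_on_auto:
  assumes J: "J \<subseteq> S" and w: "w \<in> NI W S J"
  shows "conj_on W (perp_group W S J) w \<in> auto (W\<lparr>carrier := perp_group W S J\<rparr>)"
proof -
  let ?U = "perp_group W S J"
  have wc: "w \<in> carrier W" using w NI_closed by blast
  have Uc: "u \<in> carrier W" if "u \<in> ?U" for u using that perp_group_closed[OF J] by blast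
  have mem: "w \<otimes> u \<otimes> inv w \<in> ?U" "inv w \<otimes> u \<otimes> w \<in> ?U" if "u \<in> ?U" for u
    using NI_conj_perp_group[OF J w that] NI_conj_perp_group[OF J NI_inv[OF J w] that] wc by auto
  have "conj_on W ?U w \<in> hom (W\<lparr>carrier := ?U\<rparr>) (W\<lparr>carrier := ?U\<rparr>)"
  proof (rule homI)
    fix x y assume "x \<in> carrier (W\<lparr>carrier := ?U\<rparr>)" "y \<in> carrier (W\<lparr>carrier := ?U\<rparr>)"
    then have xy: "x \<in> ?U" "y \<in> ?U" by auto
    then have "x \<otimes> y \<in> ?U" using perp_group_subgroup[OF J] subgroup.m_closed by metis
    then show "conj_on W ?U w (x \<otimes>\<^bsub>W\<lparr>carrier := ?U\<rparr>\<^esub> y) = conj_on W ?U w x \<otimes>\<^bsub>W\<lparr>carrier := ?U\<rparr>\<^esub> conj_on W ?U w y"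
      using xy wc Uc by (simp add: conj_on_def m_assoc)
  qed (auto simp: conj_on_def mem)
  moreover have "bij_betw (conj_on W ?U w) ?U ?U"
    by (rule bij_betw_byWitness[where f' = "\<lambda>u. inv w \<otimes> u \<otimes> w"])
      (use mem wc Uc in \<open>auto simp: conj_on_def m_assoc\<close>)
  ultimately show ?thesis by (simp add: auto_def Bij_def conj_on_def)
qed

lemma conj_on_coxeter_Aut:
  assumes J: "J \<subseteq> S"
  shows "conj_on W (perp_group W S J) \<in> hom (W\<lparr>carrier := Y_tilde W S J\<rparr>)
       (coxeter_Aut (W\<lparr>carrier := perp_group W S J\<rparr>) (perp_gens W S J))"
proof (rule homI)
  let ?U = "perp_group W S J"
  fix w assume "w \<in> carrier (W\<lparr>carrier := Y_tilde W S J\<rparr>)"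
  then have w: "w \<in> Y_tilde W S J" by simp
  have "perp_gens W S J \<subseteq> ?U" unfolding perp_gens_eq perp_group_def
    using perp_simple_sub by (auto intro: generate.incl)
  then have "conj_on W ?U w ` perp_gens W S J = (\<lambda>u. w \<otimes> u \<otimes> inv w) ` perp_gens W S J"
    by (intro image_cong) (auto simp: conj_on_def)
  then show "conj_on W ?U w \<in> carrier (coxeter_Aut (W\<lparr>carrier := ?U\<rparr>) (perp_gens W S J))"
    using conj_on_auto[OF J Y_tilde_NI[OF w]] conj_perp_gens[OF J w] by (simp add: coxeter_Aut_def)
next
  let ?U = "perp_group W S J"
  fix v w assume "v \<in> carrier (W\<lparr>carrier := Y_tilde W S J\<rparr>)" "w \<in> carrier (W\<lparr>carrier := Y_tilde W S J\<rparr>)"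
  then have vw: "v \<in> Y_tilde W S J" "w \<in> Y_tilde W S J" by auto
  then have vwc: "v \<in> carrier W" "w \<in> carrier W" using Y_tilde_closed by auto
  have bij: "conj_on W ?U x \<in> Bij ?U" if "x \<in> Y_tilde W S J" for x
    using conj_on_auto[OF J Y_tilde_NI[OF that]] by (simp add: auto_def)
  have Uc: "u \<in> carrier W" if "u \<in> ?U" for u using that perp_group_closed[OF J] by blast
  have "conj_on W ?U (v \<otimes> w) = compose ?U (conj_on W ?U v) (conj_on W ?U w)"
    by (rule ext) (use vwc Uc NI_conj_perp_group[OF J Y_tilde_NI[OF vw(2)]] in
      \<open>auto simp: conj_on_def compose_def inv_mult_group m_assoc\<close>)
  then show "conj_on W ?U (v \<otimes>\<^bsub>W\<lparr>carrier := Y_tilde W S J\<rparr>\<^esub> w)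
      = conj_on W ?U v \<otimes>\<^bsub>coxeter_Aut (W\<lparr>carrier := ?U\<rparr>) (perp_gens W S J)\<^esub> conj_on W ?U w"
    using bij[OF vw(1)] bij[OF vw(2)] by (simp add: coxeter_Aut_def AutoGroup_def BijGroup_def)
qed

section \<open>The normalizer\<close>

text \<open>An element of N_J sends simple roots of J to simple roots, so it has no descent in
  J.\<close>

lemma NI_Int_parabolic:
  assumes J: "J \<subseteq> S" and "u \<in> generate W J" "u \<in> NI W S J" shows "u = \<one>"
proof (rule parabolic_one[OF J assms(2)])
  fix s assume "s \<in> J"
  then show "nonneg (act u (simple_root s))" using NI_act[OF assms(3)] by fastforce
qed

lemma conj_generate:
  assumes "w \<in> carrier W" "J \<subseteq> carrier W" "u \<in> generate W J"
    "\<And>s. s \<in> J \<Longrightarrow> w \<otimes> s \<otimes> inv w \<in> generate W K" "K \<subseteq> carrier W"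
  shows "w \<otimes> u \<otimes> inv w \<in> generate W K"
  using assms(3)
proof (induction u)
  case one
  then show ?case using assms(1) by (simp add: generate.one)
next
  case (incl h)
  then show ?case using assms(4) by blast
next
  case (inv h)
  have "h \<in> carrier W" using inv assms by auto
  then have "w \<otimes> inv h \<otimes> inv w = inv (w \<otimes> h \<otimes> inv w)" using assms(1) by (simp add: inv_mult_group m_assoc)
  then show ?case using generate_m_inv_closed[OF assms(5) assms(4)[OF inv]] by simp
next
  case (eng h1 h2)
  have "h1 \<in> carrier W" "h2 \<in> carrier W" using eng assms(2) generate_incl by blast+
  then have "w \<otimes> (h1 \<otimes> h2) \<otimes> inv w = (w \<otimes> h1 \<otimes> inv w) \<otimes> (w \<otimes> h2 \<otimes> inv w)"
    using assms(1) by (simp add: m_assoc)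
  then show ?case using eng by (simp add: generate.eng)
qed

lemma NI_normalizes:
  assumes J: "J \<subseteq> S" and w: "w \<in> NI W S J" and u: "u \<in> generate W J"
  shows "w \<otimes> u \<otimes> inv w \<in> generate W J"
proof (rule conj_generate[OF NI_closed[OF w] _ u])
  show "J \<subseteq> carrier W" "J \<subseteq> carrier W" using J S_carrier by auto
  fix s assume s: "s \<in> J"
  then obtain k where k: "k \<in> J" "act w (simple_root s) = simple_root k" using NI_act[OF w] by blast
  then have "w \<otimes> s \<otimes> inv w = k" using rr_eq[OF NI_closed[OF w] subsetD[OF J s]] rr_simple[OF subsetD[OF J k(1)]] by simp
  then show "w \<otimes> s \<otimes> inv w \<in> generate W J" using k by (simp add: generate.incl)
qed

text \<open>The reflection w s w^-1 negates w\<alpha>_s; lying in W_J, it alters only coordinates in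
  J. All other coordinates equal their own negatives.\<close>

lemma normalizer_support:
  assumes J: "J \<subseteq> S" and w: "w \<in> carrier W" and s: "s \<in> J"
    and n: "w \<otimes> s \<otimes> inv w \<in> generate W J" and r: "r \<notin> J"
  shows "act w (simple_root s) r = 0"
proof -
  let ?g = "act w (simple_root s)"
  have sS: "s \<in> S" and g: "?g \<in> \<Phi>" using s J w by auto
  have "act (w \<otimes> s \<otimes> inv w) ?g = opp ?g" using rr_eq[OF w sS] act_rr_self[OF g] by simp
  then have "opp ?g r = ?g r" using act_coord[OF J n root_V[OF g] r] by simp
  then show ?thesis by (simp add: opp_def)
qed

lemma parabolic_coset_rep:
  assumes J: "J \<subseteq> S" and g: "g \<in> carrier W"
  shows "\<exists>u\<in>generate W J. \<forall>t\<in>J. nonneg (act (g \<otimes> u) (simple_root t))"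
proof -
  let ?H = "generate W J"
  obtain u where u: "u \<in> ?H" and min: "\<And>x. x \<in> ?H \<Longrightarrow> len (g \<otimes> u) \<le> len (g \<otimes> x)"
    using ex_has_least_nat[of "\<lambda>u. u \<in> ?H" \<one> "\<lambda>u. len (g \<otimes> u)"] generate.one by auto
  have uc: "u \<in> carrier W" using u J generate_S_closed by blast
  have "nonneg (act (g \<otimes> u) (simple_root t))" if t: "t \<in> J" for t
  proof -
    have tS: "t \<in> S" using t J by auto
    have "u \<otimes> t \<in> ?H" by (rule generate.eng[OF u generate.incl[OF t]])
    from min[OF this] have "len (g \<otimes> u) \<le> len (g \<otimes> u \<otimes> t)" using g uc tS by (simp add: m_assoc)
    then have "len (g \<otimes> u) < len (g \<otimes> u \<otimes> t)" using len_gen_neq[of "g \<otimes> u" t] g uc tS by simp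
    then show ?thesis using act_simple_root_nonneg[of "g \<otimes> u" t] g uc tS by simp
  qed
  then show ?thesis using u by blast
qed

text \<open>For v without descents in J, both v and v^-1 preserve the span of the simple roots of J
  by \<open>normalizer_support\<close> and keep these roots positive; extremality then makes v
  permute them.\<close>

lemma normalizer_decompose:
  assumes J: "J \<subseteq> S" and n: "w \<in> normalizer W (generate W J)"
  shows "\<exists>u\<in>generate W J. \<exists>v\<in>NI W S J. w = u \<otimes> v"
proof -
  let ?H = "generate W J"
  have H: "subgroup ?H W" using J by (rule parabolic_subgroup)
  note iff = normalizer_iff[OF H]
  have wc: "w \<in> carrier W" using n iff by blast
  have Hc: "x \<in> ?H \<Longrightarrow> x \<in> carrier W" for x using H subgroup.mem_carrier by metis
  obtain u where u: "u \<in> ?H" and pos_u: "\<forall>t\<in>J. nonneg (act (w \<otimes> u) (simple_root t))"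
    using parabolic_coset_rep[OF J wc] by blast
  define v where "v = w \<otimes> u"
  have uc: "u \<in> carrier W" and vc: "v \<in> carrier W" using u Hc wc by (auto simp: v_def)
  have pos: "nonneg (act v (simple_root t))" if "t \<in> J" for t using pos_u that by (simp add: v_def)
  have vn: "v \<otimes> h \<otimes> inv v \<in> ?H" "inv v \<otimes> h \<otimes> v \<in> ?H" if h: "h \<in> ?H" for h
  proof -
    have hc: "h \<in> carrier W" using h Hc by blast
    have i: "inv u \<in> ?H" using H u subgroup.m_inv_closed by metis
    have "u \<otimes> h \<otimes> inv u \<in> ?H" using u h i by (simp add: generate.eng)
    then have "w \<otimes> (u \<otimes> h \<otimes> inv u) \<otimes> inv w \<in> ?H" using n iff by blast
    then show "v \<otimes> h \<otimes> inv v \<in> ?H" using wc uc hc by (simp add: v_def m_assoc inv_mult_group)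
    have "inv w \<otimes> h \<otimes> w \<in> ?H" using n iff h by blast
    then have "inv u \<otimes> (inv w \<otimes> h \<otimes> w) \<otimes> u \<in> ?H" using u i by (simp add: generate.eng)
    then show "inv v \<otimes> h \<otimes> v \<in> ?H" using wc uc hc by (simp add: v_def m_assoc inv_mult_group)
  qed
  have supp: "act v (simple_root t) r = 0" if "t \<in> J" "r \<notin> J" for t r
    using normalizer_support[OF J vc that(1) vn(1)[OF generate.incl[OF that(1)]] that(2)] .
  have supp': "act (inv v) (simple_root t) r = 0" if "t \<in> J" "r \<notin> J" for t r
    using normalizer_support[OF J inv_closed[OF vc] that(1) _ that(2)] vn(2)[OF generate.incl[OF that(1)]] vc by simp
  \<comment> \<open>If v^-1 \<alpha>_t were negative, its opposite would be a nonnegative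
    combination of simple roots of J, hence kept positive by v; but v sends it to
    -\<alpha>_t.\<close>
  have pos': "nonneg (act (inv v) (simple_root t))" if t: "t \<in> J" for t
  proof (rule ccontr)
    let ?g = "act (inv v) (simple_root t)"
    have tS: "t \<in> S" using t J by auto
    have g: "?g \<in> \<Phi>" using vc tS by simp
    assume "\<not> nonneg ?g"
    then have "nonneg (opp ?g)" using root_cases[OF g] by blast
    moreover have "r \<in> J" if "opp ?g r \<noteq> 0" for r
      using supp'[OF t, of r] that by (auto simp: opp_def)
    ultimately have "nonneg (act v (opp ?g))"
      by (intro act_nonneg[OF vc opp_V[OF root_V[OF g]]] pos) blast+
    then have "nonneg (opp (simple_root t))" using g vc tS by (simp add: act_opp)
    then show False using root_not_both[of "simple_root t"] tS by simp
  qed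
  have "v \<in> NI W S J"
  proof (rule NI_I[OF vc J])
    fix t assume t: "t \<in> J"
    then have tS: "t \<in> S" using J by auto
    show "\<exists>k\<in>J. act v (simple_root t) = simple_root k"
      by (rule act_simple_root_simple[OF vc tS J pos[OF t]]) (use supp t pos' in auto)
    show "\<exists>k\<in>J. act (inv v) (simple_root t) = simple_root k"
      by (rule act_simple_root_simple[OF inv_closed[OF vc] tS J pos'[OF t]]) (use supp' t pos vc in auto)
  qed
  moreover have "v \<otimes> inv u \<otimes> inv v \<in> ?H" using vn(1) u H subgroup.m_inv_closed by metis
  moreover have "w = (v \<otimes> inv u \<otimes> inv v) \<otimes> v" using wc uc by (simp add: v_def m_assoc)
  ultimately show ?thesis by blast
qed

lemma NI_sub_normalizer: "J \<subseteq> S \<Longrightarrow> NI W S J \<subseteq> normalizer W (generate W J)"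
  using normalizer_iff[OF parabolic_subgroup] NI_normalizes NI_inv NI_closed
  by (metis inv_inv subsetI)

lemma parabolic_sub_normalizer:
  assumes J: "J \<subseteq> S" shows "generate W J \<subseteq> normalizer W (generate W J)"
proof
  note H = parabolic_subgroup[OF J]
  fix u assume u: "u \<in> generate W J"
  have "u \<otimes> h \<otimes> inv u \<in> generate W J \<and> inv u \<otimes> h \<otimes> u \<in> generate W J" if "h \<in> generate W J" for h
    by (intro conjI subgroup.m_closed[OF H] subgroup.m_inv_closed[OF H] u that)
  then show "u \<in> normalizer W (generate W J)"
    unfolding normalizer_iff[OF H] using subgroup.mem_carrier[OF H u] by simp
qed

lemma normalizer_subgroup:
  "J \<subseteq> S \<Longrightarrow> subgroup (normalizer W (generate W J)) W"
  by (intro normalizer_imp_subgroup) (use generate_S_closed in auto)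

lemma normalizer_semidirect:
  assumes J: "J \<subseteq> S"
  shows "is_semidirect W (normalizer W (generate W J)) (generate W J) (NI W S J)"
  by (rule is_semidirectI[OF normalizer_subgroup[OF J] parabolic_subgroup[OF J] NI_subgroup[OF J]
        parabolic_sub_normalizer[OF J] NI_sub_normalizer[OF J]])
    (use normalizer_iff[OF parabolic_subgroup[OF J]] NI_Int_parabolic[OF J] normalizer_decompose[OF J] in blast)+

lemma parabolic_perp_direct:
  assumes J: "J \<subseteq> S"
  shows "is_direct W (generate W J <#> perp_group W S J) (generate W J) (perp_group W S J)"
proof (rule is_directI[OF parabolic_subgroup[OF J] perp_group_subgroup[OF J]])
  show "u \<otimes> v = v \<otimes> u" if "u \<in> generate W J" "v \<in> perp_group W S J" for u v
    using that by (rule parabolic_perp_commute[OF J])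
  show "x = \<one>" if "x \<in> generate W J" "x \<in> perp_group W S J" for x
    using that(1) perp_group_NI[OF J that(2)] by (rule NI_Int_parabolic[OF J])
qed

lemma normalizer_semidirect':
  assumes J: "J \<subseteq> S"
  shows "is_semidirect W (normalizer W (generate W J)) (generate W J <#> perp_group W S J) (Y_tilde W S J)"
proof (rule is_semidirectI[OF normalizer_subgroup[OF J] _ Y_tilde_subgroup[OF J]])
  let ?N = "normalizer W (generate W J)" and ?H = "generate W J" and ?U = "perp_group W S J"
  note H = parabolic_subgroup[OF J] and U = perp_group_subgroup[OF J] and N = normalizer_subgroup[OF J]
  have Hc: "x \<in> ?H \<Longrightarrow> x \<in> carrier W" for x using H subgroup.mem_carrier by metis
  note Uc = perp_group_closed[OF J]
  show "subgroup (?H <#> ?U) W" using parabolic_perp_direct[OF J] by (simp add: is_direct_def)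
  show "?H <#> ?U \<subseteq> ?N"
  proof
    fix x assume "x \<in> ?H <#> ?U"
    then obtain u v where "x = u \<otimes> v" "u \<in> ?H" "v \<in> ?U" by (auto simp: set_mult_def)
    moreover from this have "u \<in> ?N" "v \<in> ?N"
      using parabolic_sub_normalizer[OF J] perp_group_NI[OF J] NI_sub_normalizer[OF J] by (auto dest: subsetD)
    ultimately show "x \<in> ?N" using subgroup.m_closed[OF N] by simp
  qed
  show "Y_tilde W S J \<subseteq> ?N" using Y_tilde_NI NI_sub_normalizer[OF J] by blast
  show "a \<otimes> x \<otimes> inv a \<in> ?H <#> ?U" if a: "a \<in> ?N" and x: "x \<in> ?H <#> ?U" for a x
  proof -
    obtain u v where x: "x = u \<otimes> v" "u \<in> ?H" "v \<in> ?U" using x by (auto simp: set_mult_def)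
    obtain g n where a': "a = g \<otimes> n" "g \<in> ?H" "n \<in> NI W S J" using normalizer_decompose[OF J a] by blast
    note c = Hc[OF x(2)] Uc[OF x(3)] Hc[OF a'(2)] NI_closed[OF a'(3)]
    have ac: "a \<in> carrier W" using c a' by simp
    have n: "n \<otimes> v \<otimes> inv n \<in> ?U" using NI_conj_perp_group[OF J a'(3) x(3)] .
    \<comment> \<open>After n has conjugated v within the orthogonal part, the factor g from W_J
      commutes with the result and drops out.\<close>
    have "a \<otimes> v \<otimes> inv a = (g \<otimes> (n \<otimes> v \<otimes> inv n)) \<otimes> inv g" using c a' by (simp add: m_assoc inv_mult_group)
    also have "\<dots> = n \<otimes> v \<otimes> inv n" using parabolic_perp_commute[OF J a'(2) n] c by (simp add: m_assoc)
    finally have "a \<otimes> v \<otimes> inv a \<in> ?U" using n by simp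
    moreover have "a \<otimes> u \<otimes> inv a \<in> ?H" using a x normalizer_iff[OF H] by blast
    moreover have "a \<otimes> x \<otimes> inv a = (a \<otimes> u \<otimes> inv a) \<otimes> (a \<otimes> v \<otimes> inv a)"
      using c ac x by (simp add: m_assoc)
    ultimately show ?thesis by (auto simp: set_mult_def)
  qed
  show "x = \<one>" if xm: "x \<in> ?H <#> ?U" "x \<in> Y_tilde W S J" for x
  proof -
    obtain u v where x: "x = u \<otimes> v" "u \<in> ?H" "v \<in> ?U" using xm(1) by (auto simp: set_mult_def)
    note c = Hc[OF x(2)] Uc[OF x(3)]
    have "x \<otimes> inv v \<in> NI W S J"
      using Y_tilde_NI[OF xm(2)] perp_group_NI[OF J x(3)] NI_inv[OF J] NI_subgroup[OF J]
      by (simp add: subgroup.m_closed)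
    then have "u \<in> NI W S J" using x c by (simp add: m_assoc)
    then have "u = \<one>" using NI_Int_parabolic[OF J x(2)] by simp
    then show ?thesis using perp_group_Int_Y_tilde[OF J] x xm c by simp
  qed
  show "\<exists>n\<in>?H <#> ?U. \<exists>h\<in>Y_tilde W S J. a = n \<otimes> h" if a: "a \<in> ?N" for a
  proof -
    obtain g n where a': "a = g \<otimes> n" "g \<in> ?H" "n \<in> NI W S J" using normalizer_decompose[OF J a] by blast
    obtain v y where n: "n = v \<otimes> y" "v \<in> ?U" "y \<in> Y_tilde W S J" using NI_decompose[OF J a'(3)] by blast
    have "a = (g \<otimes> v) \<otimes> y" using a' n Hc Uc Y_tilde_closed by (simp add: m_assoc)
    moreover have "g \<otimes> v \<in> ?H <#> ?U" using a' n by (auto simp: set_mult_def)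
    ultimately show ?thesis using n by blast
  qed
qed

section \<open>Longest elements\<close>

lemma parabolic_mono: "K \<subseteq> J \<Longrightarrow> generate W K \<subseteq> generate W J"
  by (rule mono_generate)

lemma longest_properties:
  assumes "finite (generate W J)"
  shows "longest W S J \<in> generate W J" "g \<in> generate W J \<Longrightarrow> len g \<le> len (longest W S J)"
proof -
  have "\<forall>y. y \<in> generate W J \<longrightarrow> len y < Suc (Max (len ` generate W J))"
    using assms by (simp add: less_Suc_eq_le)
  from arg_max_nat_lemma[of "\<lambda>w. w \<in> generate W J", OF generate.one this]
  show "longest W S J \<in> generate W J" "g \<in> generate W J \<Longrightarrow> len g \<le> len (longest W S J)"
    unfolding longest_def by auto
qed

lemma longest_closed: "\<lbrakk>J \<subseteq> S; finite (generate W J)\<rbrakk> \<Longrightarrow> longest W S J \<in> carrier W"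
  using longest_properties(1) generate_S_closed by blast

lemma longest_negative:
  assumes J: "J \<subseteq> S" "finite (generate W J)" "t \<in> J"
  shows "nonneg (opp (act (longest W S J) (simple_root t)))"
proof -
  let ?w = "longest W S J"
  have t: "t \<in> S" and w: "?w \<in> carrier W" using assms longest_closed by auto
  have "?w \<otimes> t \<in> generate W J"
    by (rule generate.eng[OF longest_properties(1)[OF assms(2)] generate.incl[OF assms(3)]])
  then have "\<not> len ?w < len (?w \<otimes> t)" using longest_properties(2)[OF assms(2)] by (simp add: not_less)
  then show ?thesis using act_simple_root_nonneg_iff[OF w t] root_not_both[OF root_I[OF w t]] by simp
qed

text \<open>A positive u^-1 \<alpha>_t would be a nonnegative combination of simple roots of J, all
  made negative by u, whereas u returns it to \<alpha>_t.\<close>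

lemma parabolic_negative_inv:
  assumes J: "J \<subseteq> S" and u: "u \<in> generate W J"
    and neg: "\<And>t. t \<in> J \<Longrightarrow> nonneg (opp (act u (simple_root t)))" and t: "t \<in> J"
  shows "nonneg (opp (act (inv u) (simple_root t)))"
proof (rule ccontr)
  have uc: "u \<in> carrier W" and tS: "t \<in> S" using assms generate_S_closed by auto
  have iu: "inv u \<in> generate W J" using u parabolic_subgroup[OF J] subgroup.m_inv_closed by metis
  let ?g = "act (inv u) (simple_root t)"
  have g: "?g \<in> \<Phi>" using uc tS by simp
  assume "\<not> nonneg (opp ?g)"
  then have "nonneg ?g" using root_cases[OF g] by blast
  moreover have "r \<in> J" if "?g r \<noteq> 0" for r
    using act_coord[OF J iu simple_root_V[OF tS], of r] that t by (cases "r \<in> J") (auto simp: simple_root_apply split: if_splits)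
  ultimately have "nonneg (opp (act u ?g))" by (intro act_nonpos[OF uc root_V[OF g]] neg) blast+
  then show False using root_not_both[of "simple_root t"] uc tS by simp
qed

text \<open>v^-1 makes each simple root of J negative within the span of J and u makes it positive
  again, so u v^-1 has no descent in J. This allows longest elements to be recognized by signs
  alone.\<close>

lemma parabolic_negative_unique:
  assumes J: "J \<subseteq> S" and u: "u \<in> generate W J" and v: "v \<in> generate W J"
    and "\<And>t. t \<in> J \<Longrightarrow> nonneg (opp (act u (simple_root t)))"
    and "\<And>t. t \<in> J \<Longrightarrow> nonneg (opp (act v (simple_root t)))"
  shows "u = v"
proof -
  have uc: "u \<in> carrier W" "v \<in> carrier W" using u v J generate_S_closed by auto
  have iv: "inv v \<in> generate W J" using v parabolic_subgroup[OF J] subgroup.m_inv_closed by metis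
  have "u \<otimes> inv v = \<one>"
  proof (rule parabolic_one[OF J generate.eng[OF u iv]])
    fix t assume t: "t \<in> J"
    then have tS: "t \<in> S" using J by auto
    let ?g = "act (inv v) (simple_root t)"
    have g: "?g \<in> \<Phi>" using uc tS by simp
    have "nonneg (opp ?g)" using parabolic_negative_inv[OF J v assms(5) t] .
    moreover have "r \<in> J" if "opp ?g r \<noteq> 0" for r
      using act_coord[OF J iv simple_root_V[OF tS], of r] that t
      by (cases "r \<in> J") (auto simp: simple_root_apply opp_def split: if_splits)
    ultimately have "nonneg (opp (act u (opp ?g)))"
      by (intro act_nonpos[OF uc(1) opp_V[OF root_V[OF g]]] assms(4)) blast+
    then show "nonneg (act (u \<otimes> inv v) (simple_root t))"
      using uc tS g by (simp add: act_opp act_mult)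
  qed
  then show ?thesis using uc by (metis inv_equality inv_inv inv_closed)
qed

lemma longest_unique:
  assumes "J \<subseteq> S" "finite (generate W J)" "u \<in> generate W J"
    "\<And>t. t \<in> J \<Longrightarrow> nonneg (opp (act u (simple_root t)))"
  shows "u = longest W S J"
  using parabolic_negative_unique[OF assms(1,3) longest_properties(1)[OF assms(2)] assms(4)]
    longest_negative[OF assms(1,2)] by blast

lemma longest_inv:
  assumes "J \<subseteq> S" "finite (generate W J)" shows "inv (longest W S J) = longest W S J"
proof (rule longest_unique[OF assms])
  show "inv (longest W S J) \<in> generate W J"
    using longest_properties(1)[OF assms(2)] parabolic_subgroup[OF assms(1)] subgroup.m_inv_closed by metis
  show "nonneg (opp (act (inv (longest W S J)) (simple_root t)))" if "t \<in> J" for t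
    using parabolic_negative_inv[OF assms(1) longest_properties(1)[OF assms(2)] longest_negative[OF assms] that] .
qed

lemma longest_act_act:
  assumes "J \<subseteq> S" "finite (generate W J)" "v \<in> V"
  shows "act (longest W S J) (act (longest W S J) v) = v"
  using longest_inv[OF assms(1,2)] longest_closed[OF assms(1,2)] assms(3) act_inv2 by metis

text \<open>By extremality -w_0(J) permutes the simple roots of J; \<open>longest_simple_sym\<close>
  shows that this permutation is an involution.\<close>

lemma longest_simple:
  assumes J: "J \<subseteq> S" "finite (generate W J)" and t: "t \<in> J"
  shows "\<exists>k\<in>J. act (longest W S J) (simple_root t) = opp (simple_root k)"
proof (rule act_simple_root_opp_simple[OF longest_closed[OF J] _ J(1) longest_negative[OF J t]])
  show tS: "t \<in> S" using J t by auto
  show "act (longest W S J) (simple_root t) r = 0" if "r \<notin> J" for r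
    using act_coord[OF J(1) longest_properties(1)[OF J(2)] simple_root_V[OF tS] that] t that
    by (auto simp: simple_root_apply)
  show "nonneg (opp (act (inv (longest W S J)) (simple_root k)))" if "k \<in> J" for k
    unfolding longest_inv[OF J] using longest_negative[OF J that] .
qed

lemma longest_simple_sym:
  assumes J: "J \<subseteq> S" "finite (generate W J)" and "t \<in> S" "k \<in> S"
    "act (longest W S J) (simple_root t) = opp (simple_root k)"
  shows "act (longest W S J) (simple_root k) = opp (simple_root t)"
proof -
  have "simple_root t = act (longest W S J) (opp (simple_root k))"
    using longest_act_act[OF J simple_root_V[OF assms(3)]] assms(5) by simp
  then show ?thesis using assms(4) longest_closed[OF J] by (simp add: act_opp)
qed

section \<open>Connected components of the Coxeter graph\<close>

abbreviation khull where "khull \<equiv> component_hull W"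

lemma hull_base: "s \<in> khull J {s}"
  by (auto simp: component_hull_def)

lemma hull_sub: "khull J {s} \<subseteq> insert s J"
  unfolding component_hull_def by (auto elim: rtranclE)

lemma hull_step: "\<lbrakk>a \<in> khull J {s}; b \<in> insert s J; cox_adj W a b\<rbrakk> \<Longrightarrow> b \<in> khull J {s}"
proof -
  assume *: "a \<in> khull J {s}" "b \<in> insert s J" "cox_adj W a b"
  then have "a \<in> insert s J" using hull_sub by blast
  then show ?thesis using * unfolding component_hull_def by (auto intro: rtrancl_into_rtrancl)
qed

lemma hull_induct [consumes 1, case_names base step]:
  assumes "t \<in> khull J {s}" "P s"
    "\<And>a b. \<lbrakk>a \<in> khull J {s}; b \<in> khull J {s}; cox_adj W a b; P a\<rbrakk> \<Longrightarrow> P b"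
  shows "P t"
proof -
  let ?R = "{(a, b). a \<in> J \<union> {s} \<and> b \<in> J \<union> {s} \<and> cox_adj W a b}"
  have "(s, t) \<in> ?R\<^sup>*" using assms(1) by (auto simp: component_hull_def)
  then have "t \<in> khull J {s} \<and> P t"
  proof (induction rule: rtrancl_induct)
    case base
    show ?case using assms(2) hull_base by simp
  next
    case (step a b)
    have a: "a \<in> khull J {s}" "P a" "cox_adj W a b" "b \<in> insert s J" using step by auto
    have b: "b \<in> khull J {s}" by (rule hull_step[OF a(1,4,3)])
    show ?case using b assms(3)[OF a(1) b a(3,2)] by simp
  qed
  then show ?thesis by blast
qed

text \<open>Exchanging s for t leaves the vertex set unchanged, and adjacency is symmetric. Hence an
  edge and its reverse are built from the same component.\<close>

lemma hull_swap:
  assumes "insert s J \<subseteq> S" "t \<in> khull J {s}" "insert t J' = insert s J"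
  shows "khull J' {t} = khull J {s}"
proof -
  let ?R = "{(a, b). a \<in> J \<union> {s} \<and> b \<in> J \<union> {s} \<and> cox_adj W a b}"
  have eq: "J' \<union> {t} = J \<union> {s}" using assms(3) by auto
  have "sym ?R" using assms(1) by (auto intro!: symI cox_adj_sym)
  then have "sym (?R\<^sup>*)" by (rule sym_rtrancl)
  moreover have "(s, t) \<in> ?R\<^sup>*" using assms(2) by (auto simp: component_hull_def)
  ultimately have "(t, s) \<in> ?R\<^sup>*" by (rule symD)
  then have "?R\<^sup>* `` {t} = ?R\<^sup>* `` {s}" using \<open>(s, t) \<in> ?R\<^sup>*\<close> by (auto intro: rtrancl_trans)
  then show ?thesis unfolding component_hull_def eq .
qed

text \<open>A vertex of J outside the component is adjacent to none of its vertices, so its root is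
  orthogonal to every letter of g.\<close>

lemma hull_fixes:
  assumes "insert s J \<subseteq> S" "g \<in> generate W (khull J {s})" "t \<in> J - khull J {s}"
  shows "act g (simple_root t) = simple_root t"
proof -
  let ?K = "khull J {s}"
  have K: "?K \<subseteq> S" using hull_sub[of J s] assms(1) by blast
  obtain ws where ws: "ws \<in> lists ?K" "g = wp ws" using assms generate_eq_words[OF K] by auto
  have tS: "t \<in> S" using assms by auto
  have "wact ws (simple_root t) = simple_root t" using ws(1)
  proof (induction ws)
    case (Cons k ws)
    have k: "k \<in> S" "k \<noteq> t" using Cons K assms(3) by auto
    have "\<not> cox_adj W k t" using hull_step[OF Cons.hyps(1), of t] assms(3) by blast
    then have "B (simple_root k) (simple_root t) = 0" using k tS by (simp add: B_simple kf_eq_0)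
    then show ?case using Cons k tS by (simp add: rf_perp)
  qed simp
  moreover have "ws \<in> lists S" using ws K by auto
  ultimately show ?thesis using ws tS by (simp add: act_word)
qed

section \<open>The elements \<open>w\<^sub>x\<^sup>s\<close>\<close>

abbreviation wxs where
  "wxs J s \<equiv> longest W S (khull J {s}) \<otimes> longest W S (khull J {s} - {s})"

context
  fixes J :: "'a set" and s :: 'a
  assumes J: "J \<subseteq> S" and s: "s \<in> S - J" and fin: "finite (generate W (khull J {s}))"
begin

lemma hull_subset_S: "(khull J {s}) \<subseteq> S" "khull J {s} - {s} \<subseteq> S" and base_in_hull: "s \<in> (khull J {s})" "s \<in> S"
  using hull_sub[of J s] hull_base[of s J] J s by auto

lemma finite_hull_diff: "finite (generate W (khull J {s} - A))"
  using fin parabolic_mono[of "khull J {s} - A" "khull J {s}"] finite_subset by blast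

lemma wxs_mem: "wxs J s \<in> generate W (khull J {s})"
proof (rule generate.eng)
  show "longest W S (khull J {s}) \<in> generate W (khull J {s})" by (rule longest_properties(1)[OF fin])
  show "longest W S (khull J {s} - {s}) \<in> generate W (khull J {s})"
    using longest_properties(1)[OF finite_hull_diff] parabolic_mono[of "khull J {s} - {s}" "khull J {s}"] by blast
qed

lemma wxs_closed: "wxs J s \<in> carrier W"
  using generate_S_closed[OF hull_subset_S(1) wxs_mem] .

lemma longest_hull_closed: "longest W S (khull J {s}) \<in> carrier W" "longest W S (khull J {s} - {s}) \<in> carrier W"
  using longest_closed[OF hull_subset_S(1) fin] longest_closed[OF hull_subset_S(2) finite_hull_diff] by auto

lemma act_wxs: "v \<in> V \<Longrightarrow> act (wxs J s) v = act (longest W S (khull J {s})) (act (longest W S (khull J {s} - {s})) v)"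
  using longest_hull_closed by (simp add: act_mult)

text \<open>The first factor to act, w_0(K - s), keeps the positive s-coordinate and thereby the
  sign; w_0(K) then makes the root, still supported in K, negative.\<close>

lemma wxs_inverts:
  assumes \<beta>: "\<beta> \<in> \<Phi>" "nonneg \<beta>" and supp: "\<And>r. r \<notin> (khull J {s}) \<Longrightarrow> \<beta> r = 0" and "0 < \<beta> s"
  shows "nonneg (opp (act (wxs J s) \<beta>))"
proof -
  let ?g = "act (longest W S (khull J {s} - {s})) \<beta>"
  have c: "?g r = \<beta> r" if "r \<notin> khull J {s} - {s}" for r
    by (rule act_coord[OF hull_subset_S(2) longest_properties(1)[OF finite_hull_diff] root_V[OF \<beta>(1)] that])
  have g: "?g \<in> \<Phi>" using \<beta> longest_hull_closed by simp
  have "nonneg ?g" using root_coord_nonneg[OF g, of s] c[of s] assms by simp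
  moreover have "r \<in> (khull J {s})" if "?g r \<noteq> 0" for r using c[of r] supp[of r] that by (cases "r \<in> (khull J {s})") auto
  ultimately have "nonneg (opp (act (longest W S (khull J {s})) ?g))"
    by (intro act_nonpos[OF longest_hull_closed(1) root_V[OF g]] longest_negative[OF hull_subset_S(1) fin]) blast+
  then show ?thesis using act_wxs \<beta> by simp
qed

text \<open>Either a positive coordinate outside K survives, or the support lies in K - s and the
  two longest elements each flip the sign. With \<open>wxs_inverts\<close> this determines the
  inversions of w_x^s exactly.\<close>

lemma wxs_not_inverts:
  assumes \<beta>: "\<beta> \<in> \<Phi>" "nonneg \<beta>" "\<not> (\<forall>r. r \<notin> (khull J {s}) \<longrightarrow> \<beta> r = 0) \<or> \<beta> s = 0"
  shows "nonneg (act (wxs J s) \<beta>)"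
proof (cases "\<forall>r. r \<notin> (khull J {s}) \<longrightarrow> \<beta> r = 0")
  case False
  then obtain r where r: "r \<notin> (khull J {s})" "\<beta> r \<noteq> 0" by blast
  then have "act (wxs J s) \<beta> r = \<beta> r" by (intro act_coord[OF hull_subset_S(1) wxs_mem root_V[OF \<beta>(1)]])
  then have "0 < act (wxs J s) \<beta> r" using r \<beta>(2) by (simp add: nonneg_def less_le)
  then show ?thesis using root_coord_nonneg[of "act (wxs J s) \<beta>" r] \<beta> wxs_closed by simp
next
  case True
  let ?g = "act (longest W S (khull J {s} - {s})) \<beta>"
  have c: "?g r = \<beta> r" if "r \<notin> khull J {s} - {s}" for r
    by (rule act_coord[OF hull_subset_S(2) longest_properties(1)[OF finite_hull_diff] root_V[OF \<beta>(1)] that])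
  have g: "?g \<in> \<Phi>" using \<beta> longest_hull_closed by simp
  have "r \<in> khull J {s} - {s}" if "\<beta> r \<noteq> 0" for r using that True \<beta>(3) by auto
  then have "nonneg (opp ?g)" using \<beta>(2)
    by (intro act_nonpos[OF longest_hull_closed(2) root_V[OF \<beta>(1)]] longest_negative[OF hull_subset_S(2) finite_hull_diff]) blast+
  moreover have "r \<in> (khull J {s})" if "opp ?g r \<noteq> 0" for r
    using c[of r] True that by (cases "r \<in> (khull J {s})") (auto simp: opp_def)
  ultimately have "nonneg (opp (act (longest W S (khull J {s})) (opp ?g)))"
    by (intro act_nonpos[OF longest_hull_closed(1) opp_V[OF root_V[OF g]]] longest_negative[OF hull_subset_S(1) fin]) blast+
  then show ?thesis using act_wxs \<beta> g longest_hull_closed by (simp add: act_opp)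
qed

text \<open>The involution -w_0(K) exchanges s and t, so it carries K - t to K - s; the companion
  lemma treats the other direction.\<close>

lemma longest_K_minus:
  assumes "t \<in> (khull J {s})" "act (longest W S (khull J {s})) (simple_root s) = opp (simple_root t)" "k \<in> khull J {s} - {t}"
  shows "\<exists>j\<in>khull J {s} - {s}. act (longest W S (khull J {s})) (simple_root k) = opp (simple_root j)"
proof -
  have S: "t \<in> S" "k \<in> S" using assms hull_subset_S by auto
  obtain j where j: "j \<in> (khull J {s})" "act (longest W S (khull J {s})) (simple_root k) = opp (simple_root j)"
    using longest_simple[OF hull_subset_S(1) fin, of k] assms by auto
  have "j \<noteq> s"
  proof
    assume "j = s"
    then have "act (longest W S (khull J {s})) (simple_root s) = opp (simple_root k)"
      using longest_simple_sym[OF hull_subset_S(1) fin S(2)] j base_in_hull by simp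
    then show False using assms by (simp add: opp_inj simple_root_inj)
  qed
  then show ?thesis using j by blast
qed

lemma longest_K_minus':
  assumes "t \<in> (khull J {s})" "act (longest W S (khull J {s})) (simple_root s) = opp (simple_root t)" "j \<in> khull J {s} - {s}"
  shows "\<exists>k\<in>khull J {s} - {t}. act (longest W S (khull J {s})) (simple_root j) = opp (simple_root k)"
proof -
  have S: "t \<in> S" "j \<in> S" using assms hull_subset_S by auto
  obtain k where k: "k \<in> (khull J {s})" "act (longest W S (khull J {s})) (simple_root j) = opp (simple_root k)"
    using longest_simple[OF hull_subset_S(1) fin, of j] assms by auto
  have "k \<noteq> t"
  proof
    assume "k = t"
    then have "act (longest W S (khull J {s})) (simple_root t) = opp (simple_root j)"
      using longest_simple_sym[OF hull_subset_S(1) fin S(2)] k S by simp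
    moreover have "act (longest W S (khull J {s})) (simple_root t) = opp (simple_root s)"
      using longest_simple_sym[OF hull_subset_S(1) fin base_in_hull(2) S(1) assms(2)] .
    ultimately show False using assms by (simp add: opp_inj simple_root_inj)
  qed
  then show ?thesis using k by blast
qed

text \<open>Roots of J outside K are fixed. Inside, the signs of the two longest elements cancel,
  and -w_0(K) carries K - s to K - t.\<close>

lemma wxs_image:
  assumes t: "t \<in> (khull J {s})" "act (longest W S (khull J {s})) (simple_root s) = opp (simple_root t)"
  shows "act (wxs J s) ` simple_root ` J = simple_root ` (insert s J - {t})"
proof -
  have fix_e: "act (wxs J s) (simple_root j) = simple_root j" if "j \<in> J - (khull J {s})" for j
    using hull_fixes[of s J "wxs J s" j] J s wxs_mem that by auto
  have KJ: "khull J {s} - {s} \<subseteq> J" "J \<subseteq> (J - (khull J {s})) \<union> (khull J {s} - {s})" using hull_sub[of J s] s by auto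
  have fwd: "\<exists>k\<in>khull J {s} - {t}. act (wxs J s) (simple_root j) = simple_root k" if j: "j \<in> khull J {s} - {s}" for j
  proof -
    obtain i where i: "i \<in> khull J {s} - {s}" "act (longest W S (khull J {s} - {s})) (simple_root j) = opp (simple_root i)"
      using longest_simple[OF hull_subset_S(2) finite_hull_diff j] by blast
    obtain k where "k \<in> khull J {s} - {t}" "act (longest W S (khull J {s})) (simple_root i) = opp (simple_root k)"
      using longest_K_minus'[OF t i(1)] by blast
    moreover have "j \<in> S" "i \<in> S" using i j hull_subset_S by auto
    ultimately show ?thesis using i longest_hull_closed by (auto simp: act_mult act_opp)
  qed
  have bwd: "\<exists>j\<in>khull J {s} - {s}. act (wxs J s) (simple_root j) = simple_root k" if k: "k \<in> khull J {s} - {t}" for k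
  proof -
    obtain i where i: "i \<in> khull J {s} - {s}" "act (longest W S (khull J {s})) (simple_root k) = opp (simple_root i)"
      using longest_K_minus[OF t k] by blast
    obtain j where j: "j \<in> khull J {s} - {s}" "act (longest W S (khull J {s} - {s})) (simple_root i) = opp (simple_root j)"
      using longest_simple[OF hull_subset_S(2) finite_hull_diff i(1)] by blast
    have S: "i \<in> S" "j \<in> S" "k \<in> S" using i j k hull_subset_S by auto
    have "act (longest W S (khull J {s} - {s})) (simple_root j) = opp (simple_root i)"
      using longest_simple_sym[OF hull_subset_S(2) finite_hull_diff S(1,2) j(2)] .
    moreover have "act (longest W S (khull J {s})) (simple_root i) = opp (simple_root k)"
      using longest_simple_sym[OF hull_subset_S(1) fin S(3,1) i(2)] .
    ultimately have "act (wxs J s) (simple_root j) = simple_root k"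
      using S longest_hull_closed by (auto simp: act_mult act_opp)
    then show ?thesis using j by blast
  qed
  show ?thesis
  proof (intro equalityI subsetI)
    fix v assume "v \<in> act (wxs J s) ` simple_root ` J"
    then obtain j where j: "j \<in> J" "v = act (wxs J s) (simple_root j)" by blast
    show "v \<in> simple_root ` (insert s J - {t})"
    proof (cases "j \<in> (khull J {s})")
      case True
      then obtain k where "k \<in> khull J {s} - {t}" "v = simple_root k" using fwd[of j] j s by auto
      then show ?thesis using KJ by blast
    next
      case False
      then show ?thesis using j t fix_e by auto
    qed
  next
    fix v assume "v \<in> simple_root ` (insert s J - {t})"
    then obtain k where k: "k \<in> insert s J" "k \<noteq> t" "v = simple_root k" by blast
    show "v \<in> act (wxs J s) ` simple_root ` J"
    proof (cases "k \<in> (khull J {s})")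
      case True
      then obtain j where "j \<in> khull J {s} - {s}" "act (wxs J s) (simple_root j) = simple_root k" using bwd[of k] k by blast
      then have "j \<in> J" "v = act (wxs J s) (simple_root j)" using KJ k by auto
      then show ?thesis by blast
    next
      case False
      then have "k \<in> J - (khull J {s})" using k base_in_hull by blast
      then show ?thesis using k fix_e by (metis DiffD1 imageI)
    qed
  qed
qed

text \<open>Conjugation by w_0(K) turns w_0(K - s) into w_0(K - t), which is recognized by its
  signs; the rest uses that longest elements are involutions.\<close>

lemma wxs_inverse:
  assumes t: "t \<in> (khull J {s})" "act (longest W S (khull J {s})) (simple_root s) = opp (simple_root t)"
  shows "longest W S (khull J {s}) \<otimes> longest W S (khull J {s} - {t}) = inv (wxs J s)"
proof -
  let ?a = "longest W S (khull J {s})" and ?b = "longest W S (khull J {s} - {s})"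
  have Kt: "khull J {s} - {t} \<subseteq> S" using hull_subset_S by auto
  have ia: "inv ?a = ?a" and ib: "inv ?b = ?b" using longest_inv[OF hull_subset_S(1) fin] longest_inv[OF hull_subset_S(2) finite_hull_diff] by auto
  have ab: "?a \<in> carrier W" "?b \<in> carrier W" using longest_hull_closed .
  have "?a \<otimes> ?b \<otimes> inv ?a = longest W S (khull J {s} - {t})"
  proof (rule longest_unique[OF Kt finite_hull_diff])
    show "?a \<otimes> ?b \<otimes> inv ?a \<in> generate W (khull J {s} - {t})"
    proof (rule conj_generate[OF ab(1) _ longest_properties(1)[OF finite_hull_diff]])
      show "khull J {s} - {s} \<subseteq> carrier W" "khull J {s} - {t} \<subseteq> carrier W" using hull_subset_S Kt S_carrier by auto
      fix j assume j: "j \<in> khull J {s} - {s}"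
      obtain k where k: "k \<in> khull J {s} - {t}" "act ?a (simple_root j) = opp (simple_root k)"
        using longest_K_minus'[OF t j] by blast
      have S: "j \<in> S" "k \<in> S" using j k hull_subset_S by auto
      have "?a \<otimes> j \<otimes> inv ?a = rr (opp (simple_root k))" using rr_eq[OF ab(1) S(1)] k by simp
      also have "\<dots> = k" using S by (simp add: rr_opp rr_simple)
      finally show "?a \<otimes> j \<otimes> inv ?a \<in> generate W (khull J {s} - {t})" using k by (simp add: generate.incl)
    qed
    fix k assume k: "k \<in> khull J {s} - {t}"
    obtain i where i: "i \<in> khull J {s} - {s}" "act ?a (simple_root k) = opp (simple_root i)"
      using longest_K_minus[OF t k] by blast
    obtain j where j: "j \<in> khull J {s} - {s}" "act ?b (simple_root i) = opp (simple_root j)"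
      using longest_simple[OF hull_subset_S(2) finite_hull_diff i(1)] by blast
    have S: "i \<in> S" "j \<in> S" "k \<in> S" using i j k hull_subset_S by auto
    have "act (?a \<otimes> ?b \<otimes> inv ?a) (simple_root k) = act ?a (simple_root j)"
      unfolding ia using S ab i j by (simp add: act_mult act_opp)
    then show "nonneg (opp (act (?a \<otimes> ?b \<otimes> inv ?a) (simple_root k)))"
      using longest_negative[OF hull_subset_S(1) fin, of j] j by simp
  qed
  then have "?a \<otimes> longest W S (khull J {s} - {t}) = ?a \<otimes> (?a \<otimes> (?b \<otimes> ?a))"
    using ia ab by (metis m_assoc m_closed)
  also have "\<dots> = ?b \<otimes> ?a" using inv_cancel_left[OF ab(1), of "?b \<otimes> ?a"] ia ab by simp
  also have "\<dots> = inv (wxs J s)" using ia ib ab by (simp add: inv_mult_group)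
  finally show ?thesis .
qed

text \<open>A root orthogonal to \<open>J\<close> and inverted by \<open>w = wxs J s\<close> gives a reflection with the same inversions
  as \<open>w\<close> among the roots supported in \<open>J\<^sub>\<sim>\<^sub>s\<close>, so that \<open>w\<close> is this reflection and fixes \<open>\<Pi>\<^sub>J\<close>.\<close>

lemma wxs_fixes:
  assumes \<gamma>: "\<gamma> \<in> perp_roots W S J" "nonneg \<gamma>" "\<not> nonneg (act (wxs J s) \<gamma>)" and j: "j \<in> J"
  shows "act (wxs J s) (simple_root j) = simple_root j"
proof -
  have g: "\<gamma> \<in> \<Phi>" "B \<gamma> (simple_root i) = 0" if "i \<in> J" for i using \<gamma>(1) that by (auto simp: perp_roots_def)
  have g\<Phi>: "\<gamma> \<in> \<Phi>" using \<gamma>(1) by (rule perp_root)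
  have supp: "\<gamma> r = 0" if "r \<notin> (khull J {s})" for r
    using wxs_not_inverts[OF g\<Phi> \<gamma>(2)] \<gamma>(3) that by blast
  have gs: "\<gamma> s \<noteq> 0"
    using wxs_not_inverts[OF g\<Phi> \<gamma>(2)] \<gamma>(3) by blast
  have gs0: "\<gamma> s > 0" using gs \<gamma>(2) by (simp add: nonneg_def less_le)
  \<comment> \<open>\<gamma> is orthogonal to J, and subtracting the \<alpha>_s-component of \<beta>
    leaves a combination of simple roots of J.\<close>
  have B\<gamma>: "B \<gamma> \<beta> = \<beta> s * B \<gamma> (simple_root s)" if \<beta>: "\<beta> \<in> V" "\<And>r. r \<notin> (khull J {s}) \<Longrightarrow> \<beta> r = 0" for \<beta>
  proof -
    let ?d = "lincomb 1 \<beta> (- \<beta> s) (simple_root s)"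
    have d: "?d \<in> V" using \<beta> base_in_hull by simp
    have dJ: "r \<in> J" if "?d r \<noteq> 0" for r
    proof (rule ccontr)
      assume "r \<notin> J"
      then have "r \<notin> (khull J {s}) \<or> r = s" using hull_sub[of J s] by blast
      then show False using that \<beta>(2)[of r] base_in_hull
        by (cases "r = s") (auto simp: lincomb_def simple_root_apply)
    qed
    have "B ?d \<gamma> = (\<Sum>i | ?d i \<noteq> 0. ?d i * B (simple_root i) \<gamma>)"
    proof -
      have "B ?d \<gamma> = (\<Sum>i | ?d i \<noteq> 0. \<Sum>t | \<gamma> t \<noteq> 0. ?d i * \<gamma> t * kf i t)"
        by (rule B_eq) (use d g\<Phi> V_fin in auto)
      then show ?thesis using g\<Phi> by (simp add: B_simple_left sum_distrib_left mult.assoc)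
    qed
    also have "\<dots> = 0"
    proof (rule sum.neutral, rule ballI)
      fix i assume "i \<in> {i. ?d i \<noteq> 0}"
      then have "i \<in> J" "i \<in> S" using dJ J by auto
      then show "?d i * B (simple_root i) \<gamma> = 0" using g(2) g\<Phi> B_sym[of "simple_root i" \<gamma>] by simp
    qed
    finally have "B \<gamma> ?d = 0" using B_sym[OF root_V[OF g\<Phi>] d] by simp
    then show ?thesis using \<beta> g\<Phi> base_in_hull by (simp add: B_lincomb_right)
  qed
  define b where "b = B \<gamma> (simple_root s)"
  have b: "\<gamma> s * b = 1" using B\<gamma>[OF root_V[OF g\<Phi>] supp] root_norm[OF g\<Phi>] by (simp add: b_def)
  \<comment> \<open>Signs on \<alpha>_i: for i outside K the image under the reflection keeps
    coordinate 1 at i; for i in K - s it is \<alpha>_i itself; for i = s its s-coordinate is 1 - 2 =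
    -1, and w then flips the sign back.\<close>
  have "wxs J s \<otimes> rr \<gamma> = \<one>"
  proof (rule all_nonneg_one)
    show "wxs J s \<otimes> rr \<gamma> \<in> carrier W" using wxs_closed g\<Phi> by simp
    fix i assume i: "i \<in> S"
    let ?\<beta> = "simple_root i"
    let ?r = "act (rr \<gamma>) ?\<beta>"
    have r: "?r \<in> \<Phi>" using i g\<Phi> by simp
    have r_eq: "?r = lincomb 1 ?\<beta> (- 2 * B \<gamma> ?\<beta>) \<gamma>" using act_rr[OF g\<Phi>] i by simp
    have "nonneg (act (wxs J s) ?r)"
    proof (cases "i \<in> (khull J {s})")
      case False
      then have "?r i = 1" unfolding r_eq using supp by (simp add: lincomb_def simple_root_apply)
      then have "nonneg ?r" "\<not> (\<forall>r. r \<notin> (khull J {s}) \<longrightarrow> ?r r = 0)"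
        using root_coord_nonneg[OF r, of i] False by (auto intro!: exI[of _ i])
      then show ?thesis using wxs_not_inverts[OF r] by blast
    next
      case True
      have i0: "simple_root i r = 0" if "r \<notin> (khull J {s})" for r using True that by (auto simp: simple_root_apply)
      have Bi: "B \<gamma> ?\<beta> = ?\<beta> s * b" unfolding b_def by (rule B\<gamma>) (use i i0 in auto)
      show ?thesis
      proof (cases "i = s")
        case False
        then have "B \<gamma> ?\<beta> = 0" using Bi by (simp add: simple_root_apply)
        then have "?r = ?\<beta>" unfolding r_eq by (simp add: lincomb_def)
        moreover have "nonneg (act (wxs J s) ?\<beta>)"
          by (rule wxs_not_inverts) (use False i in \<open>auto simp: simple_root_apply\<close>)
        ultimately show ?thesis by simp
      next
        case i_s: True
        have "?r s = 1 - 2 * (\<gamma> s * b)" unfolding r_eq using Bi i_s by (simp add: lincomb_def simple_root_apply)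
        then have rs: "?r s = - 1" using b by simp
        have "\<not> nonneg ?r"
        proof
          assume "nonneg ?r"
          then have "0 \<le> ?r s" by (simp add: nonneg_def)
          then show False using rs by simp
        qed
        then have n: "nonneg (opp ?r)" using root_not_both[OF r] by simp
        have "opp ?r t = 0" if "t \<notin> (khull J {s})" for t
          unfolding r_eq using that supp i0 by (simp add: opp_def lincomb_def)
        moreover have "0 < opp ?r s" using rs by (simp add: opp_def)
        ultimately have "nonneg (opp (act (wxs J s) (opp ?r)))" using wxs_inverts[OF root_opp[OF r] n] by blast
        then show ?thesis using r wxs_closed by (simp add: act_opp)
      qed
    qed
    then show "nonneg (act ((wxs J s) \<otimes> rr \<gamma>) ?\<beta>)" using wxs_closed g\<Phi> i by (simp add: act_mult)
  qed
  then have "wxs J s = rr \<gamma>" using wxs_closed g\<Phi> by (metis inv_equality rr_inv rr_closed inv_inv)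
  then show ?thesis using act_rr[OF g\<Phi>, of "simple_root j"] g(2)[OF j] j J by (auto simp: lincomb_def)
qed

end

section \<open>Finiteness of components\<close>

text \<open>If w\<beta> were positive, the coordinates of w\<alpha>_s outside J' would be both
  nonnegative and nonpositive. Then w\<alpha>_s would lie in the span of the simple roots of J', and
  \<alpha>_s in that of J, although s is not in J.\<close>

lemma inverts_component:
  assumes J: "J \<subseteq> S" and w: "w \<in> carrier W"
    and fwd: "\<And>t. t \<in> J \<Longrightarrow> \<exists>k\<in>J'. act w (simple_root t) = simple_root k"
    and bwd: "\<And>k. k \<in> J' \<Longrightarrow> \<exists>t\<in>J. act w (simple_root t) = simple_root k"
    and s: "s \<in> S - J" and neg: "nonneg (opp (act w (simple_root s)))"
    and \<beta>: "\<beta> \<in> \<Phi>" "nonneg \<beta>" "\<And>r. r \<notin> insert s J \<Longrightarrow> \<beta> r = 0" "0 < \<beta> s"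
  shows "nonneg (opp (act w \<beta>))"
proof (rule ccontr)
  assume "\<not> nonneg (opp (act w \<beta>))"
  then have pos: "nonneg (act w \<beta>)" using root_cases[of "act w \<beta>"] \<beta> w by auto
  let ?g = "act w (simple_root s)"
  have g: "?g \<in> V" using w s by simp
  have supp: "?g r = 0" if r: "r \<notin> J'" for r
  proof -
    have "act w \<beta> r = (\<Sum>t | \<beta> t \<noteq> 0. \<beta> t * act w (simple_root t) r)"
      by (rule act_expand[OF w root_V[OF \<beta>(1)]])
    also have "\<dots> = (\<Sum>t\<in>{s}. \<beta> t * act w (simple_root t) r)"
    proof (rule sum.mono_neutral_right)
      show "finite {t. \<beta> t \<noteq> 0}" using V_fin[OF root_V[OF \<beta>(1)]] .
      show "{s} \<subseteq> {t. \<beta> t \<noteq> 0}" using \<beta>(4) by simp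
      show "\<forall>t\<in>{t. \<beta> t \<noteq> 0} - {s}. \<beta> t * act w (simple_root t) r = 0"
      proof
        fix t assume "t \<in> {t. \<beta> t \<noteq> 0} - {s}"
        then have "t \<in> J" using \<beta>(3) by blast
        then obtain k where k: "k \<in> J'" "act w (simple_root t) = simple_root k" using fwd by blast
        have "r \<noteq> k" using k r by blast
        then show "\<beta> t * act w (simple_root t) r = 0" using k by (simp add: simple_root_apply)
      qed
    qed
    finally have "act w \<beta> r = \<beta> s * ?g r" by simp
    moreover have "0 \<le> act w \<beta> r" using pos by (simp add: nonneg_def)
    ultimately have "0 \<le> ?g r" using \<beta>(4) by (simp add: zero_le_mult_iff)
    moreover have "?g r \<le> 0" using neg by (simp add: nonneg_def opp_def)
    ultimately show ?thesis by simp
  qed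
  have "act (inv w) ?g s = (\<Sum>k | ?g k \<noteq> 0. ?g k * act (inv w) (simple_root k) s)"
    by (rule act_expand[OF inv_closed[OF w] g])
  also have "\<dots> = 0"
  proof (rule sum.neutral, rule ballI)
    fix k assume "k \<in> {k. ?g k \<noteq> 0}"
    then have "k \<in> J'" using supp by blast
    then obtain t where t: "t \<in> J" "act w (simple_root t) = simple_root k" using bwd by blast
    then have "act (inv w) (simple_root k) = simple_root t"
      using act_inv1[OF w simple_root_V[OF subsetD[OF J t(1)]]] by simp
    moreover have "s \<noteq> t" using s t by auto
    ultimately show "?g k * act (inv w) (simple_root k) s = 0" by (simp add: simple_root_apply)
  qed
  finally show False using w s by (simp add: simple_root_apply)
qed

text \<open>Equal inversion sets mean that v and v' give every root the same sign, so v v'^-1 makes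
  no simple root negative.\<close>

lemma Inv_inject:
  assumes "v \<in> carrier W" "v' \<in> carrier W" "Inv v = Inv v'"
  shows "v = v'"
proof -
  have "v \<otimes> inv v' = \<one>"
  proof (rule all_nonneg_one)
    show "v \<otimes> inv v' \<in> carrier W" using assms by simp
    fix s assume s: "s \<in> S"
    let ?b = "act (inv v') (simple_root s)"
    have b: "?b \<in> \<Phi>" using s assms by simp
    have v'b: "act v' ?b = simple_root s" using s assms by simp
    have ns: "\<not> nonneg (opp (simple_root s))" using root_not_both[of "simple_root s"] s by simp
    have vb: "act v ?b \<in> \<Phi>" using b assms by simp
    have "nonneg (act v ?b)"
    proof (cases "nonneg ?b")
      case True
      then have "?b \<notin> Inv v" using assms(3) v'b ns by (simp add: Inv_def)
      then have "\<not> nonneg (opp (act v ?b))" using True b by (simp add: Inv_def)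
      then show ?thesis using root_cases[OF vb] by blast
    next
      case False
      then have "nonneg (opp ?b)" using root_cases[OF b] by blast
      then have "opp ?b \<in> Inv v'" using v'b b assms by (simp add: Inv_def act_opp)
      then have "opp ?b \<in> Inv v" using assms(3) by simp
      then have "nonneg (opp (act v (opp ?b)))" by (simp add: Inv_def)
      then show ?thesis using b assms by (simp add: act_opp)
    qed
    then show "nonneg (act (v \<otimes> inv v') (simple_root s))" using assms s by (simp add: act_mult)
  qed
  then show ?thesis using assms by (metis inv_equality inv_inv inv_closed)
qed

text \<open>\<open>W\<^sub>K\<^sub>-\<^sub>s\<close> acts faithfully on the finite set \<open>F\<close> of positive roots supported in \<open>K\<close> that involve \<open>s\<close>,
  because \<open>K\<close> is connected; and a minimal left coset representative of \<open>W\<^sub>K\<^sub>-\<^sub>s\<close> in \<open>W\<^sub>K\<close> is determined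
  by its inversions, which lie in \<open>F\<close>.\<close>

lemma component_finite:
  assumes J: "J \<subseteq> S" and s: "s \<in> S - J" and K: "K = khull J {s}"
    and F: "F = {\<beta> \<in> \<Phi>. nonneg \<beta> \<and> (\<forall>r. r \<notin> K \<longrightarrow> \<beta> r = 0) \<and> 0 < \<beta> s}" and fin: "finite F"
  shows "finite (generate W K)"
proof -
  have KS: "K \<subseteq> S" "K - {s} \<subseteq> S" and base_in_hull: "s \<in> K" "s \<in> S"
    using hull_sub[of J s] hull_base[of s J] J s K by auto
  let ?H = "generate W (K - {s})"
  have Hc: "g \<in> carrier W" if "g \<in> ?H" for g using generate_S_closed[OF KS(2) that] .
  have F\<Phi>: "\<beta> \<in> \<Phi>" if "\<beta> \<in> F" for \<beta> using that by (simp add: F)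
  have HF: "act g \<beta> \<in> F" if g: "g \<in> ?H" and \<beta>: "\<beta> \<in> F" for g \<beta>
  proof -
    have c: "act g \<beta> r = \<beta> r" if "r \<notin> K - {s}" for r
      by (rule act_coord[OF KS(2) g root_V[OF F\<Phi>[OF \<beta>]] that])
    have "act g \<beta> \<in> \<Phi>" using Hc[OF g] F\<Phi>[OF \<beta>] by simp
    moreover have "0 < act g \<beta> s" using c[of s] \<beta> by (simp add: F)
    moreover have "act g \<beta> r = 0" if "r \<notin> K" for r using c[of r] \<beta> that by (simp add: F)
    ultimately show ?thesis using root_coord_nonneg[of "act g \<beta>" s] by (simp add: F)
  qed
  have sF: "simple_root s \<in> F" using base_in_hull by (auto simp: F simple_root_apply)
  \<comment> \<open>Across an edge from a to b: if \<beta> in F is not orthogonal to \<alpha>_a,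
    then \<beta> and its reflection at a, again in F, cannot both be orthogonal to \<alpha>_b,
    because <\<alpha>_b, \<alpha>_a> < 0.\<close>
  have conn: "t = s \<or> (\<exists>\<beta>\<in>F. B (simple_root t) \<beta> \<noteq> 0)" if "t \<in> K" for t
    using that unfolding K
  proof (induction rule: hull_induct)
    case (step a b)
    then have ab: "a \<in> S" "b \<in> S" "a \<in> K" using KS K by auto
    have k: "kf b a < 0" using kf_less_0[OF cox_adj_sym[OF ab(1,2) step(3)]] .
    show ?case
    proof (cases "a = s")
      case True
      then have "B (simple_root b) (simple_root s) \<noteq> 0" using k ab by (simp add: B_simple)
      then show ?thesis using sF by blast
    next
      case False
      then obtain \<beta> where \<beta>: "\<beta> \<in> F" "B (simple_root a) \<beta> \<noteq> 0" using step by blast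
      have "a \<in> ?H" using False ab by (simp add: generate.incl)
      then have aF: "act a \<beta> \<in> F" using HF \<beta> by blast
      have V: "\<beta> \<in> V" using F\<Phi> \<beta> by simp
      have "B (simple_root b) (act a \<beta>) = B (simple_root b) \<beta> - 2 * B (simple_root a) \<beta> * kf b a"
        using V ab by (simp add: act_gen rf_eq B_lincomb_right B_simple)
      then have "B (simple_root b) \<beta> \<noteq> 0 \<or> B (simple_root b) (act a \<beta>) \<noteq> 0" using k \<beta>(2) by auto
      then show ?thesis using aF \<beta>(1) by blast
    qed
  qed simp
  \<comment> \<open>If \<beta> in F is not orthogonal to \<alpha>_t, then u fixes \<beta> and its
    reflection at t, hence their difference, a nonzero multiple of \<alpha>_t.\<close>
  have faithful: "u = \<one>" if u: "u \<in> ?H" and fix_F: "\<And>\<beta>. \<beta> \<in> F \<Longrightarrow> act u \<beta> = \<beta>" for u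
  proof (rule parabolic_one[OF KS(2) u])
    fix t assume t: "t \<in> K - {s}"
    then have tS: "t \<in> S" using KS by auto
    obtain \<beta> where \<beta>: "\<beta> \<in> F" "B (simple_root t) \<beta> \<noteq> 0" using conn t by blast
    define c where "c = - 2 * B (simple_root t) \<beta>"
    have V: "\<beta> \<in> V" using F\<Phi> \<beta> by simp
    have t\<beta>: "act t \<beta> = lincomb 1 \<beta> c (simple_root t)" using V tS by (simp add: act_gen rf_eq c_def)
    have "act t \<beta> \<in> F" using HF[OF generate.incl[OF t] \<beta>(1)] .
    then have "act u (act t \<beta>) = act t \<beta>" by (rule fix_F)
    then have "lincomb 1 \<beta> c (act u (simple_root t)) = lincomb 1 \<beta> c (simple_root t)"
      unfolding t\<beta> using V tS Hc[OF u] fix_F[OF \<beta>(1)] by (simp add: act_lincomb)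
    then have "c * act u (simple_root t) r = c * simple_root t r" for r
      by (auto simp: lincomb_def dest: fun_cong[of _ _ r])
    then have "act u (simple_root t) = simple_root t" using \<beta>(2) by (auto simp: c_def)
    then show "nonneg (act u (simple_root t))" by simp
  qed
  have "finite ?H"
  proof (rule finite_imageD)
    show "finite ((\<lambda>g. restrict (act g) F) ` ?H)"
      by (rule finite_subset[of _ "F \<rightarrow>\<^sub>E F"]) (use HF fin in \<open>auto intro: finite_PiE\<close>)
    show "inj_on (\<lambda>g. restrict (act g) F) ?H"
    proof (rule inj_onI)
      fix g h assume gh: "g \<in> ?H" "h \<in> ?H" "restrict (act g) F = restrict (act h) F"
      have eq: "act g \<beta> = act h \<beta>" if "\<beta> \<in> F" for \<beta> using gh(3) that by (metis restrict_apply')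
      have c: "g \<in> carrier W" "h \<in> carrier W" using gh Hc by auto
      have "inv h \<in> ?H" using gh(2) parabolic_subgroup[OF KS(2)] subgroup.m_inv_closed by metis
      then have "inv h \<otimes> g \<in> ?H" using gh(1) by (rule generate.eng)
      moreover have "act (inv h \<otimes> g) \<beta> = \<beta>" if "\<beta> \<in> F" for \<beta>
        using eq[OF that] c root_V[OF F\<Phi>[OF that]] by (simp add: act_mult)
      ultimately have "inv h \<otimes> g = \<one>" by (rule faithful)
      then show "g = h" using c by (metis inv_equality inv_inv inv_closed inv_comm)
    qed
  qed
  define X where "X = {v \<in> generate W K. \<forall>t\<in>K - {s}. nonneg (act v (simple_root t))}"
  have Xc: "v \<in> carrier W" if "v \<in> X" for v using that generate_S_closed[OF KS(1)] by (simp add: X_def)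
  have "finite X"
  proof (rule finite_imageD)
    have InvF: "Inv v \<subseteq> F" if v: "v \<in> X" for v
    proof
      fix \<beta> assume "\<beta> \<in> Inv v"
      then have \<beta>: "\<beta> \<in> \<Phi>" "nonneg \<beta>" "\<not> nonneg (act v \<beta>)"
        using root_not_both[of "act v \<beta>"] Xc[OF v] by (auto simp: Inv_def)
      have vK: "v \<in> generate W K" using v by (simp add: X_def)
      have supp: "\<beta> r = 0" if r: "r \<notin> K" for r
      proof (rule ccontr)
        assume "\<beta> r \<noteq> 0"
        then have "0 < act v \<beta> r"
          using act_coord[OF KS(1) vK root_V[OF \<beta>(1)] r] \<beta>(2) by (simp add: nonneg_def less_le)
        then show False using root_coord_nonneg[of "act v \<beta>" r] \<beta> Xc[OF v] by simp
      qed
      have "\<beta> s \<noteq> 0"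
      proof
        assume "\<beta> s = 0"
        then have "t \<in> K - {s}" if "\<beta> t \<noteq> 0" for t using supp that by auto
        then have "nonneg (act v \<beta>)"
          using v by (intro act_nonneg[OF Xc[OF v] root_V[OF \<beta>(1)] \<beta>(2)]) (simp add: X_def)
        then show False using \<beta>(3) by simp
      qed
      then have "0 < \<beta> s" using \<beta>(2) by (simp add: nonneg_def less_le)
      then show "\<beta> \<in> F" using \<beta> supp by (simp add: F)
    qed
    have "Inv ` X \<subseteq> Pow F" by (intro image_subsetI PowI InvF)
    then show "finite (Inv ` X)" by (rule finite_subset) (use fin in simp)
    show "inj_on Inv X" by (intro inj_onI Inv_inject Xc)
  qed
  have "g \<in> (\<lambda>(v, u). v \<otimes> u) ` (X \<times> ?H)" if g: "g \<in> generate W K" for g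
  proof -
    have gc: "g \<in> carrier W" using g generate_S_closed[OF KS(1)] by blast
    obtain u where u: "u \<in> ?H" "\<forall>t\<in>K - {s}. nonneg (act (g \<otimes> u) (simple_root t))"
      using parabolic_coset_rep[OF KS(2) gc] by blast
    have "u \<in> generate W K" using u parabolic_mono[of "K - {s}" K] by blast
    then have "g \<otimes> u \<in> X" using u g by (simp add: X_def generate.eng)
    moreover have "inv u \<in> ?H" using u parabolic_subgroup[OF KS(2)] subgroup.m_inv_closed by metis
    moreover have "g = g \<otimes> u \<otimes> inv u" using gc Hc[OF u(1)] by (simp add: m_assoc)
    ultimately show ?thesis by (intro image_eqI[of _ _ "(g \<otimes> u, inv u)"]) auto
  qed
  then have "generate W K \<subseteq> (\<lambda>(v, u). v \<otimes> u) ` (X \<times> ?H)" by blast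
  then show ?thesis using \<open>finite X\<close> \<open>finite ?H\<close> by (auto intro: finite_subset)
qed

text \<open>e^-1 maps the inversions of w e^-1 injectively to inversions of w that e does not
  invert. This is the measure for splitting off an edge.\<close>

lemma Inv_mult_inv:
  assumes w: "w \<in> carrier W" and e: "e \<in> carrier W" and sub: "Inv e \<subseteq> Inv w" and ne: "Inv e \<noteq> {}"
  shows "card (Inv (w \<otimes> inv e)) < card (Inv w)"
proof -
  have "act (inv e) \<beta> \<in> Inv w - Inv e" if b: "\<beta> \<in> Inv (w \<otimes> inv e)" for \<beta>
  proof -
    let ?g = "act (inv e) \<beta>"
    have \<beta>: "\<beta> \<in> \<Phi>" "nonneg \<beta>" "nonneg (opp (act w ?g))" using b w e by (auto simp: Inv_def act_mult)
    have g: "?g \<in> \<Phi>" "act w ?g \<in> \<Phi>" using \<beta> e w by auto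
    have eg: "act e ?g = \<beta>" using \<beta> e by simp
    have "nonneg ?g"
    proof (rule ccontr)
      assume "\<not> nonneg ?g"
      then have "nonneg (opp ?g)" using root_cases[OF g(1)] by blast
      then have "opp ?g \<in> Inv e" using g eg \<beta> e by (simp add: Inv_def act_opp)
      then have "nonneg (opp (act w (opp ?g)))" using sub by (auto simp: Inv_def)
      then have "nonneg (act w ?g)" using g w by (simp add: act_opp)
      then show False using \<beta>(3) root_not_both[OF g(2)] by simp
    qed
    moreover have "?g \<notin> Inv e" using eg \<beta> root_not_both[OF \<beta>(1)] by (simp add: Inv_def)
    ultimately show ?thesis using g \<beta> by (simp add: Inv_def)
  qed
  then have im: "act (inv e) ` Inv (w \<otimes> inv e) \<subseteq> Inv w - Inv e" by blast
  have inj: "inj_on (act (inv e)) (Inv (w \<otimes> inv e))"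
    by (rule inj_on_inverseI[where g = "act e"]) (use e in \<open>auto simp: Inv_def\<close>)
  have fin: "finite (Inv w)" using w by (rule finite_Inv)
  have "card (Inv (w \<otimes> inv e)) \<le> card (Inv w - Inv e)"
    by (rule card_inj_on_le[OF inj im]) (use fin in simp)
  also have "\<dots> < card (Inv w)" using fin sub ne by (intro psubset_card_mono) auto
  finally show ?thesis .
qed

section \<open>The groupoids \<open>C\<close> and \<open>Y\<close>\<close>

lemma inj_maps_mem: "\<lbrakk>x \<in> inj_maps \<Lambda> S; l \<in> \<Lambda>\<rbrakk> \<Longrightarrow> x l \<in> S"
  by (auto simp: inj_maps_def)

lemma inj_maps_sub: "x \<in> inj_maps \<Lambda> S \<Longrightarrow> x ` \<Lambda> \<subseteq> S"
  by (auto simp: inj_maps_def)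

lemma C_hom_closed: "w \<in> C_hom W S \<Lambda> x y \<Longrightarrow> w \<in> carrier W"
  by (simp add: C_hom_def)

lemma C_hom_act: "\<lbrakk>w \<in> C_hom W S \<Lambda> x y; l \<in> \<Lambda>\<rbrakk> \<Longrightarrow> act w (simple_root (y l)) = simple_root (x l)"
  by (simp add: C_hom_def)

lemma C_hom_one: "x \<in> inj_maps \<Lambda> S \<Longrightarrow> \<one> \<in> C_hom W S \<Lambda> x x"
  by (simp add: C_hom_def inj_maps_mem)

lemma C_hom_mult:
  "\<lbrakk>x \<in> inj_maps \<Lambda> S; g \<in> C_hom W S \<Lambda> z y; h \<in> C_hom W S \<Lambda> y x\<rbrakk> \<Longrightarrow> g \<otimes> h \<in> C_hom W S \<Lambda> z x"
  by (simp add: C_hom_def inj_maps_mem act_mult)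

lemma C_hom_inv:
  assumes "x \<in> inj_maps \<Lambda> S" "g \<in> C_hom W S \<Lambda> y x" shows "inv g \<in> C_hom W S \<Lambda> x y"
proof -
  have "act (inv g) (simple_root (y l)) = simple_root (x l)" if l: "l \<in> \<Lambda>" for l
    using act_inv1[OF C_hom_closed[OF assms(2)] simple_root_V[OF inj_maps_mem[OF assms(1) l]]]
      C_hom_act[OF assms(2) l] by simp
  then show ?thesis using assms(2) by (simp add: C_hom_def)
qed

lemma C_hom_unique:
  assumes "y \<in> inj_maps \<Lambda> S" "y' \<in> inj_maps \<Lambda> S" "w \<in> C_hom W S \<Lambda> y x" "w \<in> C_hom W S \<Lambda> y' x"
  shows "y = y'"
proof (rule PiE_ext[of _ \<Lambda> "\<lambda>_. S"])
  fix l assume "l \<in> \<Lambda>"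
  then have "simple_root (y l) = simple_root (y' l)" using assms(3,4) by (simp add: C_hom_def)
  then show "y l = y' l" by (simp add: simple_root_inj)
qed (use assms in \<open>auto simp: inj_maps_def\<close>)

lemma map_act_eq:
  "\<lbrakk>y \<in> inj_maps \<Lambda> S; w \<in> C_hom W S \<Lambda> y x\<rbrakk> \<Longrightarrow> map_act W S \<Lambda> w x = y"
  unfolding map_act_def by (rule the_equality) (use C_hom_unique in auto)

lemma C_hom_exists:
  assumes w: "w \<in> carrier W" and x: "x \<in> inj_maps \<Lambda> S" and A: "A \<subseteq> S"
    and im: "act w ` simple_root ` x ` \<Lambda> = simple_root ` A"
  shows "\<exists>y\<in>inj_maps \<Lambda> S. w \<in> C_hom W S \<Lambda> y x \<and> y ` \<Lambda> = A"
proof -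
  have "\<forall>l\<in>\<Lambda>. \<exists>k. k \<in> A \<and> act w (simple_root (x l)) = simple_root k"
  proof
    fix l assume "l \<in> \<Lambda>"
    then have "act w (simple_root (x l)) \<in> act w ` simple_root ` x ` \<Lambda>" by blast
    then show "\<exists>k. k \<in> A \<and> act w (simple_root (x l)) = simple_root k" unfolding im by blast
  qed
  then obtain f where f: "\<forall>l\<in>\<Lambda>. f l \<in> A \<and> act w (simple_root (x l)) = simple_root (f l)"
    by (rule bchoice[THEN exE])
  let ?y = "restrict f \<Lambda>"
  have "inj_on ?y \<Lambda>"
  proof (rule inj_onI)
    fix l m assume lm: "l \<in> \<Lambda>" "m \<in> \<Lambda>" "?y l = ?y m"
    then have "act w (simple_root (x l)) = act w (simple_root (x m))" using f by simp
    then have "simple_root (x l) = simple_root (x m)"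
      using w lm x inj_maps_mem act_inv1 by (metis simple_root_V)
    then show "l = m" using lm x by (auto simp: simple_root_inj inj_maps_def dest: inj_onD)
  qed
  then have "?y \<in> inj_maps \<Lambda> S" using f A by (auto simp: inj_maps_def)
  moreover have "w \<in> C_hom W S \<Lambda> ?y x" using f w by (simp add: C_hom_def)
  moreover have "?y ` \<Lambda> = A"
  proof (intro equalityI subsetI)
    fix k assume "k \<in> A"
    then obtain l where l: "l \<in> \<Lambda>" "simple_root k = act w (simple_root (x l))" using im by (auto simp: set_eq_iff image_iff)
    then have "k = f l" using f by (simp add: simple_root_inj)
    then show "k \<in> ?y ` \<Lambda>" using l by auto
  qed (use f in auto)
  ultimately show ?thesis by blast
qed

lemma C_hom_verts:
  "\<lbrakk>x \<in> C_verts W S \<Lambda> xI; xI \<in> inj_maps \<Lambda> S; w \<in> C_hom W S \<Lambda> y x; y \<in> inj_maps \<Lambda> S\<rbrakk>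
    \<Longrightarrow> y \<in> C_verts W S \<Lambda> xI"
  unfolding C_verts_def using C_hom_mult by blast

lemma C_verts_inj: "x \<in> C_verts W S \<Lambda> xI \<Longrightarrow> x \<in> inj_maps \<Lambda> S"
  by (simp add: C_verts_def)

lemma C_verts_hom:
  assumes "x \<in> C_verts W S \<Lambda> xI" "y \<in> C_verts W S \<Lambda> xI" "xI \<in> inj_maps \<Lambda> S"
  shows "\<exists>w. w \<in> C_hom W S \<Lambda> x y"
proof -
  obtain g h where "g \<in> C_hom W S \<Lambda> x xI" "h \<in> C_hom W S \<Lambda> y xI" using assms by (auto simp: C_verts_def)
  then show ?thesis using C_hom_mult[OF C_verts_inj[OF assms(2)]] C_hom_inv[OF assms(3)] by blast
qed

lemma C_hom_image:
  assumes "w \<in> C_hom W S \<Lambda> x y"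
  shows "\<And>t. t \<in> y ` \<Lambda> \<Longrightarrow> \<exists>k\<in>x ` \<Lambda>. act w (simple_root t) = simple_root k"
    "\<And>k. k \<in> x ` \<Lambda> \<Longrightarrow> \<exists>t\<in>y ` \<Lambda>. act w (simple_root t) = simple_root k"
  using C_hom_act[OF assms] by auto

lemma Y_hom_iff: "w \<in> Y_hom W S \<Lambda> x y \<longleftrightarrow> w \<in> C_hom W S \<Lambda> x y \<and>
    (\<forall>\<gamma>\<in>perp_roots W S (y ` \<Lambda>). nonneg \<gamma> \<longrightarrow> nonneg (act w \<gamma>))"
  by (auto simp: Y_hom_def positive_part_eq C_hom_closed perp_root)

lemma Y_hom_one: "x \<in> inj_maps \<Lambda> S \<Longrightarrow> \<one> \<in> Y_hom W S \<Lambda> x x"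
  by (simp add: Y_hom_iff C_hom_one perp_root)

lemma Y_hom_mult:
  assumes x: "x \<in> inj_maps \<Lambda> S" "y \<in> inj_maps \<Lambda> S"
    and g: "g \<in> Y_hom W S \<Lambda> z y" and h: "h \<in> Y_hom W S \<Lambda> y x"
  shows "g \<otimes> h \<in> Y_hom W S \<Lambda> z x"
proof -
  have gh: "g \<in> C_hom W S \<Lambda> z y" "h \<in> C_hom W S \<Lambda> y x" using g h by (auto simp: Y_hom_iff)
  note c = C_hom_closed[OF gh(1)] C_hom_closed[OF gh(2)]
  have "nonneg (act (g \<otimes> h) \<gamma>)" if \<gamma>: "\<gamma> \<in> perp_roots W S (x ` \<Lambda>)" "nonneg \<gamma>" for \<gamma>
  proof -
    have "act h \<gamma> \<in> perp_roots W S (y ` \<Lambda>)"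
      by (rule act_perp[OF inj_maps_sub[OF x(1)] inj_maps_sub[OF x(2)] c(2) \<gamma>(1) C_hom_image(2)[OF gh(2)]])
    moreover have "nonneg (act h \<gamma>)" using h \<gamma> by (simp add: Y_hom_iff)
    ultimately have "nonneg (act g (act h \<gamma>))" using g by (simp add: Y_hom_iff)
    then show ?thesis using c perp_root[OF \<gamma>(1)] by (simp add: act_mult)
  qed
  then show ?thesis using C_hom_mult[OF x(1) gh] by (simp add: Y_hom_iff)
qed

abbreviation elt where "elt \<equiv> edge_elt W S"

text \<open>t is the partner of s under -w_0(K): it leaves the vertex while s enters, and together
  with y it names the same edge in the opposite orientation.\<close>

lemma edge_exists:
  assumes x: "x \<in> inj_maps \<Lambda> S" and s: "s \<in> S - x ` \<Lambda>" and fin: "finite (generate W (khull (x ` \<Lambda>) {s}))"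
  obtains y t where "y \<in> inj_maps \<Lambda> S" "elt \<Lambda> (x, s) \<in> C_hom W S \<Lambda> y x" "t \<in> S - y ` \<Lambda>"
    "insert t (y ` \<Lambda>) = insert s (x ` \<Lambda>)" "t \<in> khull (x ` \<Lambda>) {s}" "elt \<Lambda> (y, t) = inv (elt \<Lambda> (x, s))"
proof -
  let ?J = "x ` \<Lambda>"
  let ?K = "khull ?J {s}"
  have J: "?J \<subseteq> S" using x by (rule inj_maps_sub)
  note ctx = J s fin
  obtain t where t: "t \<in> ?K" "act (longest W S ?K) (simple_root s) = opp (simple_root t)"
    using longest_simple[OF hull_subset_S(1)[OF ctx] fin base_in_hull(1)[OF ctx]] by blast
  let ?e = "wxs ?J s"
  have e: "elt \<Lambda> (x, s) = ?e" by (simp add: Let_def)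
  have tJ: "t \<in> insert s ?J" using t(1) hull_sub[of ?J s] by blast
  have A: "insert s ?J - {t} \<subseteq> S" using J s by auto
  from C_hom_exists[OF wxs_closed[OF ctx] x A wxs_image[OF ctx t]]
  obtain y where y: "y \<in> inj_maps \<Lambda> S" "?e \<in> C_hom W S \<Lambda> y x" "y ` \<Lambda> = insert s ?J - {t}"
    by (elim bexE conjE)
  have ins: "insert t (y ` \<Lambda>) = insert s ?J" using y(3) tJ by auto
  have hull: "khull (y ` \<Lambda>) {t} = ?K"
    using hull_swap[of s ?J t "y ` \<Lambda>"] t(1) ins J s by auto
  have "elt \<Lambda> (y, t) = inv ?e"
    using wxs_inverse[OF ctx t] hull by (simp add: Let_def)
  then show ?thesis using that[of y t] y ins tJ t(1) J s e by auto
qed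

lemma edge_data:
  assumes x: "x \<in> inj_maps \<Lambda> S" and y: "y \<in> inj_maps \<Lambda> S" "elt \<Lambda> (x, s) \<in> C_hom W S \<Lambda> y x"
    "t \<in> S - y ` \<Lambda>" "insert t (y ` \<Lambda>) = insert s (x ` \<Lambda>)"
  shows "edge_target W S \<Lambda> (x, s) = y" "edge_inv W S \<Lambda> (x, s) = (y, t)"
proof -
  show tg: "edge_target W S \<Lambda> (x, s) = y"
    unfolding edge_target_def fst_conv by (rule map_act_eq[OF y(1,2)])
  have "{t} = x ` \<Lambda> \<union> {s} - y ` \<Lambda>" using y(3,4) by auto
  then have "(THE t. {t} = x ` \<Lambda> \<union> {s} - y ` \<Lambda>) = t" by (metis (mono_tags) the_equality singleton_inject)
  then show "edge_inv W S \<Lambda> (x, s) = (y, t)" by (simp add: edge_inv_def tg Let_def)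
qed

lemma edge_properties:
  assumes x: "x \<in> inj_maps \<Lambda> S" and s: "s \<in> S - x ` \<Lambda>" and fin: "finite (generate W (khull (x ` \<Lambda>) {s}))"
  obtains y t where "y \<in> inj_maps \<Lambda> S" "edge_target W S \<Lambda> (x, s) = y" "edge_inv W S \<Lambda> (x, s) = (y, t)"
    "elt \<Lambda> (x, s) \<in> C_hom W S \<Lambda> y x" "t \<in> S - y ` \<Lambda>" "khull (y ` \<Lambda>) {t} = khull (x ` \<Lambda>) {s}"
    "elt \<Lambda> (y, t) = inv (elt \<Lambda> (x, s))" "edge_target W S \<Lambda> (y, t) = x" "edge_inv W S \<Lambda> (y, t) = (x, s)"
proof -
  obtain y t where y: "y \<in> inj_maps \<Lambda> S" "elt \<Lambda> (x, s) \<in> C_hom W S \<Lambda> y x" "t \<in> S - y ` \<Lambda>"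
    "insert t (y ` \<Lambda>) = insert s (x ` \<Lambda>)" "t \<in> khull (x ` \<Lambda>) {s}" "elt \<Lambda> (y, t) = inv (elt \<Lambda> (x, s))"
    using edge_exists[OF assms] .
  have "insert s (x ` \<Lambda>) \<subseteq> S" using s inj_maps_sub[OF x] by auto
  from hull_swap[OF this y(5,4)] have hull: "khull (y ` \<Lambda>) {t} = khull (x ` \<Lambda>) {s}" .
  have i: "elt \<Lambda> (y, t) \<in> C_hom W S \<Lambda> x y" unfolding y(6) by (rule C_hom_inv[OF x y(2)])
  show ?thesis
    by (rule that[OF y(1) edge_data[OF x y(1-4)] y(2,3) hull y(6) edge_data[OF y(1) x i s y(4)[symmetric]]])
qed

lemma edge_Y_hom:
  assumes x: "x \<in> inj_maps \<Lambda> S" and s: "s \<in> S - x ` \<Lambda>" and fin: "finite (generate W (khull (x ` \<Lambda>) {s}))"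
    and y: "y \<in> inj_maps \<Lambda> S" "elt \<Lambda> (x, s) \<in> C_hom W S \<Lambda> y x" "x \<noteq> y"
  shows "elt \<Lambda> (x, s) \<in> Y_hom W S \<Lambda> y x"
proof -
  let ?J = "x ` \<Lambda>"
  let ?e = "wxs ?J s"
  note ctx = inj_maps_sub[OF x] s fin
  have e: "elt \<Lambda> (x, s) = ?e" by (simp add: Let_def)
  have "nonneg (act ?e \<gamma>)" if \<gamma>: "\<gamma> \<in> perp_roots W S ?J" "nonneg \<gamma>" for \<gamma>
  proof (rule ccontr)
    assume "\<not> nonneg (act ?e \<gamma>)"
    then have "act ?e (simple_root (x l)) = simple_root (x l)" if "l \<in> \<Lambda>" for l
      using wxs_fixes[OF ctx \<gamma>] that by blast
    then have "elt \<Lambda> (x, s) \<in> C_hom W S \<Lambda> x x" unfolding e using wxs_closed[OF ctx] by (simp add: C_hom_def)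
    then show False using C_hom_unique[OF x y(1)] y(2,3) by blast
  qed
  then show ?thesis using y(2) unfolding e by (simp add: Y_hom_iff)
qed

text \<open>A descent s of w lies outside [y], since w sends simple roots of [y] to simple roots.
  With F the positive roots supported in the component and involving s, the inclusions of Inv e in F
  and of F in Inv w feed \<open>Inv_mult_inv\<close>.\<close>

lemma C_hom_edge:
  assumes x: "x \<in> inj_maps \<Lambda> S" and y: "y \<in> inj_maps \<Lambda> S" and w: "w \<in> C_hom W S \<Lambda> x y" "w \<noteq> \<one>"
  shows "\<exists>s\<in>S - y ` \<Lambda>. finite (generate W (khull (y ` \<Lambda>) {s})) \<and>
    card (Inv (w \<otimes> inv (elt \<Lambda> (y, s)))) < card (Inv w)"
proof -
  let ?J = "y ` \<Lambda>"
  have J: "?J \<subseteq> S" using y by (rule inj_maps_sub)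
  have wc: "w \<in> carrier W" using w C_hom_closed by blast
  obtain s where s: "s \<in> S" "nonneg (opp (act w (simple_root s)))" using descent_exists[OF wc w(2)] by blast
  have "s \<notin> ?J"
  proof
    assume "s \<in> ?J"
    then obtain k where k: "k \<in> x ` \<Lambda>" "act w (simple_root s) = simple_root k" using C_hom_image(1)[OF w(1)] by blast
    then have "k \<in> S" using inj_maps_sub[OF x] by auto
    then show False using s k root_not_both[of "simple_root k"] by simp
  qed
  then have sJ: "s \<in> S - ?J" using s by simp
  let ?K = "khull ?J {s}"
  define F where "F = {\<beta> \<in> \<Phi>. nonneg \<beta> \<and> (\<forall>r. r \<notin> ?K \<longrightarrow> \<beta> r = 0) \<and> 0 < \<beta> s}"
  have Fw: "F \<subseteq> Inv w"
  proof
    fix \<beta> assume "\<beta> \<in> F"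
    then have \<beta>: "\<beta> \<in> \<Phi>" "nonneg \<beta>" "\<And>r. r \<notin> insert s ?J \<Longrightarrow> \<beta> r = 0" "0 < \<beta> s"
      using hull_sub[of ?J s] by (auto simp: F_def)
    have "nonneg (opp (act w \<beta>))"
      using inverts_component[OF J wc C_hom_image[OF w(1)] sJ s(2) \<beta>] .
    then show "\<beta> \<in> Inv w" using \<beta> by (simp add: Inv_def)
  qed
  then have "finite F" using finite_Inv[OF wc] finite_subset by blast
  then have fin: "finite (generate W ?K)" using component_finite[OF J sJ refl] F_def by blast
  note ctx = J sJ fin
  let ?e = "wxs ?J s"
  have ec: "?e \<in> carrier W" using wxs_closed[OF ctx] .
  have "Inv ?e \<subseteq> F"
  proof
    fix \<beta> assume "\<beta> \<in> Inv ?e"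
    then have \<beta>: "\<beta> \<in> \<Phi>" "nonneg \<beta>" "\<not> nonneg (act ?e \<beta>)"
      using root_not_both[of "act ?e \<beta>"] ec by (auto simp: Inv_def)
    then have "\<forall>r. r \<notin> ?K \<longrightarrow> \<beta> r = 0" "\<beta> s \<noteq> 0" using wxs_not_inverts[OF ctx \<beta>(1,2)] by blast+
    then show "\<beta> \<in> F" using \<beta> by (simp add: F_def nonneg_def less_le)
  qed
  moreover have "simple_root s \<in> Inv ?e"
  proof -
    have "nonneg (opp (act ?e (simple_root s)))"
      by (rule wxs_inverts[OF ctx]) (use s hull_base[of s ?J] in \<open>auto simp: simple_root_apply\<close>)
    then show ?thesis using s by (simp add: Inv_def)
  qed
  ultimately have "card (Inv (w \<otimes> inv ?e)) < card (Inv w)"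
    using Fw by (intro Inv_mult_inv[OF wc ec]) auto
  moreover have "elt \<Lambda> (y, s) = ?e" by (simp add: Let_def)
  ultimately show ?thesis using sJ fin by metis
qed

end

section \<open>Trees\<close>

text \<open>An undirected graph given by its oriented edges and their reversal. Stated for an
  arbitrary graph, so that it applies to both the ambient graph and the tree inside it.\<close>

locale inverse_digraph = wf_digraph G for G :: "('v, 'e) pre_digraph" +
  fixes einv :: "'e \<Rightarrow> 'e"
  assumes einv_arcs: "e \<in> arcs G \<Longrightarrow> einv e \<in> arcs G"
    and tail_einv: "e \<in> arcs G \<Longrightarrow> tail G (einv e) = head G e"
    and head_einv: "e \<in> arcs G \<Longrightarrow> head G (einv e) = tail G e"
    and einv_einv: "e \<in> arcs G \<Longrightarrow> einv (einv e) = e"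
begin

lemma non_backtracking_rev:
  assumes "set p \<subseteq> arcs G"
  shows "non_backtracking einv (rev p) \<longleftrightarrow> non_backtracking einv p"
proof -
  have "successively (\<lambda>x y. y \<noteq> einv x) p \<longleftrightarrow> successively (\<lambda>x y. x \<noteq> einv y) p"
    by (rule successively_cong) (use assms einv_einv in auto)
  then show ?thesis by (simp add: non_backtracking_def)
qed

lemma non_backtracking_map_einv:
  assumes "set p \<subseteq> arcs G"
  shows "non_backtracking einv (map einv p) \<longleftrightarrow> non_backtracking einv p"
proof -
  have "successively (\<lambda>x y. einv x \<noteq> einv (einv y)) p \<longleftrightarrow> successively (\<lambda>x y. x \<noteq> einv y) p"
    by (rule successively_cong) (use assms einv_einv einv_arcs in \<open>metis subsetD\<close>)+
  then show ?thesis by (simp add: non_backtracking_def successively_map)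
qed

lemma awalk_reverse:
  assumes "awalk u p v" shows "awalk v (rev (map einv p)) u"
  using assms
proof (induction p arbitrary: u)
  case Nil
  then show ?case by (auto simp: awalk_Nil_iff)
next
  case (Cons e p)
  then have e: "e \<in> arcs G" "tail G e = u" "awalk (head G e) p v" by (auto simp: awalk_Cons_iff)
  have "awalk (head G e) [einv e] u"
    using e by (auto simp: awalk_Cons_iff awalk_Nil_iff einv_arcs tail_einv head_einv)
  then show ?case using Cons.IH[OF e(3)] by simp
qed

text \<open>Going back along an arc would revisit the vertex just left.\<close>

lemma apath_non_backtracking:
  assumes "awalk u p v" "distinct (awalk_verts u p)" shows "non_backtracking einv p"
  using assms
proof (induction p arbitrary: u)
  case Nil
  then show ?case by (simp add: non_backtracking_def)
next
  case (Cons e p)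
  then have e: "e \<in> arcs G" "tail G e = u" "awalk (head G e) p v" by (auto simp: awalk_Cons_iff)
  have IH: "non_backtracking einv p" using Cons.IH[OF e(3)] Cons.prems(2) by simp
  show ?case
  proof (cases p)
    case Nil
    then show ?thesis by (simp add: non_backtracking_def)
  next
    case (Cons f q)
    then have f: "f \<in> arcs G" "tail G f = head G e" "awalk (head G f) q v" using e by (auto simp: awalk_Cons_iff)
    have "head G f \<in> set (awalk_verts (head G f) q)" using f(3) by (cases q) (auto simp: awalk_Cons_iff)
    then have "head G f \<noteq> u" using Cons.prems(2) Cons e by auto
    then have "e \<noteq> einv f" using f e tail_einv by auto
    then show ?thesis using IH Cons by (simp add: non_backtracking_def)
  qed
qed

text \<open>A repeated inner vertex cuts out a shorter closed walk. The backtracking condition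
  concerns consecutive arcs only, not the pair at the closing point, so subwalks inherit it.\<close>

lemma closed_walk_cycle:
  assumes "awalk u p u" "non_backtracking einv p" "p \<noteq> []"
  shows "\<exists>c. cycle c \<and> non_backtracking einv c"
  using assms
proof (induction "length p" arbitrary: u p rule: less_induct)
  case less
  show ?case
  proof (cases "distinct (tl (awalk_verts u p))")
    case True
    then show ?thesis using less.prems by (auto simp: cycle_def)
  next
    case False
    obtain e q where p: "p = e # q" using less.prems by (cases p) auto
    then have e: "awalk (head G e) q u" using less.prems by (auto simp: awalk_Cons_iff)
    have "\<not> distinct (awalk_verts (head G e) q)" using False p by simp
    from awalk_not_distinct_decomp[OF e this]
    obtain r c t w where d: "q = r @ c @ t" "0 < length c" "awalk w c w" by blast
    have "non_backtracking einv c"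
      using less.prems(2) unfolding p d(1) by (auto simp: non_backtracking_def successively_append_iff successively_Cons)
    moreover have "length c < length p" using p d by simp
    ultimately show ?thesis using less.hyps[of c w] d by auto
  qed
qed

text \<open>Equal last arcs are stripped. If the last arcs differ, p followed by the reverse of q is
  a nonempty closed walk without backtracking.\<close>

lemma tree_walk_unique:
  assumes acyclic: "\<nexists>c. cycle c \<and> non_backtracking einv c"
    and "awalk u p v" "awalk u q v" "non_backtracking einv p" "non_backtracking einv q"
  shows "p = q"
  using assms(2-)
proof (induction p arbitrary: q v rule: rev_induct)
  case Nil
  then have "u = v" by (simp add: awalk_Nil_iff)
  then show ?case using closed_walk_cycle[of u q] acyclic Nil by auto
next
  case (snoc x p)
  show ?case
  proof (cases q rule: rev_exhaust)
    case Nil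
    then have "u = v" using snoc by (simp add: awalk_Nil_iff)
    then show ?thesis using closed_walk_cycle[of u "p @ [x]"] acyclic snoc.prems by auto
  next
    case (snoc q' y)
    have p: "awalk u p (tail G x)" "x \<in> arcs G" "head G x = v" "set p \<subseteq> arcs G"
      using snoc.prems(1) by (auto simp: awalk_Cons_iff awalk_Nil_iff)
    have q: "awalk u q' (tail G y)" "y \<in> arcs G" "head G y = v" "set q' \<subseteq> arcs G"
      using snoc.prems(2) snoc by (auto simp: awalk_Cons_iff awalk_Nil_iff)
    show ?thesis
    proof (cases "x = y")
      case True
      have "p = q'"
        using snoc.prems(3,4) snoc q(1) p(1) True by (intro snoc.IH) (auto simp: non_backtracking_def successively_append_iff)
      then show ?thesis using snoc True by simp
    next
      case False
      let ?c = "(p @ [x]) @ rev (map einv q)"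
      have "awalk u ?c u" using snoc.prems(1) awalk_reverse[OF snoc.prems(2)] by (rule awalk_appendI)
      moreover have "non_backtracking einv ?c"
      proof -
        have qs: "set q \<subseteq> arcs G" "set (map einv q) \<subseteq> arcs G" using q snoc einv_arcs by auto
        then have "non_backtracking einv (rev (map einv q))"
          using snoc.prems(4) by (simp add: non_backtracking_rev non_backtracking_map_einv)
        moreover have "x \<noteq> einv (einv y)" using False q einv_einv by simp
        ultimately show ?thesis using snoc.prems(3) snoc
          unfolding non_backtracking_def successively_append_iff[of _ "p @ [x]"] by simp
      qed
      ultimately show ?thesis using closed_walk_cycle acyclic by blast
    qed
  qed
qed

lemma is_tree_path_exists:
  assumes "strongly_connected G" "y \<in> verts G" "z \<in> verts G"
  shows "\<exists>p. is_path G z p y \<and> non_backtracking einv p"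
proof -
  have "y \<rightarrow>\<^sup>*\<^bsub>G\<^esub> z" using assms by (simp add: strongly_connected_def)
  then obtain p where p: "apath y p z" using reachable_apath by blast
  then have p': "awalk y p z" "distinct (awalk_verts y p)" by (auto simp: apath_def)
  then have "set p \<subseteq> arcs G" by (auto simp: awalk_def)
  then have "non_backtracking einv (rev p)"
    using apath_non_backtracking[OF p'] non_backtracking_rev by simp
  then show ?thesis using p'(1) by (intro exI[of _ "rev p"]) (simp add: is_path_def)
qed

lemma is_tree_path_unique:
  assumes "is_tree einv G" "is_path G z p y" "non_backtracking einv p" "is_path G z q y" "non_backtracking einv q"
  shows "p = q"
proof -
  have "set p \<subseteq> arcs G" "set q \<subseteq> arcs G" using assms(2,4) by (auto simp: is_path_def awalk_def)
  then have "rev p = rev q"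
    using assms by (intro tree_walk_unique[of y "rev p" z "rev q"])
      (auto simp: is_tree_def is_path_def non_backtracking_rev)
  then show ?thesis by simp
qed

lemma tree_path_props:
  assumes "is_tree einv G" "y \<in> verts G" "z \<in> verts G"
  shows "is_path G z (tree_path einv G z y) y" "non_backtracking einv (tree_path einv G z y)"
proof -
  have "\<exists>!p. is_path G z p y \<and> non_backtracking einv p"
    using is_tree_path_exists[of y z] is_tree_path_unique[OF assms(1)] assms by (auto simp: is_tree_def)
  then have "is_path G z (tree_path einv G z y) y \<and> non_backtracking einv (tree_path einv G z y)"
    unfolding tree_path_def by (rule theI')
  then show "is_path G z (tree_path einv G z y) y" "non_backtracking einv (tree_path einv G z y)" by auto
qed

lemma tree_path_reverse:
  assumes "is_tree einv G" "y \<in> verts G" "z \<in> verts G"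
  shows "tree_path einv G y z = rev (map einv (tree_path einv G z y))"
proof -
  let ?p = "tree_path einv G z y"
  have p: "is_path G z ?p y" "non_backtracking einv ?p" using tree_path_props[OF assms] by auto
  then have s: "set ?p \<subseteq> arcs G" by (auto simp: is_path_def awalk_def)
  have "is_path G y (rev (map einv ?p)) z"
    using awalk_reverse[of y "rev ?p" z] p by (simp add: is_path_def rev_map)
  moreover have "non_backtracking einv (rev (map einv ?p))"
    using p s einv_arcs by (subst non_backtracking_rev) (auto simp: non_backtracking_map_einv)
  ultimately show ?thesis
    using is_tree_path_unique[OF assms(1)] tree_path_props[OF assms(1,3,2)] by blast
qed

text \<open>The new vertex is a leaf: e is the only arc into it and its reverse the only arc out. A
  cycle using either would have to backtrack, and any other cycle already lies in T.\<close>

lemma add_leaf_tree: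
  assumes T: "subgraph T G" "is_tree einv T" and e: "e \<in> arcs G" "tail G e \<in> verts T" "head G e \<notin> verts T"
  defines "T' \<equiv> \<lparr>verts = insert (head G e) (verts T), arcs = insert e (insert (einv e) (arcs T)), tail = tail G, head = head G\<rparr>"
  shows "subgraph T' G" "subgraph T T'" "is_tree einv T'"
proof -
  let ?v = "head G e" and ?u = "tail G e"
  have T'simps: "verts T' = insert ?v (verts T)" "arcs T' = insert e (insert (einv e) (arcs T))"
    "tail T' = tail G" "head T' = head G" by (auto simp: T'_def)
  have ie: "einv e \<in> arcs G" "tail G (einv e) = ?v" "head G (einv e) = ?u"
    using e einv_arcs tail_einv head_einv by auto
  have Tt: "tail T = tail G" "head T = head G" "verts T \<subseteq> verts G" "arcs T \<subseteq> arcs G" "wf_digraph T"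
    using T(1) by (auto simp: subgraph_def compatible_def)
  interpret T: wf_digraph T by fact
  have Te: "tail G f \<in> verts T" "head G f \<in> verts T" if "f \<in> arcs T" for f
    using T.tail_in_verts[OF that] T.head_in_verts[OF that] Tt by auto
  interpret T': wf_digraph T'
    by unfold_locales (use T'simps ie e Te in auto)
  show sub: "subgraph T' G"
    using Tt e ie T'.wf_digraph wf_digraph_axioms by (auto simp: subgraph_def compatible_def T'simps)
  show sub': "subgraph T T'"
    using Tt T'.wf_digraph by (auto simp: subgraph_def compatible_def T'simps)
  have uv: "?u \<noteq> ?v" using e by auto
  have tail_v: "f = einv e" if "f \<in> arcs T'" "tail G f = ?v" for f
    using that T'simps Te(1)[of f] uv e by auto
  have head_v: "f = e" if "f \<in> arcs T'" "head G f = ?v" for f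
    using that T'simps Te(2)[of f] uv e ie by auto
  have "einv ` arcs T' \<subseteq> arcs T'"
    using T(2) einv_einv[OF e(1)] by (auto simp: T'simps is_tree_def)
  moreover have "strongly_connected T'"
    unfolding strongly_connected_def
  proof (intro conjI ballI)
    show "verts T' \<noteq> {}" by (simp add: T'simps)
    have old: "a \<rightarrow>\<^sup>*\<^bsub>T'\<^esub> b" if "a \<in> verts T" "b \<in> verts T" for a b
      using T(2) that T'.reachable_mono[OF _ sub'] by (auto simp: is_tree_def strongly_connected_def)
    have "T'.awalk ?u [e] ?v" "T'.awalk ?v [einv e] ?u"
      using e ie by (auto simp: T'.awalk_Cons_iff T'.awalk_Nil_iff T'simps)
    then have uv': "?u \<rightarrow>\<^sup>*\<^bsub>T'\<^esub> ?v" "?v \<rightarrow>\<^sup>*\<^bsub>T'\<^esub> ?u" using T'.reachable_awalkI by blast+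
    fix a b assume "a \<in> verts T'" "b \<in> verts T'"
    then have "a \<rightarrow>\<^sup>*\<^bsub>T'\<^esub> ?u" "?u \<rightarrow>\<^sup>*\<^bsub>T'\<^esub> b"
      using old e(2) uv' by (auto simp: T'simps)
    then show "a \<rightarrow>\<^sup>*\<^bsub>T'\<^esub> b" by (rule T'.reachable_trans)
  qed
  moreover have False if c: "T'.cycle p" and nb: "non_backtracking einv p" for p
  proof -
    obtain a where a: "T'.awalk a p a" "distinct (tl (T'.awalk_verts a p))" "p \<noteq> []"
      using c by (auto simp: T'.cycle_def)
    show False
    proof (cases "e \<in> set p")
      case True
      then obtain p1 p2 where p: "p = p1 @ e # p2" by (meson split_list)
      have w2: "T'.awalk ?v p2 a" using a(1) p by (simp add: T'.awalk_Cons_iff T'simps)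
      have "p2 = []"
      proof (rule ccontr)
        assume "p2 \<noteq> []"
        then obtain f p3 where f: "p2 = f # p3" by (cases p2) auto
        then have "f = einv e" using w2 tail_v[of f] by (simp add: T'.awalk_Cons_iff T'simps)
        then have "e \<noteq> einv (einv e)" using nb unfolding p f
          by (auto simp: non_backtracking_def successively_append_iff)
        then show False using einv_einv e by simp
      qed
      then have av: "a = ?v" using w2 by (auto simp: T'.awalk_Nil_iff)
      then have w1: "T'.awalk ?v p1 ?u" using a(1) p by (auto simp: T'.awalk_Cons_iff T'simps)
      then obtain f p3 where f: "p1 = f # p3" using uv by (cases p1) (auto simp: T'.awalk_Nil_iff)
      then have fe: "f = einv e" using w1 tail_v[of f] by (auto simp: T'.awalk_Cons_iff T'simps)
      have w3: "T'.awalk ?u p3 ?u" using w1 f fe ie by (auto simp: T'.awalk_Cons_iff T'simps)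
      \<comment> \<open>The cycle starts at the leaf and returns to it by e. Its vertices after the
        first are distinct, so the closed walk p3 at the tail of e is empty, and the cycle runs back
        and forth along one edge.\<close>
      have p_eq: "p = einv e # p3 @ [e]" using p f fe \<open>p2 = []\<close> by simp
      have "distinct (T'.awalk_verts ?u (p3 @ [e]))"
        using a(2) unfolding p_eq by (auto simp: T'simps ie)
      moreover have "T'.awalk ?u (p3 @ [e]) ?v" using a(1) av unfolding p_eq by (auto simp: T'.awalk_Cons_iff T'simps ie)
      ultimately have "T'.apath ?u (p3 @ [e]) ?v" by (simp add: T'.apath_def)
      then have "T'.apath ?u p3 ?u" using w3 by (auto simp: T'.apath_append_iff T'.awalk_ends_eqD)
      then have "p3 = []" using T'.apath_nonempty_ends by blast
      then show False using nb einv_einv[OF e(1)] unfolding p_eq by (simp add: non_backtracking_def)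
    next
      case False
      \<comment> \<open>Only e leads into the leaf. A walk avoiding e can leave the leaf only if it
        starts there, and being closed it would have to return through e.\<close>
      have "einv e \<notin> set p"
      proof
        assume "einv e \<in> set p"
        then obtain p1 p2 where p: "p = p1 @ einv e # p2" by (meson split_list)
        have w1: "T'.awalk a p1 ?v" and w2: "T'.awalk ?u p2 a"
          using a(1) p by (auto simp: T'.awalk_Cons_iff T'simps ie)
        have last: "q = []" if "T'.awalk b q ?v" "e \<notin> set q" for b q
        proof (cases q rule: rev_exhaust)
          case (snoc q' f)
          then have "f \<in> arcs T'" "head G f = ?v" using that(1) by (auto simp: T'.awalk_Cons_iff T'.awalk_Nil_iff T'simps)
          then show ?thesis using head_v[of f] snoc that(2) by auto
        qed simp
        have "p1 = []" using last[OF w1] False p by auto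
        then have "a = ?v" using w1 by (simp add: T'.awalk_Nil_iff)
        then have "p2 = []" using last w2 False p by auto
        then show False using w2 \<open>a = ?v\<close> uv by (simp add: T'.awalk_Nil_iff)
      qed
      then have s: "set p \<subseteq> arcs T" using False a(1) by (auto simp: T'.awalk_def T'simps)
      have "tail G (hd p) = a" "hd p \<in> arcs T" using a(1,3) s by (cases p; auto simp: T'.awalk_Cons_iff T'simps)+
      then have "a \<in> verts T" using Te by blast
      moreover have "pre_digraph.cas T u q v = T'.cas u q v" for u q v
        using compatible_cas[of T T'] Tt by (simp add: compatible_def T'simps)
      ultimately have "T.awalk a p a" using a(1) s by (auto simp: T.awalk_def T'.awalk_def)
      moreover have "T.awalk_verts a p = T'.awalk_verts a p"
        using compatible_awalk_verts[of T T'] Tt by (simp add: compatible_def T'simps)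
      ultimately have "T.cycle p" using a by (auto simp: T.cycle_def)
      then show False using T(2) nb by (auto simp: is_tree_def)
    qed
  qed
  ultimately show "is_tree einv T'" unfolding is_tree_def by blast
qed

text \<open>Connectedness enters as a cut condition, which hands over exactly the arc along which a
  leaf is attached; a larger tree contradicts maximality.\<close>

lemma maximal_tree_spanning:
  assumes T: "maximal_tree einv G T"
    and conn: "\<And>A. \<lbrakk>A \<subseteq> verts G; A \<noteq> {}; A \<noteq> verts G\<rbrakk> \<Longrightarrow> \<exists>e\<in>arcs G. tail G e \<in> A \<and> head G e \<notin> A"
  shows "verts T = verts G"
proof (rule ccontr)
  assume ne: "verts T \<noteq> verts G"
  have T': "subgraph T G" "is_tree einv T" "\<And>H. \<lbrakk>H \<noteq> T; subgraph T H; subgraph H G\<rbrakk> \<Longrightarrow> \<not> is_tree einv H"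
    using T by (auto simp: maximal_tree_def max_subgraph_def)
  have "verts T \<subseteq> verts G" "verts T \<noteq> {}" using T' by (auto simp: subgraph_def is_tree_def strongly_connected_def)
  then obtain e where e: "e \<in> arcs G" "tail G e \<in> verts T" "head G e \<notin> verts T" using conn ne by blast
  let ?H = "\<lparr>verts = insert (head G e) (verts T), arcs = insert e (insert (einv e) (arcs T)), tail = tail G, head = head G\<rparr>"
  have "head G e \<in> verts ?H" by simp
  then have "?H \<noteq> T" using e(3) by metis
  then show False using T'(3)[of ?H] add_leaf_tree[OF T'(1,2) e] by blast
qed

lemma subgraph_inverse_digraph:
  assumes "subgraph T G" "einv ` arcs T \<subseteq> arcs T"
  shows "inverse_digraph T einv"
proof -
  have Tt: "tail T = tail G" "head T = head G" "arcs T \<subseteq> arcs G" "wf_digraph T"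
    using assms(1) by (auto simp: subgraph_def compatible_def)
  interpret T: wf_digraph T by fact
  show ?thesis by unfold_locales (use assms(2) Tt tail_einv head_einv einv_einv in auto)
qed

end

section \<open>Bijections of the index set\<close>

lemma Bij_closed: "\<lbrakk>\<rho> \<in> Bij \<Lambda>; l \<in> \<Lambda>\<rbrakk> \<Longrightarrow> \<rho> l \<in> \<Lambda>"
  by (auto simp: Bij_def bij_betw_def)

lemma Bij_inv: "\<rho> \<in> Bij \<Lambda> \<Longrightarrow> inv\<^bsub>BijGroup \<Lambda>\<^esub> \<rho> \<in> Bij \<Lambda>"
  using group.inv_closed[OF group_BijGroup, of \<rho> \<Lambda>] by (simp add: BijGroup_def)

lemma Bij_inv_left: "\<lbrakk>\<rho> \<in> Bij \<Lambda>; l \<in> \<Lambda>\<rbrakk> \<Longrightarrow> (inv\<^bsub>BijGroup \<Lambda>\<^esub> \<rho>) (\<rho> l) = l"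
  using Bij_closed[of \<rho> \<Lambda> l] by (auto simp: inv_BijGroup Bij_def bij_betw_def)

lemma Bij_inv_right: "\<lbrakk>\<rho> \<in> Bij \<Lambda>; l \<in> \<Lambda>\<rbrakk> \<Longrightarrow> \<rho> ((inv\<^bsub>BijGroup \<Lambda>\<^esub> \<rho>) l) = l"
  by (auto simp: inv_BijGroup Bij_def bij_betw_def f_inv_into_f)

lemma perm_act_apply: "l \<in> \<Lambda> \<Longrightarrow> perm_act \<Lambda> \<rho> y l = y ((inv\<^bsub>BijGroup \<Lambda>\<^esub> \<rho>) l)"
  by (simp add: perm_act_def compose_def)

lemma perm_act_shift: "\<lbrakk>\<rho> \<in> Bij \<Lambda>; l \<in> \<Lambda>\<rbrakk> \<Longrightarrow> perm_act \<Lambda> \<rho> y (\<rho> l) = y l"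
  by (simp add: perm_act_apply Bij_closed Bij_inv_left)

lemma perm_act_image:
  assumes "\<rho> \<in> Bij \<Lambda>" shows "perm_act \<Lambda> \<rho> y ` \<Lambda> = y ` \<Lambda>"
proof (intro equalityI image_subsetI)
  fix l assume l: "l \<in> \<Lambda>"
  show "perm_act \<Lambda> \<rho> y l \<in> y ` \<Lambda>" using Bij_closed[OF Bij_inv[OF assms] l] l by (simp add: perm_act_apply)
  show "y l \<in> perm_act \<Lambda> \<rho> y ` \<Lambda>"
    using perm_act_shift[OF assms l, of y] Bij_closed[OF assms l] by (metis imageI)
qed

lemma perm_act_inj_maps:
  assumes "\<rho> \<in> Bij \<Lambda>" "y \<in> inj_maps \<Lambda> S" shows "perm_act \<Lambda> \<rho> y \<in> inj_maps \<Lambda> S"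
proof -
  have "inj_on (perm_act \<Lambda> \<rho> y) \<Lambda>"
  proof (rule inj_onI)
    fix l m assume lm: "l \<in> \<Lambda>" "m \<in> \<Lambda>" "perm_act \<Lambda> \<rho> y l = perm_act \<Lambda> \<rho> y m"
    have "(inv\<^bsub>BijGroup \<Lambda>\<^esub> \<rho>) l = (inv\<^bsub>BijGroup \<Lambda>\<^esub> \<rho>) m"
      using lm assms(2) Bij_closed[OF Bij_inv[OF assms(1)]] by (auto simp: perm_act_apply inj_maps_def dest: inj_onD)
    then show "l = m" using Bij_inv_right[OF assms(1)] lm by metis
  qed
  moreover have "perm_act \<Lambda> \<rho> y \<in> extensional \<Lambda>" by (simp add: perm_act_def)
  moreover have "perm_act \<Lambda> \<rho> y ` \<Lambda> \<subseteq> S" using assms perm_act_image[OF assms(1), of y] by (auto simp: inj_maps_def)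
  ultimately show ?thesis by (auto simp: inj_maps_def PiE_def)
qed

context coxeter
begin

text \<open>Reindexing by \<rho> removes the inverse permutation from the action; in this form
  composition of morphisms matches composition of permutations.\<close>

lemma C_hom_perm_iff:
  assumes "\<rho> \<in> Bij \<Lambda>"
  shows "w \<in> C_hom W S \<Lambda> x (perm_act \<Lambda> \<rho> y) \<longleftrightarrow>
    w \<in> carrier W \<and> (\<forall>l\<in>\<Lambda>. act w (simple_root (y l)) = simple_root (x (\<rho> l)))"
proof -
  have "(\<forall>l\<in>\<Lambda>. simple_root (x l) = act w (simple_root (perm_act \<Lambda> \<rho> y l))) \<longleftrightarrow>
    (\<forall>l\<in>\<Lambda>. act w (simple_root (y l)) = simple_root (x (\<rho> l)))" (is "?l \<longleftrightarrow> ?r")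
  proof
    assume ?l
    then show ?r using perm_act_shift[OF assms] Bij_closed[OF assms] by metis
  next
    assume r: ?r
    show ?l
    proof
      fix l assume l: "l \<in> \<Lambda>"
      let ?m = "(inv\<^bsub>BijGroup \<Lambda>\<^esub> \<rho>) l"
      have "act w (simple_root (y ?m)) = simple_root (x (\<rho> ?m))" using r Bij_closed[OF Bij_inv[OF assms] l] by blast
      then show "simple_root (x l) = act w (simple_root (perm_act \<Lambda> \<rho> y l))"
        using l by (simp add: perm_act_apply Bij_inv_right[OF assms])
    qed
  qed
  then show ?thesis by (simp add: C_hom_def)
qed

end

section \<open>The graph \<open>\<Y>\<^sup>1\<close> and its maximal tree\<close>

locale normalizer_groupoid = coxeter W S for W :: "('a, 'b) monoid_scheme" (structure) and S :: "'a set" +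
  fixes \<Lambda> :: "'l set" and xI :: "'l \<Rightarrow> 'a"
  assumes xI: "xI \<in> inj_maps \<Lambda> S"
begin

abbreviation I where "I \<equiv> xI ` \<Lambda>"
abbreviation hom where "hom \<equiv> C_hom W S \<Lambda>"
abbreviation Yhom where "Yhom \<equiv> Y_hom W S \<Lambda>"
abbreviation verts_C where "verts_C \<equiv> C_verts W S \<Lambda> xI"
abbreviation G where "G \<equiv> Y1_graph W S \<Lambda> xI"
abbreviation einv where "einv \<equiv> edge_inv W S \<Lambda>"
abbreviation N where "N \<equiv> NI W S I"
abbreviation A where "A \<equiv> AN W S \<Lambda> xI"
abbreviation prm where "prm \<equiv> perm_act \<Lambda>"

lemma I_S: "I \<subseteq> S"
  using inj_maps_sub[OF xI] .

lemma xI_verts: "xI \<in> verts_C"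
  using C_hom_one[OF xI] xI by (auto simp: C_verts_def)

lemma G_simps: "verts G = verts_C" "tail G = fst" "head G = edge_target W S \<Lambda>"
  "(x, s) \<in> arcs G \<longleftrightarrow> x \<in> verts_C \<and> s \<in> S - x ` \<Lambda> \<and>
    finite (generate W (khull (x ` \<Lambda>) {s})) \<and> edge_target W S \<Lambda> (x, s) \<noteq> x"
  by (auto simp: Y1_graph_def C_graph_def Let_def)

lemma arc_properties:
  assumes "(x, s) \<in> arcs G"
  obtains y t where "x \<in> verts_C" "y \<in> verts_C" "edge_target W S \<Lambda> (x, s) = y" "einv (x, s) = (y, t)"
    "elt \<Lambda> (x, s) \<in> Yhom y x" "(y, t) \<in> arcs G" "elt \<Lambda> (y, t) = inv (elt \<Lambda> (x, s))"
    "edge_target W S \<Lambda> (y, t) = x" "einv (y, t) = (x, s)"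
proof -
  have xs: "x \<in> verts_C" "x \<in> inj_maps \<Lambda> S" "s \<in> S - x ` \<Lambda>" "finite (generate W (khull (x ` \<Lambda>) {s}))"
    "edge_target W S \<Lambda> (x, s) \<noteq> x"
    using assms C_verts_inj by (auto simp: G_simps)
  obtain y t where y: "y \<in> inj_maps \<Lambda> S" "edge_target W S \<Lambda> (x, s) = y" "einv (x, s) = (y, t)"
    "elt \<Lambda> (x, s) \<in> hom y x" "t \<in> S - y ` \<Lambda>" "khull (y ` \<Lambda>) {t} = khull (x ` \<Lambda>) {s}"
    "elt \<Lambda> (y, t) = inv (elt \<Lambda> (x, s))" "edge_target W S \<Lambda> (y, t) = x" "einv (y, t) = (x, s)"
    using edge_properties[OF xs(2-4)] .
  have yv: "y \<in> verts_C" using C_hom_verts[OF xs(1) xI y(4,1)] .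
  have xy: "x \<noteq> y" using xs(5) y(2) by simp
  have "elt \<Lambda> (x, s) \<in> Yhom y x" using edge_Y_hom[OF xs(2-4) y(1,4) xy] .
  moreover have "(y, t) \<in> arcs G" using yv y(5,6,8) xs(4) xy by (simp add: G_simps)
  ultimately show ?thesis using that xs(1) yv y by blast
qed

lemma G_inverse_digraph: "inverse_digraph G einv"
proof
  fix e assume e: "e \<in> arcs G"
  obtain x s where xs: "e = (x, s)" by fastforce
  show "tail G e \<in> verts G" "head G e \<in> verts G" "einv e \<in> arcs G" "tail G (einv e) = head G e"
    "head G (einv e) = tail G e" "einv (einv e) = e"
    using arc_properties[OF e[unfolded xs]] unfolding xs G_simps(1-3) by (metis fst_conv)+
qed

sublocale G: inverse_digraph G einv
  by (rule G_inverse_digraph)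

text \<open>Edges are split off w until one leaves U. A loop keeps the vertex in U while the
  inversion count still drops, so deleting loops does no harm to connectedness.\<close>

lemma G_cut_arc:
  assumes w: "w \<in> hom x y" and x: "x \<in> verts_C" "x \<notin> U" and y: "y \<in> verts_C" "y \<in> U"
  shows "\<exists>e\<in>arcs G. tail G e \<in> U \<and> head G e \<notin> U"
  using w y
proof (induction "card (Inv w)" arbitrary: w y rule: less_induct)
  case less
  note inj = C_verts_inj[OF x(1)] C_verts_inj[OF less.prems(2)]
  have "w \<noteq> \<one>"
  proof
    assume "w = \<one>"
    then have "x = y" using C_hom_unique[OF inj] less.prems(1) C_hom_one[OF inj(2)] by blast
    then show False using x less.prems by simp
  qed
  then obtain s where s: "s \<in> S - y ` \<Lambda>" "finite (generate W (khull (y ` \<Lambda>) {s}))"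
    "card (Inv (w \<otimes> inv (elt \<Lambda> (y, s)))) < card (Inv w)"
    using C_hom_edge[OF inj less.prems(1)] by blast
  obtain z where z: "z \<in> inj_maps \<Lambda> S" "edge_target W S \<Lambda> (y, s) = z" "elt \<Lambda> (y, s) \<in> hom z y"
    using edge_properties[OF inj(2) s(1,2)] by metis
  have zv: "z \<in> verts_C" using C_hom_verts[OF less.prems(2) xI z(3,1)] .
  show ?case
  proof (cases "z \<in> U")
    case True
    have "w \<otimes> inv (elt \<Lambda> (y, s)) \<in> hom x z"
      by (rule C_hom_mult[OF z(1) less.prems(1) C_hom_inv[OF inj(2) z(3)]])
    then show ?thesis using less.hyps[OF s(3)] zv True by blast
  next
    case False
    then have "z \<noteq> y" using less.prems by blast
    then have "(y, s) \<in> arcs G" using less.prems s z(2) by (simp add: G_simps)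
    moreover have "tail G (y, s) \<in> U" "head G (y, s) \<notin> U" using less.prems z(2) False by (auto simp: G_simps)
    ultimately show ?thesis by blast
  qed
qed

lemma arc_elt_closed: "e \<in> arcs G \<Longrightarrow> elt \<Lambda> e \<in> carrier W"
proof -
  assume e: "e \<in> arcs G"
  obtain x s where xs: "e = (x, s)" by fastforce
  show ?thesis using arc_properties[OF e[unfolded xs]] unfolding xs Y_hom_iff by (metis C_hom_closed)
qed

abbreviation pelt where "pelt \<equiv> path_elt W S \<Lambda>"

text \<open>What multiplicativity of \<open>path_elt\<close> requires. It depends only on the edge
  elements and is therefore visibly stable under \<open>perm_path\<close>.\<close>

definition good_path :: "('l, 'a) edge list \<Rightarrow> bool" where
  "good_path p \<longleftrightarrow> elt \<Lambda> ` set p \<subseteq> carrier W"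

lemma good_path_append [simp]: "good_path (p @ q) \<longleftrightarrow> good_path p \<and> good_path q"
  by (auto simp: good_path_def)

lemma good_path_arcs: "set p \<subseteq> arcs G \<Longrightarrow> good_path p"
  using arc_elt_closed by (auto simp: good_path_def)

lemma good_path_lists: "good_path p \<Longrightarrow> map (elt \<Lambda>) p \<in> lists (carrier W)"
  by (auto simp: good_path_def)

lemma pelt_append: "\<lbrakk>good_path p; good_path q\<rbrakk> \<Longrightarrow> pelt (p @ q) = pelt p \<otimes> pelt q"
  unfolding path_elt_def map_append by (rule wp_append) (rule good_path_lists, assumption)+

lemma pelt_closed: "good_path p \<Longrightarrow> pelt p \<in> carrier W"
  unfolding path_elt_def by (rule wp_closed[OF good_path_lists])

lemma pelt_single: "good_path [e] \<Longrightarrow> pelt [e] = elt \<Lambda> e"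
  by (simp add: path_elt_def good_path_def)

lemma pelt_reverse:
  assumes "set p \<subseteq> arcs G" shows "pelt (rev (map einv p)) = inv (pelt p)"
  using assms
proof (induction p)
  case Nil
  then show ?case by (simp add: path_elt_def)
next
  case (Cons e p)
  obtain x s where xs: "e = (x, s)" by fastforce
  have e: "e \<in> arcs G" "einv e \<in> arcs G" and p: "set p \<subseteq> arcs G" using Cons G.einv_arcs by auto
  have "set (rev (map einv p)) \<subseteq> arcs G" "set [einv e] \<subseteq> arcs G" "set [e] \<subseteq> arcs G"
    using e p G.einv_arcs by auto
  then have good: "good_path (rev (map einv p))" "good_path [einv e]" "good_path [e]" "good_path p"
    using p good_path_arcs by blast+
  have inv_e: "elt \<Lambda> (einv e) = inv (elt \<Lambda> e)"
    using arc_properties[OF e(1)[unfolded xs]] unfolding xs by metis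
  have "pelt (rev (map einv (e # p))) = inv (pelt p) \<otimes> inv (elt \<Lambda> e)"
    using Cons p good pelt_append[of "rev (map einv p)" "[einv e]"] by (simp add: pelt_single inv_e)
  also have "\<dots> = inv (elt \<Lambda> e \<otimes> pelt p)"
    using arc_elt_closed[OF e(1)] pelt_closed good by (simp add: inv_mult_group)
  also have "elt \<Lambda> e \<otimes> pelt p = pelt (e # p)" by (simp add: path_elt_def)
  finally show ?case .
qed

lemma pelt_Y_hom:
  assumes "is_path G z p y" shows "pelt p \<in> Yhom z y"
proof -
  have "pelt (rev w) \<in> Yhom z y" if "G.awalk y w z" for w
    using that
  proof (induction w arbitrary: y)
    case Nil
    then have "y = z" "z \<in> verts_C" by (auto simp: G.awalk_Nil_iff G_simps)
    then show ?case using Y_hom_one[OF C_verts_inj[of z]] by (simp add: path_elt_def)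
  next
    case (Cons e w)
    obtain x s where xs: "e = (x, s)" by fastforce
    have e: "e \<in> arcs G" "tail G e = y" "G.awalk (head G e) w z" using Cons by (auto simp: G.awalk_Cons_iff)
    then have xy: "x = y" by (simp add: xs G_simps)
    obtain y' where y': "x \<in> verts_C" "y' \<in> verts_C" "head G e = y'" "elt \<Lambda> e \<in> Yhom y' x"
      using arc_properties[OF e(1)[unfolded xs]] unfolding xs G_simps(3) by metis
    have "set (rev w) \<subseteq> arcs G" "set [e] \<subseteq> arcs G" using e by (auto simp: G.awalk_def)
    then have "good_path (rev w)" "good_path [e]" using good_path_arcs by blast+
    then have "pelt (rev (e # w)) = pelt (rev w) \<otimes> elt \<Lambda> e" by (simp add: pelt_append pelt_single)
    moreover have "pelt (rev w) \<in> Yhom z y'" using Cons.IH e(3) y'(3) by simp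
    ultimately show ?case
      using Y_hom_mult[OF C_verts_inj[OF y'(1)] C_verts_inj[OF y'(2)] _ y'(4)] xy by simp
  qed
  from this[of "rev p"] show ?thesis using assms by (simp add: is_path_def)
qed

lemma is_path_good: "is_path G z p y \<Longrightarrow> good_path p"
  by (rule good_path_arcs) (auto simp: is_path_def G.awalk_def)

text \<open>The element of an edge depends on its starting vertex only through the image set, which
  a permutation of \<Lambda> preserves.\<close>

lemma elt_perm: "\<rho> \<in> Bij \<Lambda> \<Longrightarrow> elt \<Lambda> (prm \<rho> y, s) = elt \<Lambda> (y, s)"
  by (simp add: perm_act_image)

lemma perm_path_elts:
  assumes "\<rho> \<in> Bij \<Lambda>" shows "map (elt \<Lambda>) (perm_path \<Lambda> \<rho> p) = map (elt \<Lambda>) p"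
  using elt_perm[OF assms] by (auto simp: perm_path_def simp del: edge_elt.simps)

lemma perm_path_pelt: "\<rho> \<in> Bij \<Lambda> \<Longrightarrow> pelt (perm_path \<Lambda> \<rho> p) = pelt p"
  by (simp add: path_elt_def perm_path_elts)

lemma perm_path_good: "\<rho> \<in> Bij \<Lambda> \<Longrightarrow> good_path (perm_path \<Lambda> \<rho> p) \<longleftrightarrow> good_path p"
  unfolding good_path_def using perm_path_elts[of \<rho> p] by (metis set_map)

section \<open>The group \<open>\<A>\<^sub>N\<close>\<close>

lemma A_Bij: "\<rho> \<in> A \<Longrightarrow> \<rho> \<in> Bij \<Lambda>"
  by (simp add: AN_def)

lemma A_verts: "\<rho> \<in> A \<Longrightarrow> prm \<rho> xI \<in> verts_C"
  by (simp add: AN_def)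

lemma A_I:
  assumes "\<rho> \<in> Bij \<Lambda>" "w \<in> hom xI (prm \<rho> xI)" shows "\<rho> \<in> A"
proof -
  have inj: "prm \<rho> xI \<in> inj_maps \<Lambda> S" using perm_act_inj_maps[OF assms(1) xI] .
  then show ?thesis using assms C_hom_inv[OF inj assms(2)] by (auto simp: AN_def C_verts_def)
qed

lemma hom_N:
  assumes "\<rho> \<in> Bij \<Lambda>" "w \<in> hom xI (prm \<rho> xI)" shows "w \<in> N"
proof -
  have "act w ` simple_root ` prm \<rho> xI ` \<Lambda> = simple_root ` I"
    unfolding image_image by (rule image_cong) (use C_hom_act[OF assms(2)] in auto)
  then show ?thesis using C_hom_closed[OF assms(2)] by (simp add: NI_def perm_act_image[OF assms(1)])
qed

lemma AN_map_eq:
  assumes "\<rho> \<in> Bij \<Lambda>" "w \<in> hom xI (prm \<rho> xI)" shows "AN_map W S \<Lambda> xI w = \<rho>"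
  unfolding AN_map_def
proof (rule the_equality)
  show "\<rho> \<in> A \<and> w \<in> hom xI (prm \<rho> xI)" using assms A_I by blast
  fix \<sigma> assume \<sigma>: "\<sigma> \<in> A \<and> w \<in> hom xI (prm \<sigma> xI)"
  then have \<sigma>B: "\<sigma> \<in> Bij \<Lambda>" using A_Bij by blast
  have "\<sigma> l = \<rho> l" if l: "l \<in> \<Lambda>" for l
  proof -
    have "simple_root (xI (\<sigma> l)) = simple_root (xI (\<rho> l))"
      using \<sigma> assms(2) l unfolding C_hom_perm_iff[OF \<sigma>B] C_hom_perm_iff[OF assms(1)] by metis
    then have "xI (\<sigma> l) = xI (\<rho> l)" by (simp add: simple_root_inj)
    then show ?thesis using xI Bij_closed[OF \<sigma>B l] Bij_closed[OF assms(1) l] by (auto simp: inj_maps_def dest: inj_onD)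
  qed
  then show "\<sigma> = \<rho>" using \<sigma>B assms(1) by (intro extensionalityI[of _ \<Lambda>]) (auto simp: Bij_def)
qed

text \<open>w permutes the simple roots of I, and the inverse of \<open>xI\<close> transports this
  permutation to \<Lambda>; it is restricted because bijections of \<Lambda> are
  extensional.\<close>

lemma N_hom_exists:
  assumes w: "w \<in> N" shows "\<exists>\<rho>\<in>Bij \<Lambda>. w \<in> hom xI (prm \<rho> xI)"
proof -
  have wc: "w \<in> carrier W" and im: "act w ` simple_root ` I = simple_root ` I" using w by (auto simp: NI_def)
  obtain y where y: "y \<in> inj_maps \<Lambda> S" "w \<in> hom y xI" "y ` \<Lambda> = I"
    using C_hom_exists[OF wc xI I_S im] by blast
  have inj: "inj_on xI \<Lambda>" "inj_on y \<Lambda>" using xI y by (auto simp: inj_maps_def)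
  let ?\<rho> = "restrict (inv_into \<Lambda> xI \<circ> y) \<Lambda>"
  have "bij_betw y \<Lambda> I" "bij_betw (inv_into \<Lambda> xI) I \<Lambda>"
    using inj y(3) by (auto simp: bij_betw_def intro: inj_on_inv_into)
  then have "bij_betw (inv_into \<Lambda> xI \<circ> y) \<Lambda> \<Lambda>" by (rule bij_betw_trans)
  then have \<rho>: "?\<rho> \<in> Bij \<Lambda>" by (auto simp: Bij_def cong: bij_betw_cong)
  have "act w (simple_root (xI l)) = simple_root (xI (?\<rho> l))" if "l \<in> \<Lambda>" for l
  proof -
    have "y l \<in> I" using y(3) that by blast
    then show ?thesis using C_hom_act[OF y(2) that] that by (simp add: f_inv_into_f)
  qed
  then have "w \<in> hom xI (prm ?\<rho> xI)" unfolding C_hom_perm_iff[OF \<rho>] using wc by blast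
  then show ?thesis using \<rho> by blast
qed

lemma hom_perm_mult:
  assumes "\<rho> \<in> Bij \<Lambda>" "\<sigma> \<in> Bij \<Lambda>" "v \<in> hom xI (prm \<rho> xI)" "w \<in> hom xI (prm \<sigma> xI)"
  shows "\<rho> \<otimes>\<^bsub>BijGroup \<Lambda>\<^esub> \<sigma> \<in> Bij \<Lambda>" "v \<otimes> w \<in> hom xI (prm (\<rho> \<otimes>\<^bsub>BijGroup \<Lambda>\<^esub> \<sigma>) xI)"
proof -
  show B: "\<rho> \<otimes>\<^bsub>BijGroup \<Lambda>\<^esub> \<sigma> \<in> Bij \<Lambda>"
    using monoid.m_closed[OF group.is_monoid[OF group_BijGroup], of \<rho> \<Lambda> \<sigma>] assms(1,2) by (simp add: BijGroup_def)
  show "v \<otimes> w \<in> hom xI (prm (\<rho> \<otimes>\<^bsub>BijGroup \<Lambda>\<^esub> \<sigma>) xI)"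
    unfolding C_hom_perm_iff[OF B]
  proof (intro conjI ballI)
    have c: "v \<in> carrier W" "w \<in> carrier W" using assms(3,4) C_hom_closed by auto
    then show "v \<otimes> w \<in> carrier W" by simp
    fix l assume l: "l \<in> \<Lambda>"
    have "act (v \<otimes> w) (simple_root (xI l)) = act v (act w (simple_root (xI l)))"
      using c inj_maps_mem[OF xI l] by (simp add: act_mult)
    also have "act w (simple_root (xI l)) = simple_root (xI (\<sigma> l))"
      using assms(4) l unfolding C_hom_perm_iff[OF assms(2)] by blast
    also have "act v (simple_root (xI (\<sigma> l))) = simple_root (xI (\<rho> (\<sigma> l)))"
      using assms(3) Bij_closed[OF assms(2) l] unfolding C_hom_perm_iff[OF assms(1)] by blast
    also have "\<rho> (\<sigma> l) = (\<rho> \<otimes>\<^bsub>BijGroup \<Lambda>\<^esub> \<sigma>) l"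
      using assms(1,2) l by (simp add: BijGroup_def compose_def)
    finally show "act (v \<otimes> w) (simple_root (xI l)) = simple_root (xI ((\<rho> \<otimes>\<^bsub>BijGroup \<Lambda>\<^esub> \<sigma>) l))" .
  qed
qed

lemma A_hom_exists:
  assumes "\<rho> \<in> A" shows "\<exists>w. w \<in> hom xI (prm \<rho> xI)"
  using assms C_hom_inv[OF xI] by (auto simp: AN_def C_verts_def)

lemma hom_perm_one: "w \<in> hom xI (prm \<one>\<^bsub>BijGroup \<Lambda>\<^esub> xI) \<longleftrightarrow> w \<in> hom xI xI"
  "\<one>\<^bsub>BijGroup \<Lambda>\<^esub> \<in> Bij \<Lambda>"
proof -
  show B: "\<one>\<^bsub>BijGroup \<Lambda>\<^esub> \<in> Bij \<Lambda>"
    using monoid.one_closed[OF group.is_monoid[OF group_BijGroup], of \<Lambda>] by (simp add: BijGroup_def)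
  show "w \<in> hom xI (prm \<one>\<^bsub>BijGroup \<Lambda>\<^esub> xI) \<longleftrightarrow> w \<in> hom xI xI"
  proof -
    have "\<one>\<^bsub>BijGroup \<Lambda>\<^esub> l = l" if "l \<in> \<Lambda>" for l using that by (simp add: BijGroup_def)
    then have "(\<forall>l\<in>\<Lambda>. act w (simple_root (xI l)) = simple_root (xI (\<one>\<^bsub>BijGroup \<Lambda>\<^esub> l)))
      \<longleftrightarrow> (\<forall>l\<in>\<Lambda>. simple_root (xI l) = act w (simple_root (xI l)))" by metis
    then show ?thesis by (subst C_hom_perm_iff[OF B]) (simp only: C_hom_def mem_Collect_eq)
  qed
qed

lemma A_subgroup: "subgroup A (BijGroup \<Lambda>)"
proof (rule group.subgroupI[OF group_BijGroup])
  show "A \<subseteq> carrier (BijGroup \<Lambda>)" using A_Bij by (auto simp: BijGroup_def)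
  have one: "\<one>\<^bsub>BijGroup \<Lambda>\<^esub> \<in> A"
    using A_I[OF hom_perm_one(2)] hom_perm_one(1) C_hom_one[OF xI] by blast
  then show "A \<noteq> {}" by blast
  show "\<rho> \<otimes>\<^bsub>BijGroup \<Lambda>\<^esub> \<sigma> \<in> A" if "\<rho> \<in> A" "\<sigma> \<in> A" for \<rho> \<sigma>
    using A_hom_exists[OF that(1)] A_hom_exists[OF that(2)] hom_perm_mult[OF A_Bij[OF that(1)] A_Bij[OF that(2)]] A_I by blast
  fix \<rho> assume \<rho>: "\<rho> \<in> A"
  note B = A_Bij[OF \<rho>]
  obtain w where w: "w \<in> hom xI (prm \<rho> xI)" using A_hom_exists[OF \<rho>] by blast
  have wc: "w \<in> carrier W" using w C_hom_closed by blast
  have "act (inv w) (simple_root (xI l)) = simple_root (xI ((inv\<^bsub>BijGroup \<Lambda>\<^esub> \<rho>) l))" if l: "l \<in> \<Lambda>" for l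
  proof -
    let ?m = "(inv\<^bsub>BijGroup \<Lambda>\<^esub> \<rho>) l"
    have m: "?m \<in> \<Lambda>" using Bij_closed[OF Bij_inv[OF B] l] .
    have "act w (simple_root (xI ?m)) = simple_root (xI (\<rho> ?m))" using w m unfolding C_hom_perm_iff[OF B] by blast
    then have "act w (simple_root (xI ?m)) = simple_root (xI l)" using Bij_inv_right[OF B l] by simp
    then show ?thesis using act_inv1[OF wc simple_root_V[OF inj_maps_mem[OF xI m]]] by metis
  qed
  then have "inv w \<in> hom xI (prm (inv\<^bsub>BijGroup \<Lambda>\<^esub> \<rho>) xI)"
    unfolding C_hom_perm_iff[OF Bij_inv[OF B]] using wc by simp
  then show "inv\<^bsub>BijGroup \<Lambda>\<^esub> \<rho> \<in> A" by (rule A_I[OF Bij_inv[OF B]])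
qed

lemma A_group: "group (AN_group W S \<Lambda> xI)"
  unfolding AN_group_def by (rule group.subgroup_imp_group[OF group_BijGroup A_subgroup])

lemma C_I_subgroup: "subgroup (hom xI xI) W"
  by (rule subgroupI) (use C_hom_closed C_hom_one[OF xI] C_hom_inv[OF xI] C_hom_mult[OF xI] in blast)+

text \<open>Taken with X = N_I and with \<open>Y_tilde\<close> as X, this gives both sequences.
  Surjectivity is a hypothesis because the witnesses come from h, which depends on a tree.\<close>

lemma short_exact_AN:
  assumes X: "subgroup X W" "X \<subseteq> N" and surj: "\<And>\<rho>. \<rho> \<in> A \<Longrightarrow> \<exists>w\<in>X. w \<in> hom xI (prm \<rho> xI)"
  shows "short_exact (W\<lparr>carrier := X \<inter> hom xI xI\<rparr>) (W\<lparr>carrier := X\<rparr>) (AN_group W S \<Lambda> xI)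
    id (AN_map W S \<Lambda> xI)"
proof -
  have K: "subgroup (X \<inter> hom xI xI) W" using subgroups_Inter_pair[OF X(1) C_I_subgroup] .
  have hX: "AN_map W S \<Lambda> xI w \<in> A" "AN_map W S \<Lambda> xI w \<in> Bij \<Lambda>" "w \<in> hom xI (prm (AN_map W S \<Lambda> xI w) xI)"
    if w: "w \<in> X" for w
  proof -
    obtain \<rho> where r: "\<rho> \<in> Bij \<Lambda>" "w \<in> hom xI (prm \<rho> xI)" using N_hom_exists w X(2) by blast
    then show "AN_map W S \<Lambda> xI w \<in> A" "AN_map W S \<Lambda> xI w \<in> Bij \<Lambda>" "w \<in> hom xI (prm (AN_map W S \<Lambda> xI w) xI)"
      using AN_map_eq[OF r] A_I[OF r] by auto
  qed
  have "id \<in> mon (W\<lparr>carrier := X \<inter> hom xI xI\<rparr>) (W\<lparr>carrier := X\<rparr>)"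
    by (auto simp: mon_def hom_def)
  moreover have "AN_map W S \<Lambda> xI \<in> epi (W\<lparr>carrier := X\<rparr>) (AN_group W S \<Lambda> xI)"
    unfolding epi_def
  proof (intro CollectI conjI)
    show "AN_map W S \<Lambda> xI \<in> Group.hom (W\<lparr>carrier := X\<rparr>) (AN_group W S \<Lambda> xI)"
    proof (rule homI)
      fix v w assume "v \<in> carrier (W\<lparr>carrier := X\<rparr>)" "w \<in> carrier (W\<lparr>carrier := X\<rparr>)"
      then have vw: "v \<in> X" "w \<in> X" by auto
      note m = hom_perm_mult[OF hX(2)[OF vw(1)] hX(2)[OF vw(2)] hX(3)[OF vw(1)] hX(3)[OF vw(2)]]
      show "AN_map W S \<Lambda> xI (v \<otimes>\<^bsub>W\<lparr>carrier := X\<rparr>\<^esub> w) =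
        AN_map W S \<Lambda> xI v \<otimes>\<^bsub>AN_group W S \<Lambda> xI\<^esub> AN_map W S \<Lambda> xI w"
        using AN_map_eq[OF m] by (simp add: AN_group_def)
    qed (use hX in \<open>auto simp: AN_group_def\<close>)
    show "AN_map W S \<Lambda> xI ` carrier (W\<lparr>carrier := X\<rparr>) = carrier (AN_group W S \<Lambda> xI)"
    proof (intro equalityI subsetI)
      fix \<rho> assume "\<rho> \<in> carrier (AN_group W S \<Lambda> xI)"
      then have r: "\<rho> \<in> A" by (simp add: AN_group_def)
      then obtain w where "w \<in> X" "w \<in> hom xI (prm \<rho> xI)" using surj by blast
      then show "\<rho> \<in> AN_map W S \<Lambda> xI ` carrier (W\<lparr>carrier := X\<rparr>)" using AN_map_eq[OF A_Bij[OF r]] by force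
    qed (use hX in \<open>auto simp: AN_group_def\<close>)
  qed
  moreover have "kernel (W\<lparr>carrier := X\<rparr>) (AN_group W S \<Lambda> xI) (AN_map W S \<Lambda> xI) = X \<inter> hom xI xI"
  proof -
    have "AN_map W S \<Lambda> xI w = \<one>\<^bsub>BijGroup \<Lambda>\<^esub> \<longleftrightarrow> w \<in> hom xI xI" if w: "w \<in> X" for w
      using hX(3)[OF w] hom_perm_one AN_map_eq[OF hom_perm_one(2)] by metis
    then show ?thesis by (auto simp: kernel_def AN_group_def)
  qed
  ultimately show ?thesis unfolding short_exact_def
    using subgroup_imp_group[OF K] subgroup_imp_group[OF X(1)] A_group by simp
qed

lemma hom_sub_N: "hom xI xI \<subseteq> N"
  using hom_N[OF hom_perm_one(2)] hom_perm_one(1) by blast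

lemma Y_hom_Y_tilde:
  assumes "\<rho> \<in> Bij \<Lambda>" "w \<in> Yhom xI (prm \<rho> xI)" shows "w \<in> Y_tilde W S I"
  using assms hom_N[OF assms(1)] by (simp add: Y_tilde_iff[OF I_S] Y_hom_iff perm_act_image)

text \<open>Puts the kernel of the second sequence into the form X \<inter> C_I of
  \<open>short_exact_AN\<close>.\<close>

lemma Y_I_eq: "Yhom xI xI = Y_tilde W S I \<inter> hom xI xI"
  using hom_sub_N by (auto simp: Y_tilde_iff[OF I_S] Y_hom_iff)

lemma perm_prod_A:
  assumes "\<And>i. i \<in> {1..k} \<Longrightarrow> r i \<in> A" shows "perm_prod \<Lambda> r k \<in> A"
proof -
  have "foldr (monoid.mult (BijGroup \<Lambda>)) xs \<one>\<^bsub>BijGroup \<Lambda>\<^esub> \<in> A" if "set xs \<subseteq> A" for xs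
    using that by (induction xs) (auto simp: subgroup.one_closed[OF A_subgroup] subgroup.m_closed[OF A_subgroup])
  moreover have "set (map r [1..<Suc k]) \<subseteq> A" using assms by auto
  ultimately show ?thesis unfolding perm_prod_def by blast
qed

end

section \<open>The section \<open>h\<close>\<close>

locale normalizer_section = normalizer_groupoid W S \<Lambda> xI
  for W :: "('a, 'b) monoid_scheme" (structure) and S :: "'a set" and \<Lambda> :: "'l set" and xI :: "'l \<Rightarrow> 'a" +
  fixes T :: "('l \<Rightarrow> 'a, ('l, 'a) edge) pre_digraph"
  assumes maximal_tree_T: "maximal_tree (edge_inv W S \<Lambda>) (Y1_graph W S \<Lambda> xI) T"
begin

lemma T_tree: "subgraph T G" "is_tree einv T"
  using maximal_tree_T by (auto simp: maximal_tree_def pre_digraph.max_subgraph_def)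

sublocale T: inverse_digraph T einv
  by (rule G.subgraph_inverse_digraph[OF T_tree(1)]) (use T_tree(2) in \<open>simp add: is_tree_def\<close>)

lemma T_verts: "verts T = verts_C"
proof -
  have "verts T = verts G"
  proof (rule G.maximal_tree_spanning[OF maximal_tree_T])
    fix U assume U: "U \<subseteq> verts G" "U \<noteq> {}" "U \<noteq> verts G"
    then obtain x y where xy: "x \<in> verts_C" "x \<notin> U" "y \<in> verts_C" "y \<in> U" by (auto simp: G_simps)
    obtain w where "w \<in> hom x y" using C_verts_hom[OF xy(1,3) xI] by blast
    then show "\<exists>e\<in>arcs G. tail G e \<in> U \<and> head G e \<notin> U" using G_cut_arc xy by blast
  qed
  then show ?thesis by (simp add: G_simps)
qed

abbreviation pp where "pp \<equiv> p_path W S \<Lambda> T"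
abbreviation h where "h \<equiv> h_map W S \<Lambda> T xI"

lemma pp_path:
  assumes "y \<in> verts_C" "z \<in> verts_C" shows "is_path G z (pp z y) y"
proof -
  have "T.awalk y (rev (pp z y)) z"
    using T.tree_path_props(1)[OF T_tree(2), of y z] assms T_verts by (simp add: p_path_def is_path_def)
  then have "G.awalk y (rev (pp z y)) z" using G.subgraph_awalk_imp_awalk[OF _ T_tree(1)] by blast
  then show ?thesis by (simp add: is_path_def)
qed

lemma pp_inverse:
  assumes "y \<in> verts_C" "z \<in> verts_C" shows "pelt (pp y z) = inv (pelt (pp z y))"
proof -
  have "pp y z = rev (map einv (pp z y))"
    using T.tree_path_reverse[OF T_tree(2), of y z] assms T_verts by (simp add: p_path_def)
  moreover have "set (pp z y) \<subseteq> arcs G" using pp_path[OF assms] by (auto simp: is_path_def G.awalk_def)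
  ultimately show ?thesis by (simp add: pelt_reverse)
qed

lemma h_eq: "h \<rho> = pelt (pp xI (prm \<rho> xI))"
  by (simp add: h_map_def)

lemma h_path: "\<rho> \<in> A \<Longrightarrow> is_path G xI (pp xI (prm \<rho> xI)) (prm \<rho> xI)"
  using pp_path[OF A_verts xI_verts] .

lemma h_Y_hom: "\<rho> \<in> A \<Longrightarrow> h \<rho> \<in> Yhom xI (prm \<rho> xI)"
  unfolding h_eq by (rule pelt_Y_hom[OF h_path])

lemma h_hom: "\<rho> \<in> A \<Longrightarrow> h \<rho> \<in> hom xI (prm \<rho> xI)"
  using h_Y_hom by (simp add: Y_hom_iff)

lemma h_closed: "\<rho> \<in> A \<Longrightarrow> h \<rho> \<in> carrier W"
  using h_hom C_hom_closed by blast

lemma h_Y_tilde: "\<rho> \<in> A \<Longrightarrow> h \<rho> \<in> Y_tilde W S I"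
  using Y_hom_Y_tilde[OF A_Bij h_Y_hom] .

lemma AN_map_h: "\<rho> \<in> A \<Longrightarrow> AN_map W S \<Lambda> xI (h \<rho>) = \<rho>"
  using AN_map_eq[OF A_Bij h_hom] .

lemma h_inverse: "\<rho> \<in> A \<Longrightarrow> pelt (pp (prm \<rho> xI) xI) = inv (h \<rho>)"
  unfolding h_eq using pp_inverse[OF A_verts xI_verts] .

lemma N_exact:
  "short_exact (W\<lparr>carrier := hom xI xI\<rparr>) (W\<lparr>carrier := N\<rparr>) (AN_group W S \<Lambda> xI) id (AN_map W S \<Lambda> xI)"
proof -
  have "N \<inter> hom xI xI = hom xI xI" using hom_sub_N by blast
  moreover have "\<exists>w\<in>N. w \<in> hom xI (prm \<rho> xI)" if "\<rho> \<in> A" for \<rho>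
    using h_hom[OF that] hom_N[OF A_Bij[OF that]] by blast
  ultimately show ?thesis using short_exact_AN[OF NI_subgroup[OF I_S]] by simp
qed

lemma Y_exact:
  "short_exact (W\<lparr>carrier := Yhom xI xI\<rparr>) (W\<lparr>carrier := Y_tilde W S I\<rparr>) (AN_group W S \<Lambda> xI) id (AN_map W S \<Lambda> xI)"
proof -
  have "\<exists>w\<in>Y_tilde W S I. w \<in> hom xI (prm \<rho> xI)" if "\<rho> \<in> A" for \<rho>
    using h_hom[OF that] h_Y_tilde[OF that] by blast
  moreover have "Y_tilde W S I \<subseteq> N" using Y_tilde_NI by blast
  ultimately show ?thesis unfolding Y_I_eq using short_exact_AN[OF Y_tilde_subgroup[OF I_S]] by simp
qed

text \<open>The tree paths attached by \<open>transport\<close> represent the inverse of h_\<rho>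
  and h_\<rho> itself, and permuting the path leaves its element unchanged.\<close>

lemma h_conjugate:
  assumes "c \<in> pi1 einv G xI" "q \<in> c" and \<rho>: "\<rho> \<in> A"
  shows "inv (h \<rho>) \<otimes> pelt q \<otimes> h \<rho> =
    pelt (perm_path \<Lambda> (inv\<^bsub>BijGroup \<Lambda>\<^esub> \<rho>) (transport einv T (prm \<rho> xI) xI xI q))"
proof -
  \<comment> \<open>\<open>homotopy\<close> is restricted to closed paths at the base point, so
    every member of a class is one.\<close>
  have q: "is_path G xI q xI"
    using assms(1,2) by (auto simp: pi1_def quotient_def homotopy_def Let_def)
  have good: "good_path q" "good_path (pp xI (prm \<rho> xI))" "good_path (pp (prm \<rho> xI) xI)"
    using is_path_good[OF q] is_path_good[OF h_path[OF \<rho>]] is_path_good[OF pp_path[OF xI_verts A_verts[OF \<rho>]]] by auto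
  have "pelt (perm_path \<Lambda> (inv\<^bsub>BijGroup \<Lambda>\<^esub> \<rho>) (transport einv T (prm \<rho> xI) xI xI q))
    = pelt (pp (prm \<rho> xI) xI @ q @ pp xI (prm \<rho> xI))"
    unfolding perm_path_pelt[OF Bij_inv[OF A_Bij[OF \<rho>]]] by (simp add: transport_def p_path_def)
  also have "\<dots> = inv (h \<rho>) \<otimes> (pelt q \<otimes> h \<rho>)"
    using good by (simp add: pelt_append h_inverse[OF \<rho>] h_eq[symmetric])
  finally show ?thesis using h_closed[OF \<rho>] pelt_closed[OF good(1)] by (simp add: m_assoc)
qed

text \<open>Each permuted tree path still represents its h factor, so these paths already multiply
  to the left side; the final tree path represents the inverse of the trailing h and cancels
  it.\<close>

lemma h_product:
  assumes "k \<ge> 1" and r: "\<And>i. i \<in> {1..k} \<Longrightarrow> r i \<in> A"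
  shows "wp (map (\<lambda>i. h (r i)) [1..<Suc k]) =
    pelt (pp xI (prm (r 1) xI) @
      concat (map (\<lambda>i. perm_path \<Lambda> (perm_prod \<Lambda> r i) (pp xI (prm (r (Suc i)) xI))) [1..<k]) @
      pp (prm (perm_prod \<Lambda> r k) xI) xI) \<otimes> h (perm_prod \<Lambda> r k)"
proof -
  \<comment> \<open>Entry i accounts for the factor i + 1. The first tree path covers factor 1, so
    the entries run from 1 to k - 1.\<close>
  define f where "f i = perm_path \<Lambda> (perm_prod \<Lambda> r i) (pp xI (prm (r (Suc i)) xI))" for i
  have good: "good_path (pp xI (prm (r 1) xI) @ concat (map f [1..<k])) \<and>
    pelt (pp xI (prm (r 1) xI) @ concat (map f [1..<k])) = wp (map (\<lambda>i. h (r i)) [1..<Suc k])"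
    using assms
  proof (induction k rule: nat_induct_at_least)
    case base
    have "r 1 \<in> A" using base by simp
    then show ?case using is_path_good[OF h_path[of "r 1"]] h_closed[of "r 1"] by (simp add: h_eq[symmetric])
  next
    case (Suc n)
    let ?p = "pp xI (prm (r 1) xI) @ concat (map f [1..<n])"
    have IH: "good_path ?p" "pelt ?p = wp (map (\<lambda>i. h (r i)) [1..<Suc n])" using Suc by auto
    have rS: "r (Suc n) \<in> A" and rn: "perm_prod \<Lambda> r n \<in> A" using Suc by (auto intro: perm_prod_A)
    have fn: "good_path (f n)" "pelt (f n) = h (r (Suc n))"
      unfolding f_def perm_path_good[OF A_Bij[OF rn]] perm_path_pelt[OF A_Bij[OF rn]] h_eq
      using is_path_good[OF h_path[OF rS]] by auto
    have upt: "[1..<Suc n] = [1..<n] @ [n]" "[1..<Suc (Suc n)] = [1..<Suc n] @ [Suc n]" using Suc.hyps by auto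
    have cl: "map (\<lambda>i. h (r i)) [1..<Suc n] \<in> lists (carrier W)" using Suc.prems h_closed by auto
    have "pp xI (prm (r 1) xI) @ concat (map f [1..<Suc n]) = ?p @ f n" unfolding upt(1) by simp
    moreover have "good_path (?p @ f n)" using IH(1) fn(1) by simp
    moreover have "pelt (?p @ f n) = wp (map (\<lambda>i. h (r i)) [1..<Suc (Suc n)])"
      unfolding pelt_append[OF IH(1) fn(1)] IH(2) fn(2) upt(2) map_append
      using wp_append[OF cl, of "[h (r (Suc n))]"] h_closed[OF rS] by simp
    ultimately show ?case by simp
  qed
  let ?\<rho> = "perm_prod \<Lambda> r k"
  have \<rho>: "?\<rho> \<in> A" using r by (rule perm_prod_A)
  have last: "good_path (pp (prm ?\<rho> xI) xI)" using is_path_good[OF pp_path[OF xI_verts A_verts[OF \<rho>]]] .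
  have "pelt ((pp xI (prm (r 1) xI) @ concat (map f [1..<k])) @ pp (prm ?\<rho> xI) xI) \<otimes> h ?\<rho>
    = wp (map (\<lambda>i. h (r i)) [1..<Suc k]) \<otimes> inv (h ?\<rho>) \<otimes> h ?\<rho>"
    using good pelt_append[OF _ last] h_inverse[OF \<rho>] by metis
  also have "\<dots> = wp (map (\<lambda>i. h (r i)) [1..<Suc k])"
  proof -
    have "wp (map (\<lambda>i. h (r i)) [1..<Suc k]) \<in> carrier W" using good pelt_closed by metis
    then show ?thesis using h_closed[OF \<rho>] by (simp only: m_assoc inv_closed l_inv r_one)
  qed
  finally show ?thesis unfolding f_def[abs_def] append_assoc by (rule sym)
qed

end

theorem theorem5p7:
  fixes W :: "('a, 'b) monoid_scheme" and S I :: "'a set"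
    and \<Lambda> :: "'l set" and xI :: "'l \<Rightarrow> 'a"
    and T :: "('l \<Rightarrow> 'a, ('l, 'a) edge) pre_digraph"
  assumes "coxeter_system W S"
    and "I \<subseteq> S"
    and "xI \<in> inj_maps \<Lambda> S" and "xI ` \<Lambda> = I"
    and "maximal_tree (edge_inv W S \<Lambda>) (Y1_graph W S \<Lambda> xI) T"
  shows
    "short_exact (W\<lparr>carrier := C_hom W S \<Lambda> xI xI\<rparr>) (W\<lparr>carrier := NI W S I\<rparr>) (AN_group W S \<Lambda> xI)
       id (AN_map W S \<Lambda> xI) \<and>
     (\<forall>\<rho>\<in>AN W S \<Lambda> xI. AN_map W S \<Lambda> xI (h_map W S \<Lambda> T xI \<rho>) = \<rho>) \<and>
     h_map W S \<Lambda> T xI ` AN W S \<Lambda> xI \<subseteq> Y_tilde W S I \<and>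
     short_exact (W\<lparr>carrier := Y_hom W S \<Lambda> xI xI\<rparr>) (W\<lparr>carrier := Y_tilde W S I\<rparr>) (AN_group W S \<Lambda> xI)
       id (AN_map W S \<Lambda> xI) \<and>
     is_semidirect W (NI W S I) (perp_group W S I) (Y_tilde W S I) \<and>
     conj_on W (perp_group W S I) \<in> hom (W\<lparr>carrier := Y_tilde W S I\<rparr>)
       (coxeter_Aut (W\<lparr>carrier := perp_group W S I\<rparr>) (perp_gens W S I)) \<and>
     is_semidirect W (normalizer W (generate W I)) (generate W I)
       (perp_group W S I <#>\<^bsub>W\<^esub> Y_tilde W S I) \<and>
     is_semidirect W (perp_group W S I <#>\<^bsub>W\<^esub> Y_tilde W S I) (perp_group W S I) (Y_tilde W S I) \<and>
     is_direct W (generate W I <#>\<^bsub>W\<^esub> perp_group W S I) (generate W I) (perp_group W S I) \<and>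
     is_semidirect W (normalizer W (generate W I)) (generate W I <#>\<^bsub>W\<^esub> perp_group W S I)
       (Y_tilde W S I) \<and>
     (\<forall>c \<in> pi1 (edge_inv W S \<Lambda>) (Y1_graph W S \<Lambda> xI) xI. \<forall>q\<in>c. \<forall>\<rho>\<in>AN W S \<Lambda> xI.
        inv\<^bsub>W\<^esub> h_map W S \<Lambda> T xI \<rho> \<otimes>\<^bsub>W\<^esub> path_elt W S \<Lambda> q \<otimes>\<^bsub>W\<^esub> h_map W S \<Lambda> T xI \<rho> =
        path_elt W S \<Lambda> (perm_path \<Lambda> (inv\<^bsub>BijGroup \<Lambda>\<^esub> \<rho>)
          (transport (edge_inv W S \<Lambda>) T (perm_act \<Lambda> \<rho> xI) xI xI q))) \<and>
     (\<forall>k\<ge>1. \<forall>r :: nat \<Rightarrow> 'l \<Rightarrow> 'l. (\<forall>i\<in>{1..k}. r i \<in> AN W S \<Lambda> xI) \<longrightarrow>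
        word_prod W (map (\<lambda>i. h_map W S \<Lambda> T xI (r i)) [1..<Suc k]) =
        path_elt W S \<Lambda>
          (p_path W S \<Lambda> T xI (perm_act \<Lambda> (r 1) xI) @
           concat (map (\<lambda>i. perm_path \<Lambda> (perm_prod \<Lambda> r i)
                              (p_path W S \<Lambda> T xI (perm_act \<Lambda> (r (Suc i)) xI))) [1..<k]) @
           p_path W S \<Lambda> T (perm_act \<Lambda> (perm_prod \<Lambda> r k) xI) xI)
        \<otimes>\<^bsub>W\<^esub> h_map W S \<Lambda> T xI (perm_prod \<Lambda> r k))"
proof -
  have "group W" using assms(1) by (simp add: coxeter_system_def)
  then interpret coxeter W S
    using assms(1) by (intro coxeter.intro coxeter_axioms.intro)
  interpret normalizer_section W S \<Lambda> xI T
    by unfold_locales (use assms in auto)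
  have I: "I \<subseteq> S" "xI ` \<Lambda> = I" using assms by auto
  \<comment> \<open>In the iterated decomposition the inner product of subgroups is N_I, so both
    layers reduce to the decompositions of N_I and of the normalizer.\<close>
  have "is_semidirect W (perp_group W S I <#>\<^bsub>W\<^esub> Y_tilde W S I) (perp_group W S I) (Y_tilde W S I)"
    unfolding perp_times_Y_tilde[OF I(1)] by (rule NI_semidirect[OF I(1)])
  moreover have "is_semidirect W (normalizer W (generate W I)) (generate W I) (perp_group W S I <#>\<^bsub>W\<^esub> Y_tilde W S I)"
    unfolding perp_times_Y_tilde[OF I(1)] by (rule normalizer_semidirect[OF I(1)])
  ultimately show ?thesis
    using N_exact Y_exact AN_map_h h_Y_tilde NI_semidirect[OF I(1)] conj_on_coxeter_Aut[OF I(1)]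
      parabolic_perp_direct[OF I(1)] normalizer_semidirect'[OF I(1)] h_conjugate h_product
    unfolding I(2) by (intro conjI ballI allI impI) auto
qed

end
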